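(* There is a large absolute constant $C$ such that the following holds. Suppose $k\ge2$ is an integer and $y\ge C\log^2 x$. Then $$\mathbb E\left(\left|\sum_{n\le x}X_n-\Psi_0(x,y;X_n)\right|^{2k}\right)^{\frac1{2k}}\ll\Psi(x,y)\left(\frac{k\log y\,\log^2x}{y}\right)^{\frac12}\exp\left(O\left(\frac{k\log^2x\,\log\log x}{y}\right)\right).$$
   Context: $(X_n)_{n\ge1}$ is a random completely multiplicative function: for primes $p$, the $X_p$ are independent random variables uniformly distributed on the unit circle, and $X_n=\prod_i X_{p_i}^{a_i}$ if $n=\prod_i p_i^{a_i}$. $\mathbb E$ denotes expectation. $\Psi_0(x,y;X_n)=\sum X_n$, summed over positive integers $n\le x$ all of whose prime factors are at most $y$, and $\Psi(x,y)$ is the number of such integers. Implied constants are absolute. *)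

theory Defs
  imports "HOL-Probability.Probability" "HOL-Computational_Algebra.Computational_Algebra"
begin

definition circle_uniform :: "complex measure" where
  "circle_uniform = distr (uniform_measure lborel {0..2 * pi}) borel cis"

text \<open>
  The value at \<open>0\<close> is left unspecified: the process is indexed by the positive integers.
\<close>
locale random_completely_multiplicative = prob_space M for M :: "'a measure" +
  fixes X :: "nat \<Rightarrow> 'a \<Rightarrow> complex"
  assumes indep: "indep_vars (\<lambda>_. borel) X {p. prime p}"
    and uniform: "\<And>p. prime p \<Longrightarrow> distr M borel (X p) = circle_uniform"
    and multiplicative: "\<And>n \<omega>. n > 0 \<Longrightarrow> \<omega> \<in> space M \<Longrightarrow>
      X n \<omega> = (\<Prod>p\<in>prime_factors n. X p \<omega> ^ multiplicity p n)"

definition ints_upto :: "real \<Rightarrow> nat set" where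
  "ints_upto x = {n. n > 0 \<and> real n \<le> x}"

definition smooth_upto :: "real \<Rightarrow> real \<Rightarrow> nat set" where
  "smooth_upto x y = {n. n > 0 \<and> real n \<le> x \<and> (\<forall>p\<in>prime_factors n. real p \<le> y)}"

definition Psi :: "real \<Rightarrow> real \<Rightarrow> nat" where
  "Psi x y = card (smooth_upto x y)"

definition Psi0 :: "real \<Rightarrow> real \<Rightarrow> (nat \<Rightarrow> complex) \<Rightarrow> complex" where
  "Psi0 x y f = (\<Sum>n\<in>smooth_upto x y. f n)"

lemma finite_ints_upto [simp]: "finite (ints_upto x)"
proof (rule finite_subset)
  show "ints_upto x \<subseteq> {..nat \<lfloor>x\<rfloor>}"
    by (auto simp: ints_upto_def) linarith
qed simp

lemma smooth_upto_subset: "smooth_upto x y \<subseteq> ints_upto x"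
  by (auto simp: smooth_upto_def ints_upto_def)

lemma finite_smooth_upto [simp]: "finite (smooth_upto x y)"
  using finite_subset[OF smooth_upto_subset finite_ints_upto] .

lemma prob_space_circle_uniform: "prob_space circle_uniform"
proof -
  have "cis \<in> borel_measurable borel"
    by (intro borel_measurable_continuous_onI continuous_intros)
  then have cis: "cis \<in> borel_measurable (uniform_measure lborel {0..2 * pi})"
    by (simp add: uniform_measure_def)
  interpret prob_space "uniform_measure lborel {0..2 * pi}"
    by (rule prob_space_uniform_measure) (auto simp: pi_ge_zero)
  show ?thesis
    unfolding circle_uniform_def using cis by (rule prob_space_distr)
qed

lemma sets_circle_uniform [simp, measurable_cong]: "sets circle_uniform = sets borel"
  by (simp add: circle_uniform_def)

lemma space_circle_uniform [simp]: "space circle_uniform = UNIV"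
  by (simp add: circle_uniform_def)

text \<open>
  A random completely multiplicative function exists, and the moments of its partial sums do not
  depend on the underlying probability space, not even on the type of its points.
\<close>

lemma random_completely_multiplicative_exists:
  "random_completely_multiplicative (PiM {p::nat. prime p} (\<lambda>_. circle_uniform))
     (\<lambda>n \<omega>. \<Prod>p\<in>prime_factors n. \<omega> p ^ multiplicity p n)"
proof -
  let ?P = "{p::nat. prime p}"
  let ?M = "PiM ?P (\<lambda>_. circle_uniform)"
  let ?X = "\<lambda>(n::nat) \<omega>. \<Prod>p\<in>prime_factors n. \<omega> p ^ multiplicity p n"
  interpret prob_space ?M
    by (intro prob_space_PiM prob_space_circle_uniform)
  have X: "?X p = (\<lambda>\<omega>. \<omega> p)" if "prime p" for p
    using that by (auto simp: prime_prime_factors)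
  have rv: "(\<lambda>\<omega>. \<omega> p) \<in> borel_measurable ?M" if "prime p" for p
    using that measurable_component_singleton[of p ?P "\<lambda>_. circle_uniform"] by simp
  have uni: "distr ?M borel (\<lambda>\<omega>. \<omega> p) = circle_uniform" if "prime p" for p
  proof -
    have "distr ?M borel (\<lambda>\<omega>. \<omega> p) = distr ?M circle_uniform (\<lambda>\<omega>. \<omega> p)"
      by (rule distr_cong) auto
    also have "\<dots> = circle_uniform"
      using distr_PiM_component[of ?P "\<lambda>_. circle_uniform" p] that
      by (simp add: prob_space_circle_uniform)
    finally show ?thesis .
  qed
  have "indep_vars (\<lambda>_. borel) (\<lambda>p \<omega>. \<omega> p) ?P"
  proof (subst indep_vars_iff_distr_eq_PiM')
    show "?P \<noteq> {}" using two_is_prime_nat by blast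
    show "random_variable borel (\<lambda>\<omega>. \<omega> p)" if "p \<in> ?P" for p
      using rv that by simp
    have "distr ?M (\<Pi>\<^sub>M p\<in>?P. borel) (\<lambda>\<omega>. \<lambda>p\<in>?P. \<omega> p) = distr ?M ?M (\<lambda>\<omega>. \<omega>)"
    proof (rule distr_cong)
      show "sets (\<Pi>\<^sub>M p\<in>?P. borel) = sets ?M" by (intro sets_PiM_cong) auto
      show "(\<lambda>p\<in>?P. \<omega> p) = \<omega>" if "\<omega> \<in> space ?M" for \<omega>
        using that by (auto simp: space_PiM PiE_restrict)
    qed simp
    also have "\<dots> = ?M" by (rule distr_id2) simp
    also have "\<dots> = (\<Pi>\<^sub>M p\<in>?P. distr ?M borel (\<lambda>\<omega>. \<omega> p))"
      by (intro PiM_cong) (simp_all add: uni)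
    finally show "distr ?M (\<Pi>\<^sub>M p\<in>?P. borel) (\<lambda>\<omega>. \<lambda>p\<in>?P. \<omega> p) =
      (\<Pi>\<^sub>M p\<in>?P. distr ?M borel (\<lambda>\<omega>. \<omega> p))" .
  qed
  moreover have "indep_vars (\<lambda>_. borel) ?X ?P = indep_vars (\<lambda>_. borel) (\<lambda>p \<omega>. \<omega> p) ?P"
    by (rule indep_vars_cong) (simp_all add: X)
  ultimately have ind: "indep_vars (\<lambda>_. borel) ?X ?P" by simp
  show ?thesis
  proof unfold_locales
    show "indep_vars (\<lambda>_. borel) ?X ?P" by (rule ind)
    show "distr ?M borel (?X p) = circle_uniform" if "prime p" for p
      using that uni by (simp add: X)
    show "?X n \<omega> = (\<Prod>p\<in>prime_factors n. ?X p \<omega> ^ multiplicity p n)"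
      if "n > 0" "\<omega> \<in> space ?M" for n \<omega>
    proof (rule prod.cong[OF refl])
      fix p assume "p \<in> prime_factors n"
      then have "prime p" by auto
      then show "\<omega> p ^ multiplicity p n = ?X p \<omega> ^ multiplicity p n"
        by (simp only: fun_cong[OF X])
    qed
  qed
qed

lemma (in random_completely_multiplicative) expectation_partial_sums:
  "expectation (\<lambda>\<omega>. norm ((\<Sum>n\<in>ints_upto x. X n \<omega>) - Psi0 x y (\<lambda>n. X n \<omega>)) ^ m) =
   (\<integral>u. norm ((\<Sum>n\<in>ints_upto x. \<Prod>p\<in>prime_factors n. u p ^ multiplicity p n)
          - Psi0 x y (\<lambda>n. \<Prod>p\<in>prime_factors n. u p ^ multiplicity p n)) ^ m
      \<partial>PiM {p. prime p} (\<lambda>_. circle_uniform))"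
  (is "_ = (\<integral>u. ?F u \<partial>_)")
proof -
  let ?P = "{p::nat. prime p}"
  let ?N = "\<Pi>\<^sub>M p\<in>?P. (borel :: complex measure)"
  let ?T = "\<lambda>\<omega>. \<lambda>p\<in>?P. X p \<omega>"
  have rv: "X p \<in> borel_measurable M" if "p \<in> ?P" for p
    using indep that unfolding indep_vars_def by blast
  have "?P \<noteq> {}" using two_is_prime_nat by blast
  then have "distr M ?N ?T = (\<Pi>\<^sub>M p\<in>?P. distr M borel (X p))"
    using indep indep_vars_iff_distr_eq_PiM'[of ?P X "\<lambda>_. borel"] rv by blast
  also have "\<dots> = PiM ?P (\<lambda>_. circle_uniform)"
    by (intro PiM_cong) (simp_all add: uniform)
  finally have law: "distr M ?N ?T = PiM ?P (\<lambda>_. circle_uniform)" .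
  have T: "?T \<in> measurable M ?N" by (intro measurable_restrict rv)
  have monom: "(\<lambda>u. \<Prod>p\<in>prime_factors n. u p ^ multiplicity p n) \<in> borel_measurable ?N" for n
    by (intro borel_measurable_prod borel_measurable_power measurable_component_singleton) auto
  have F: "?F \<in> borel_measurable ?N"
    unfolding Psi0_def
    by (intro borel_measurable_power measurable_compose[OF _ borel_measurable_norm]
        borel_measurable_diff borel_measurable_sum monom)
  have eq: "X n \<omega> = (\<Prod>p\<in>prime_factors n. ?T \<omega> p ^ multiplicity p n)"
    if "n > 0" "\<omega> \<in> space M" for n \<omega>
    unfolding multiplicative[OF that] by (intro prod.cong) auto
  have "expectation (\<lambda>\<omega>. norm ((\<Sum>n\<in>ints_upto x. X n \<omega>) - Psi0 x y (\<lambda>n. X n \<omega>)) ^ m)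
      = expectation (\<lambda>\<omega>. ?F (?T \<omega>))"
  proof (rule Bochner_Integration.integral_cong[OF refl])
    fix \<omega> assume \<omega>: "\<omega> \<in> space M"
    have "(\<Sum>n\<in>ints_upto x. X n \<omega>) =
        (\<Sum>n\<in>ints_upto x. \<Prod>p\<in>prime_factors n. ?T \<omega> p ^ multiplicity p n)"
      by (rule sum.cong[OF refl], rule eq) (simp_all add: \<omega> ints_upto_def)
    moreover have "Psi0 x y (\<lambda>n. X n \<omega>) =
        Psi0 x y (\<lambda>n. \<Prod>p\<in>prime_factors n. ?T \<omega> p ^ multiplicity p n)"
      unfolding Psi0_def
      by (rule sum.cong[OF refl], rule eq) (simp_all add: \<omega> smooth_upto_def)
    ultimately show "norm ((\<Sum>n\<in>ints_upto x. X n \<omega>) - Psi0 x y (\<lambda>n. X n \<omega>)) ^ m = ?F (?T \<omega>)"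
      by (simp only:)
  qed
  also have "\<dots> = (\<integral>u. ?F u \<partial>distr M ?N ?T)"
    by (rule integral_distr[OF T F, symmetric])
  finally show ?thesis unfolding law .
qed

end

theory Submission
  imports Defs "HOL-Number_Theory.Prime_Powers" "HOL-Real_Asymp.Real_Asymp"
begin

text \<open>
  Write \<open>t = ln x\<close>. By orthogonality the \<open>2k\<close>-th moment counts pairs of \<open>k\<close>-tuples of non-smooth integers
  with equal products. Decompose \<open>n = r s\<close> with \<open>s\<close> composed of primes up to some \<open>w \<le> y\<close> and \<open>r\<close> of
  larger primes. Keeping only the condition that the products of the \<open>r\<close> agree, the \<open>k\<close>-th root of the moment
  is at most the sum of \<open>d\<^sub>k(r) Psi(x/r, w)\<^sup>2\<close> over \<open>r > 1\<close>, where \<open>d\<^sub>k\<close> is the \<open>k\<close>-fold divisor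
  function. Any bound of \<open>Psi(x/r, w)\<^sup>2\<close> by a multiple of a completely multiplicative function \<open>f(r)\<close>
  turns this sum into an Euler product.

  If \<open>y\<close> exceeds a large fixed power of \<open>t\<close>, take \<open>w = y\<close>. The identity
  \<open>\<Sum> ln n = \<Sum> \<Lambda>(d) Psi(X/d, y)\<close> over smooth \<open>n, d \<le> X\<close> gives \<open>Psi(X/y, y) \<le> (8 ln X / y) Psi(X, y)\<close>
  with the Chebyshev bound, and an induction in the style of Hildebrand gives
  \<open>Psi(X/Z, y) \<le> 8 Z powr (-3/4) Psi(X, y)\<close>; together they bound \<open>Psi(x/r, y)\<close> without any loss of logarithms.

  If \<open>y\<close> is at most a fixed power of \<open>t\<close>, take \<open>w\<close> to be a small constant multiple of \<open>y\<close> and bound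
  \<open>Psi(x/r, w)\<close> by Rankin's method. The loss in that method is harmless, because \<open>Psi(x, w)\<close> is smaller than
  \<open>Psi(x, y)\<close> by a factor exponential in \<open>ln x / ln y\<close>.
\<close>

section \<open>Chebyshev and Mertens bounds\<close>

text \<open>What shapes the proof is how sharp the bound for \<open>Psi (x / r) w\<close> must be.
  For \<open>y\<close> beyond a large power of \<open>t\<close>, the square root in the claim comes
  from the absence of \<open>r = 1\<close>: the moment is controlled by \<open>exp s - 1\<close>,
  with \<open>s\<close> proportional to \<open>k\<close> times a sum of \<open>f p\<close> over
  primes \<open>p > y\<close>. For \<open>s\<close> of order \<open>k * t^2 / y\<close>, a prime
  just above \<open>y\<close> may cost only about \<open>(t / y)^2\<close>, so a bound that loses
  powers of \<open>t\<close> is useless there. The remaining decay in \<open>r\<close> only needs an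
  exponent above 1/2, since it is squared before being summed; 3/4 is used.

  Hildebrand's induction loses a power of \<open>1 + ln X\<close> with a very large exponent times
  \<open>ln z / ln y\<close>, which is negligible only beyond that large power. Below it the square
  root is simply at least \<open>y powr (-1/2)\<close> and is paid from the exponential saving.
  Rankin's exponent \<open>\<sigma>\<close> is taken with \<open>w powr (1 - \<sigma>) = t\<close>.
  The sum of \<open>p powr (-2 * \<sigma>)\<close> over \<open>p > w\<close> then behaves well only
  for \<open>ln w > 2 * ln t\<close>, which reflects the hypothesis on \<open>y\<close>; the
  closeness of \<open>2 * \<sigma>\<close> to 1 produces the factor log log x in the
  exponent.\<close>

abbreviation vonMangoldt :: "nat \<Rightarrow> real" where
  "vonMangoldt \<equiv> mangoldt"

lemma sum_divisors_upto:
  fixes f :: "nat \<Rightarrow> real"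
  shows "(\<Sum>m\<in>{1..n}. \<Sum>d | d dvd m. f d) = (\<Sum>d\<in>{1..n}. f d * real (n div d))"
proof -
  have "(\<Sum>m\<in>{1..n}. \<Sum>d | d dvd m. f d) = (\<Sum>m\<in>{1..n}. \<Sum>d\<in>{d\<in>{1..n}. d dvd m}. f d)"
  proof (intro sum.cong refl)
    fix m assume "m \<in> {1..n}"
    then show "{d. d dvd m} = {d \<in> {1..n}. d dvd m}"
      by (auto dest: dvd_imp_le simp: Suc_le_eq intro!: Nat.gr0I)
  qed
  also have "\<dots> = (\<Sum>d\<in>{1..n}. \<Sum>m\<in>{m\<in>{1..n}. d dvd m}. f d)"
    by (rule sum.swap_restrict) auto
  also have "\<dots> = (\<Sum>d\<in>{1..n}. f d * real (n div d))"
  proof (intro sum.cong refl)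
    fix d assume d: "d \<in> {1..n}"
    have "card {m\<in>{1..n}. d dvd m} = n div d"
    proof -
      have "bij_betw (\<lambda>k. d * k) {1..n div d} {m\<in>{1..n}. d dvd m}"
      proof (rule bij_betwI[where g = "\<lambda>m. m div d"])
        show "(*) d \<in> {1..n div d} \<rightarrow> {m \<in> {1..n}. d dvd m}"
        proof
          fix k assume "k \<in> {1..n div d}"
          moreover from this have "k * d \<le> n"
            using d less_eq_div_iff_mult_less_eq[of d k n] by simp
          ultimately show "d * k \<in> {m \<in> {1..n}. d dvd m}" using d by (simp add: mult.commute)
        qed
        show "(\<lambda>m. m div d) \<in> {m \<in> {1..n}. d dvd m} \<rightarrow> {1..n div d}"
        proof
          fix m assume "m \<in> {m \<in> {1..n}. d dvd m}"
          then show "m div d \<in> {1..n div d}"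
            using d by (auto simp: div_le_mono Suc_le_eq div_greater_zero_iff dvd_imp_le)
        qed      qed (use d in auto)
      from bij_betw_same_card[OF this] show ?thesis by simp
    qed
    then show "(\<Sum>m\<in>{m\<in>{1..n}. d dvd m}. f d) = f d * real (n div d)" by simp
  qed
  finally show ?thesis .
qed

text \<open>Legendre's formula in logarithmic form. The Chebyshev bounds use it through central
  binomial coefficients, the Mertens bounds directly.\<close>

lemma ln_fact_eq_sum_mangoldt:
  "ln (fact n) = (\<Sum>d\<in>{1..n}. vonMangoldt d * real (n div d))"
proof -
  have "ln (fact n :: real) = (\<Sum>m\<in>{1..n}. ln (real m))"
    unfolding fact_prod of_nat_prod by (subst ln_prod) auto
  also have "\<dots> = (\<Sum>m\<in>{1..n}. \<Sum>d | d dvd m. vonMangoldt d)"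
    by (intro sum.cong refl, subst mangoldt_sum) auto
  also have "\<dots> = (\<Sum>d\<in>{1..n}. vonMangoldt d * real (n div d))"
    by (rule sum_divisors_upto)
  finally show ?thesis .
qed

text \<open>The second Chebyshev function, usually written psi.\<close>

definition Chebyshev :: "nat \<Rightarrow> real" where
  "Chebyshev n = (\<Sum>d\<in>{1..n}. vonMangoldt d)"

lemma Chebyshev_mono: "m \<le> n \<Longrightarrow> Chebyshev m \<le> Chebyshev n"
  unfolding Chebyshev_def by (intro sum_mono2) (auto simp: mangoldt_nonneg)

lemma ln_central_binomial:
  "ln (real ((2 * n) choose n)) =
     (\<Sum>d\<in>{1..2 * n}. vonMangoldt d * (real ((2 * n) div d) - 2 * real (n div d)))"
proof -
  have "real ((2 * n) choose n) = fact (2 * n) / (fact n * fact n)"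
    by (subst binomial_fact) auto
  then have "ln (real ((2 * n) choose n)) = ln (fact (2 * n)) - 2 * ln (fact n)"
    by (simp add: ln_div ln_mult)
  also have "ln (fact n :: real) = (\<Sum>d\<in>{1..2 * n}. vonMangoldt d * real (n div d))"
    unfolding ln_fact_eq_sum_mangoldt by (intro sum.mono_neutral_left) auto
  finally show ?thesis
    by (simp add: ln_fact_eq_sum_mangoldt sum_distrib_left sum_subtractf algebra_simps)
qed

lemma double_div_bounds:
  fixes n d :: nat
  assumes "d > 0"
  shows "real ((2 * n) div d) - 2 * real (n div d) \<in> {0..1}"
proof -
  define q where "q = n div d"
  have q: "q * d \<le> n" "n < (q + 1) * d"
    using assms by (auto simp: q_def dividend_less_div_times add.commute)
  have "2 * q \<le> (2 * n) div d"
    using q assms by (simp add: less_eq_div_iff_mult_less_eq)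
  moreover have "(2 * n) div d < 2 * q + 2"
    using q assms by (subst div_less_iff_less_mult) (auto simp: algebra_simps)
  ultimately show ?thesis by (auto simp flip: q_def)
qed

text \<open>The logarithm of \<open>(2 * m) choose m\<close> puts a coefficient between 0 and 1 on
  each \<open>vonMangoldt d\<close>, and it is at least \<open>m * ln 2\<close>. The form
  \<open>real n + 1\<close> allows the bound to be applied to the floor of a real number without
  further loss.\<close>

lemma Chebyshev_lower:
  assumes "n \<ge> 2"
  shows "Chebyshev n \<ge> (real n + 1) / 8"
proof -
  define m where "m = n div 2"
  have m: "m \<ge> 1" "2 * m \<le> n" "n + 1 \<le> 4 * m"
    using assms unfolding m_def by presburger+
  have "2 * real m \<le> 2 ^ m"
    using m(1) by (induction m rule: nat_induct_at_least) auto
  then have "2 ^ m * (2 * real m) \<le> 2 ^ m * 2 ^ m" by (intro mult_left_mono) auto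
  then have "2 ^ m \<le> 4 ^ m / (2 * real m)"
    using m(1) by (simp add: field_simps flip: power_mult_distrib)
  also have "\<dots> \<le> real ((2 * m) choose m)"
    using central_binomial_lower_bound m(1) by simp
  finally have "ln (2 ^ m) \<le> ln (real ((2 * m) choose m))"
    by (subst ln_le_cancel_iff) auto
  then have "real m * ln 2 \<le> ln (real ((2 * m) choose m))" by (simp add: ln_realpow)
  also have "\<dots> \<le> (\<Sum>d\<in>{1..2 * m}. vonMangoldt d * 1)"
    unfolding ln_central_binomial
    by (intro sum_mono mult_left_mono) (use double_div_bounds in \<open>auto simp: mangoldt_nonneg\<close>)
  also have "\<dots> \<le> Chebyshev n"
    using Chebyshev_mono[OF m(2)] by (simp add: Chebyshev_def)
  finally have "real m * ln 2 \<le> Chebyshev n" .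
  moreover have "real m * (1 / 2) \<le> real m * ln 2"
    using ln2_ge_two_thirds by (intro mult_left_mono) auto
  moreover have "(real n + 1) / 8 \<le> real m * (1 / 2)" using m(3) by simp
  ultimately show ?thesis by (meson order_trans)
qed

lemma Chebyshev_double: "Chebyshev (2 * n) \<le> Chebyshev n + real n * (7 / 5)"
proof -
  have split: "{1..2 * n} = {1..n} \<union> {n<..2 * n}" "{1..n} \<inter> {n<..2 * n} = {}" by auto
  have "Chebyshev (2 * n) - Chebyshev n = (\<Sum>d\<in>{n<..2 * n}. vonMangoldt d)"
    unfolding Chebyshev_def split(1) by (subst sum.union_disjoint) (use split(2) in auto)
  also have "\<dots> = (\<Sum>d\<in>{n<..2 * n}. vonMangoldt d * (real ((2 * n) div d) - 2 * real (n div d)))"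
  proof (intro sum.cong refl)
    fix d assume d: "d \<in> {n<..2 * n}"
    then have "(2 * n) div d = 1"
      by (intro div_nat_eqI) auto
    then show "vonMangoldt d = vonMangoldt d * (real ((2 * n) div d) - 2 * real (n div d))"
      using d by simp
  qed
  also have "\<dots> \<le> ln (real ((2 * n) choose n))"
    unfolding ln_central_binomial
    by (intro sum_mono2 mult_nonneg_nonneg) (use double_div_bounds in \<open>auto simp: mangoldt_nonneg\<close>)
  also have "\<dots> \<le> ln (2 ^ (2 * n))"
    using binomial_le_pow2[of "2 * n" n] by (subst ln_le_cancel_iff) (auto simp flip: of_nat_le_iff)
  also have "\<dots> = real n * (2 * ln 2)" by (simp add: ln_realpow)
  also have "\<dots> \<le> real n * (7 / 5)"
    using ln_2_less_1 ln2_le_25_over_36 by (intro mult_left_mono) auto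
  finally show ?thesis by simp
qed

text \<open>Induction by halving. The constant 3 absorbs the rounding for odd
  \<open>n = 2 * m - 1\<close>: there \<open>(3 + 7/5) * m <= 3 * (2 * m - 1)\<close> as soon as
  \<open>m >= 2\<close>.\<close>

lemma Chebyshev_upper: "Chebyshev n \<le> 3 * real n"
proof (induction n rule: less_induct)
  case (less n)
  show ?case
  proof (cases "n \<le> 1")
    case True
    then show ?thesis by (cases n) (auto simp: Chebyshev_def)
  next
    case False
    show ?thesis
    proof (cases "even n")
      case True
      then obtain m where m: "n = 2 * m" by auto
      with False less[of m] Chebyshev_double[of m] show ?thesis by auto
    next
      case odd: False
      define m where "m = (n + 1) div 2"
      have m: "n + 1 = 2 * m" "m < n" "m \<ge> 2" using odd False by (auto simp: m_def elim!: oddE)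
      have "Chebyshev n \<le> Chebyshev (2 * m)" using m by (intro Chebyshev_mono) auto
      with less[of m] Chebyshev_double[of m] m show ?thesis by auto
    qed
  qed
qed

lemma ln_fact_bounds:
  assumes "n \<ge> 1"
  shows "ln (fact n) \<le> real n * ln (real n)" "ln (fact n) \<ge> real n * ln (real n) - real n"
proof -
  have "fact n \<le> (real n ^ n)"
    using fact_le_power[of n] by simp
  then have "ln (fact n) \<le> ln (real n ^ n)" using assms by (subst ln_le_cancel_iff) auto
  then show "ln (fact n) \<le> real n * ln (real n)" using assms by (simp add: ln_realpow)
  have "(\<lambda>k. real n ^ k / fact k) sums exp (real n)"
    using exp_converges[of "real n"] by (simp add: field_simps)
  then have "(\<Sum>k\<in>{n}. real n ^ k / fact k) \<le> exp (real n)"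
    by (intro sum_le_suminf[where f = "\<lambda>k. real n ^ k / fact k", THEN order_trans])
       (auto simp: sums_iff)
  then have "real n ^ n \<le> exp (real n) * fact n" by (simp add: field_simps)
  then have "ln (real n ^ n) \<le> ln (exp (real n) * fact n)" using assms by (subst ln_le_cancel_iff) auto
  then show "ln (fact n) \<ge> real n * ln (real n) - real n" using assms by (simp add: ln_realpow ln_mult)
qed

lemma Mertens_first:
  assumes "n \<ge> 1"
  shows "(\<Sum>d\<in>{1..n}. vonMangoldt d / real d) \<le> ln (real n) + 3"
    and "(\<Sum>d\<in>{1..n}. vonMangoldt d / real d) \<ge> ln (real n) - 1"
proof -
  let ?S = "\<Sum>d\<in>{1..n}. vonMangoldt d / real d"
  have "ln (fact n) \<le> (\<Sum>d\<in>{1..n}. vonMangoldt d * (real n / real d))"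
    unfolding ln_fact_eq_sum_mangoldt
    by (intro sum_mono mult_left_mono of_nat_div_le_of_nat) (auto simp: mangoldt_nonneg)
  also have "\<dots> = real n * ?S" by (simp add: sum_distrib_left mult_ac)
  finally have "real n * (ln (real n) - 1) \<le> real n * ?S"
    using ln_fact_bounds(2)[OF assms] by (simp add: algebra_simps)
  then show "?S \<ge> ln (real n) - 1" using assms by simp
  have "real n * ?S - Chebyshev n = (\<Sum>d\<in>{1..n}. vonMangoldt d * (real n / real d - 1))"
    by (simp add: Chebyshev_def sum_distrib_left sum_subtractf algebra_simps)
  also have "\<dots> \<le> ln (fact n)"
    unfolding ln_fact_eq_sum_mangoldt
  proof (intro sum_mono mult_left_mono)
    fix d assume "d \<in> {1..n}"
    then show "real n / real d - 1 \<le> real (n div d)"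
      using real_of_int_div3[of "int n" "int d"] by (simp flip: of_nat_div)
  qed (auto simp: mangoldt_nonneg)
  finally have "real n * ?S \<le> real n * (ln (real n) + 3)"
    using ln_fact_bounds(1)[OF assms] Chebyshev_upper[of n] by (simp add: algebra_simps)
  then show "?S \<le> ln (real n) + 3" using assms by simp
qed

text \<open>Summation by parts puts the nonnegative weights \<open>g m - g (Suc m)\<close> on
  \<open>Chebyshev m\<close>. After \<open>Chebyshev m\<close> is replaced by \<open>3 * m\<close>,
  the same identity is run backwards with all coefficients equal to 1.\<close>

lemma sum_mangoldt_antimono:
  fixes g :: "nat \<Rightarrow> real"
  assumes "\<And>m. 1 \<le> m \<Longrightarrow> m \<le> n \<Longrightarrow> g (Suc m) \<le> g m" "\<And>m. g m \<ge> 0"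
  shows "(\<Sum>d\<in>{1..n}. vonMangoldt d * g d) \<le> 3 * (\<Sum>m\<in>{1..n}. g m)"
proof -
  have abel: "(\<Sum>d\<in>{1..n}. a d * g d) =
      (\<Sum>d\<in>{1..n}. a d) * g (Suc n) + (\<Sum>m\<in>{1..n}. (\<Sum>d\<in>{1..m}. a d) * (g m - g (Suc m)))"
    for a :: "nat \<Rightarrow> real"
    by (induction n) (auto simp: algebra_simps)
  have "(\<Sum>d\<in>{1..n}. vonMangoldt d * g d) =
      Chebyshev n * g (Suc n) + (\<Sum>m\<in>{1..n}. Chebyshev m * (g m - g (Suc m)))"
    unfolding Chebyshev_def by (rule abel)
  also have "\<dots> \<le> (3 * real n) * g (Suc n) + (\<Sum>m\<in>{1..n}. (3 * real m) * (g m - g (Suc m)))"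
    using assms by (intro add_mono sum_mono mult_right_mono Chebyshev_upper) auto
  also have "\<dots> = 3 * (\<Sum>m\<in>{1..n}. g m)"
    using abel[of "\<lambda>_. 1"] by (simp add: sum_distrib_left algebra_simps)
  finally show ?thesis .
qed

section \<open>Counting smooth numbers\<close>

definition smooth :: "real \<Rightarrow> nat set" where
  "smooth y = {n. n > 0 \<and> (\<forall>p\<in>prime_factors n. real p \<le> y)}"

lemma smooth_upto_iff: "n \<in> smooth_upto x y \<longleftrightarrow> n \<in> smooth y \<and> real n \<le> x"
  by (auto simp: smooth_upto_def smooth_def)

lemma smooth_pos: "n \<in> smooth y \<Longrightarrow> n > 0"
  by (simp add: smooth_def)

lemma smooth_mult_iff: "m * n \<in> smooth y \<longleftrightarrow> m \<in> smooth y \<and> n \<in> smooth y"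
  by (cases "m = 0 \<or> n = 0") (auto simp: smooth_def prime_factors_product)

lemma smooth_dvd: "n \<in> smooth y \<Longrightarrow> d dvd n \<Longrightarrow> d \<in> smooth y"
  by (auto simp: smooth_mult_iff elim!: dvdE)

lemma smooth_le: "n > 0 \<Longrightarrow> real n \<le> y \<Longrightarrow> n \<in> smooth y"
  by (fastforce simp: smooth_def dest: prime_factors_dvd dvd_imp_le)

lemma Psi_mono: "X \<le> X' \<Longrightarrow> Psi X y \<le> Psi X' y"
  unfolding Psi_def by (intro card_mono) (auto simp: smooth_upto_iff)

lemma Psi_eq_0: "X < 1 \<Longrightarrow> Psi X y = 0"
  by (auto simp: Psi_def smooth_upto_iff smooth_def)

lemma Psi_ge_1: "X \<ge> 1 \<Longrightarrow> Psi X y \<ge> 1"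
proof -
  assume "X \<ge> 1"
  then have "{1} \<subseteq> smooth_upto X y" by (auto simp: smooth_upto_def)
  from card_mono[OF finite_smooth_upto this] show ?thesis unfolding Psi_def by simp
qed

lemma Psi_le: "X \<ge> 0 \<Longrightarrow> real (Psi X y) \<le> X"
proof -
  assume "X \<ge> 0"
  have "smooth_upto X y \<subseteq> {1..nat \<lfloor>X\<rfloor>}"
    by (auto simp: smooth_upto_iff smooth_def le_nat_floor)
  from card_mono[OF _ this] have "Psi X y \<le> nat \<lfloor>X\<rfloor>" unfolding Psi_def by simp
  then show ?thesis using \<open>X \<ge> 0\<close> by linarith
qed

lemma Psi_ge_half:
  assumes "1 \<le> X" "X \<le> y"
  shows "X \<le> 2 * real (Psi X y)"
proof -
  have "{1..nat \<lfloor>X\<rfloor>} \<subseteq> smooth_upto X y"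
  proof
    fix n assume n: "n \<in> {1..nat \<lfloor>X\<rfloor>}"
    then have "real n \<le> X" using assms by (simp add: le_nat_iff le_floor_iff)
    then show "n \<in> smooth_upto X y" using n assms smooth_le[of n y] by (auto simp: smooth_upto_iff)
  qed
  from card_mono[OF finite_smooth_upto this] have "real (nat \<lfloor>X\<rfloor>) \<le> real (Psi X y)" unfolding Psi_def by simp
  moreover have "X \<le> real (nat \<lfloor>X\<rfloor>) + 1" "1 \<le> real (nat \<lfloor>X\<rfloor>)"
    using assms le_nat_floor[of 1 X] by linarith+
  ultimately show ?thesis by linarith
qed

lemma card_smooth_multiples:
  assumes "d \<in> smooth y"
  shows "card {n\<in>smooth_upto X y. d dvd n} = Psi (X / real d) y"
proof -
  have d: "d > 0" using assms smooth_pos by blast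
  have "bij_betw (\<lambda>m. d * m) (smooth_upto (X / real d) y) {n\<in>smooth_upto X y. d dvd n}"
    using assms d
    by (intro bij_betwI[where g = "\<lambda>n. n div d"])
       (auto simp: smooth_upto_iff smooth_mult_iff field_simps elim!: dvdE)
  then show ?thesis unfolding Psi_def by (rule bij_betw_same_card[symmetric])
qed

text \<open>The interchange of sums stays among smooth numbers because these are closed under
  divisors, and the smooth multiples of \<open>d\<close> are \<open>d\<close> times smooth
  numbers.\<close>

lemma sum_ln_smooth:
  "(\<Sum>n\<in>smooth_upto X y. ln (real n)) =
     (\<Sum>d\<in>smooth_upto X y. vonMangoldt d * real (Psi (X / real d) y))"
proof -
  have "(\<Sum>n\<in>smooth_upto X y. ln (real n)) =
      (\<Sum>n\<in>smooth_upto X y. \<Sum>d\<in>{d\<in>smooth_upto X y. d dvd n}. vonMangoldt d)"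
  proof (intro sum.cong refl)
    fix n assume n: "n \<in> smooth_upto X y"
    have "d \<in> smooth_upto X y" if "d dvd n" for d
      using that n dvd_imp_le[OF that] smooth_dvd[of n y d] smooth_pos[of n y]
      by (force simp: smooth_upto_iff)
    then have "{d\<in>smooth_upto X y. d dvd n} = {d. d dvd n}" by auto
    then show "ln (real n) = (\<Sum>d\<in>{d\<in>smooth_upto X y. d dvd n}. vonMangoldt d)"
      using n mangoldt_sum[of n, where 'a = real] by (simp add: smooth_upto_iff smooth_def)
  qed
  also have "\<dots> = (\<Sum>d\<in>smooth_upto X y. \<Sum>n\<in>{n\<in>smooth_upto X y. d dvd n}. vonMangoldt d)"
    by (rule sum.swap_restrict) auto
  also have "\<dots> = (\<Sum>d\<in>smooth_upto X y. vonMangoldt d * real (Psi (X / real d) y))"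
  proof (intro sum.cong refl)
    fix d assume "d \<in> smooth_upto X y"
    then have "d \<in> smooth y" by (simp add: smooth_upto_iff)
    from card_smooth_multiples[OF this, of X]
    show "(\<Sum>n\<in>{n\<in>smooth_upto X y. d dvd n}. vonMangoldt d) = vonMangoldt d * real (Psi (X / real d) y)"
      by simp
  qed
  finally show ?thesis .
qed

text \<open>The last sum is the cost of replacing \<open>ln n\<close> by \<open>ln X\<close>. It is
  nonnegative, so upper bounds for the weighted sum may drop it; lower bounds have to show that it
  is a bounded multiple of \<open>Psi X y\<close>.\<close>

lemma sum_ln_smooth_split:
  assumes "X > 0"
  shows "real (Psi X y) * ln X =
    (\<Sum>d\<in>smooth_upto X y. vonMangoldt d * real (Psi (X / real d) y)) +
    (\<Sum>n\<in>smooth_upto X y. ln (X / real n))"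
proof -
  have "(\<Sum>n\<in>smooth_upto X y. ln (X / real n)) = (\<Sum>n\<in>smooth_upto X y. ln X - ln (real n))"
    using assms by (intro sum.cong refl) (auto simp: ln_div smooth_upto_iff smooth_def)
  then show ?thesis by (simp add: sum_subtractf sum_ln_smooth Psi_def)
qed

lemma sum_mangoldt_Psi_le:
  assumes "X \<ge> 1" "finite D" "D \<subseteq> smooth y"
  shows "(\<Sum>d\<in>D. vonMangoldt d * real (Psi (X / real d) y)) \<le> ln X * real (Psi X y)"
proof -
  have "(\<Sum>d\<in>D. vonMangoldt d * real (Psi (X / real d) y)) =
      (\<Sum>d\<in>D \<inter> smooth_upto X y. vonMangoldt d * real (Psi (X / real d) y))"
  proof (intro sum.mono_neutral_right ballI)
    fix d assume d: "d \<in> D - D \<inter> smooth_upto X y"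
    then have "d \<in> smooth y" "real d > X" using assms by (auto simp: smooth_upto_iff)
    then have "X / real d < 1" using smooth_pos[of d y] by simp
    then show "vonMangoldt d * real (Psi (X / real d) y) = 0" by (simp add: Psi_eq_0)
  qed (use assms in auto)
  also have "\<dots> \<le> (\<Sum>d\<in>smooth_upto X y. vonMangoldt d * real (Psi (X / real d) y))"
    by (intro sum_mono2) (auto simp: mangoldt_nonneg)
  also have "\<dots> \<le> real (Psi X y) * ln X"
    using sum_ln_smooth_split[of X y] assms
    by (auto intro!: sum_nonneg ln_ge_zero simp: smooth_upto_iff smooth_def)
  finally show ?thesis by (simp add: mult.commute)
qed

text \<open>Because \<open>s <= y\<close>, every \<open>d <= s\<close> is smooth and contributes at
  least \<open>Psi (X / s) y\<close> to the logarithmic identity; these \<open>d\<close> carry total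
  weight at least \<open>s / 8\<close>.\<close>

lemma Psi_divide_le:
  assumes "X \<ge> 1" "2 \<le> s" "s \<le> y"
  shows "real (Psi (X / s) y) \<le> 8 * ln X / s * real (Psi X y)"
proof -
  define n where "n = nat \<lfloor>s\<rfloor>"
  have n: "n \<ge> 2" "real n \<le> s" "s \<le> real n + 1"
    unfolding n_def using assms le_nat_floor[of 2 s] by simp_all
  have "s / 8 \<le> Chebyshev n" using Chebyshev_lower[OF n(1)] n(3) by simp
  then have "s / 8 * real (Psi (X / s) y) \<le> Chebyshev n * real (Psi (X / s) y)"
    by (intro mult_right_mono) auto
  also have "\<dots> = (\<Sum>d\<in>{1..n}. vonMangoldt d * real (Psi (X / s) y))"
    by (simp add: Chebyshev_def sum_distrib_right)
  also have "\<dots> \<le> (\<Sum>d\<in>{1..n}. vonMangoldt d * real (Psi (X / real d) y))"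
    using assms n by (intro sum_mono mult_left_mono of_nat_mono Psi_mono)
      (auto simp: mangoldt_nonneg intro!: divide_left_mono)
  also have "\<dots> \<le> ln X * real (Psi X y)"
    using assms n by (intro sum_mangoldt_Psi_le) (auto intro!: smooth_le)
  finally show ?thesis using assms by (simp add: field_simps)
qed

text \<open>For \<open>v = X / n >= 1\<close> the number of \<open>i >= 0\<close> with
  \<open>2 ^ i <= v\<close> exceeds \<open>log 2 v\<close>, which is at least \<open>ln v\<close>.
  Counting pairs the other way gives the dyadic sum; \<open>N\<close> only keeps it finite.\<close>

lemma sum_ln_quotient_le:
  assumes "0 < X" "X \<le> 2 ^ N"
  shows "(\<Sum>n\<in>smooth_upto X y. ln (X / real n)) \<le> (\<Sum>i\<le>N. real (Psi (X / 2 ^ i) y))"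
proof -
  have "(\<Sum>n\<in>smooth_upto X y. ln (X / real n)) \<le>
      (\<Sum>n\<in>smooth_upto X y. \<Sum>i\<in>{i\<in>{..N}. real n \<le> X / 2 ^ i}. 1)"
  proof (intro sum_mono)
    fix n assume "n \<in> smooth_upto X y"
    then have n: "n \<ge> 1" "real n \<le> X" by (auto simp: smooth_upto_iff smooth_def)
    define k where "k = nat \<lfloor>log 2 (X / real n)\<rfloor>"
    have v: "X / real n \<ge> 1" using n by simp
    have k: "real k \<le> log 2 (X / real n)" "log 2 (X / real n) < real k + 1"
      using v by (auto simp: k_def)
    have "real n \<le> X / 2 ^ i \<and> i \<le> N" if "i \<le> k" for i
    proof -
      have "real i \<le> log 2 (X / real n)" using that k by linarith
      then have *: "2 ^ i \<le> X / real n"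
        using v by (simp add: le_log_iff powr_realpow)
      also have "\<dots> \<le> 2 ^ N / 1" using n assms by (intro frac_le) auto
      finally have "i \<le> N" by simp
      with * n show ?thesis by (simp add: field_simps)
    qed
    then have "{..k} \<subseteq> {i\<in>{..N}. real n \<le> X / 2 ^ i}" by auto
    then have "card {..k} \<le> card {i\<in>{..N}. real n \<le> X / 2 ^ i}" by (intro card_mono) auto
    then have "real k + 1 \<le> (\<Sum>i\<in>{i\<in>{..N}. real n \<le> X / 2 ^ i}. 1)" by simp
    moreover have "ln (X / real n) \<le> log 2 (X / real n)"
      using v ln2_le_25_over_36 by (auto simp: log_def le_divide_eq_1 intro!: divide_left_mono[of "ln 2" 1, simplified])
    ultimately show "ln (X / real n) \<le> (\<Sum>i\<in>{i\<in>{..N}. real n \<le> X / 2 ^ i}. 1)"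
      using k by linarith
  qed
  also have "\<dots> = (\<Sum>i\<le>N. \<Sum>n\<in>{n\<in>smooth_upto X y. real n \<le> X / 2 ^ i}. 1)"
    by (rule sum.swap_restrict) auto
  also have "\<dots> = (\<Sum>i\<le>N. real (Psi (X / 2 ^ i) y))"
  proof (intro sum.cong refl)
    fix i :: nat
    have "X / 2 ^ i \<le> X / 1" using assms by (intro divide_left_mono) auto
    then have "{n\<in>smooth_upto X y. real n \<le> X / 2 ^ i} = smooth_upto (X / 2 ^ i) y"
      by (auto simp: smooth_upto_iff)
    then show "(\<Sum>n\<in>{n\<in>smooth_upto X y. real n \<le> X / 2 ^ i}. 1) = real (Psi (X / 2 ^ i) y)"
      by (simp add: Psi_def)
  qed
  finally show ?thesis .
qed

text \<open>A geometric series from the least exponent in \<open>K\<close> with ratio at most 1/2.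
  Subtracting the last term in the auxiliary bound is what makes the induction close.\<close>

lemma sum_inverse_powers_le:
  fixes p :: nat
  assumes "p \<ge> 2" "X > 0" "finite K" "\<And>k. k \<in> K \<Longrightarrow> real p ^ k > X"
  shows "(\<Sum>k\<in>K. 1 / real p ^ k) \<le> 2 / X"
proof (cases "K = {}")
  case False
  define a where "a = Min K"
  define b where "b = Max K"
  have a: "a \<in> K" and sub: "K \<subseteq> {a..b}" using assms(3) False by (auto simp: a_def b_def)
  have aux: "(\<Sum>k\<in>{a..c}. 1 / real p ^ k) \<le> 2 / real p ^ a - 1 / real p ^ c" if "a \<le> c" for c
    using that
  proof (induction c rule: dec_induct)
    case (step c)
    have "2 * (1 / real p ^ Suc c) \<le> real p * (1 / real p ^ Suc c)"
      using assms by (intro mult_right_mono) auto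
    then have "2 * (1 / real p ^ Suc c) \<le> 1 / real p ^ c" using assms by simp
    with step show ?case by (simp add: sum.atLeast_Suc_atMost atLeastAtMostSuc_conv)
  qed simp
  have "(\<Sum>k\<in>K. 1 / real p ^ k) \<le> (\<Sum>k\<in>{a..b}. 1 / real p ^ k)"
    using sub by (intro sum_mono2) auto
  also have "\<dots> \<le> 2 / real p ^ a - 1 / real p ^ b" using a sub by (intro aux) auto
  also have "\<dots> \<le> 2 / real p ^ a" by simp
  also have "\<dots> \<le> 2 / X" using assms(2) assms(1) assms(4)[OF a] by (intro divide_left_mono mult_pos_pos) auto
  finally show ?thesis .
qed (use assms in auto)

text \<open>Group prime powers by their prime \<open>p <= y\<close>: the powers of \<open>p\<close>
  beyond \<open>X\<close> sum to at most \<open>2 / X\<close>, and the logarithmic weights are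
  bounded by the Chebyshev function at \<open>y\<close>. The bound does not depend on
  \<open>Y\<close>; this controls the moduli beyond \<open>X\<close> in
  \<open>upper_growth_step\<close>.\<close>

lemma sum_mangoldt_tail_le:
  assumes "X > 0" "y \<ge> 0"
  shows "(\<Sum>d\<in>{d\<in>smooth_upto Y y. real d > X}. vonMangoldt d / real d) \<le> 6 * y / X"
proof -
  define S where "S = {d\<in>smooth_upto Y y. real d > X \<and> primepow d}"
  define P where "P = {1..nat \<lfloor>y\<rfloor>}"
  have fin: "finite S" unfolding S_def by (rule finite_subset[OF _ finite_smooth_upto[of Y y]]) auto
  have "(\<Sum>d\<in>{d\<in>smooth_upto Y y. real d > X}. vonMangoldt d / real d) = (\<Sum>d\<in>S. vonMangoldt d / real d)"
    by (intro sum.mono_neutral_right) (auto simp: S_def mangoldt_def intro: finite_subset[OF _ finite_smooth_upto[of Y y]])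
  also have "\<dots> = (\<Sum>p\<in>P. \<Sum>d\<in>{d\<in>S. aprimedivisor d = p}. vonMangoldt d / real d)"
  proof (rule sum.group[symmetric])
    show "aprimedivisor ` S \<subseteq> P"
    proof safe
      fix d assume d: "d \<in> S"
      then have "d > 1" by (auto simp: S_def intro: primepow_gt_Suc_0)
      then have "prime (aprimedivisor d)" "aprimedivisor d dvd d"
        using aprimedivisor_nat[of d] by auto
      then have "aprimedivisor d \<in> prime_factors d" using \<open>d > 1\<close> by (auto simp: prime_factors_dvd)
      then have "real (aprimedivisor d) \<le> y" using d by (auto simp: S_def smooth_upto_iff smooth_def)
      then show "aprimedivisor d \<in> P"
        using prime_ge_1_nat[OF \<open>prime (aprimedivisor d)\<close>] by (auto simp: P_def le_nat_floor)
    qed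
  qed (use fin in \<open>auto simp: P_def\<close>)
  also have "\<dots> \<le> (\<Sum>p\<in>P. vonMangoldt p * (2 / X))"
  proof (intro sum_mono)
    fix p assume "p \<in> P"
    show "(\<Sum>d\<in>{d\<in>S. aprimedivisor d = p}. vonMangoldt d / real d) \<le> vonMangoldt p * (2 / X)"
    proof (cases "{d\<in>S. aprimedivisor d = p} = {}")
      case True
      then show ?thesis using assms by (subst True) (auto simp: mangoldt_nonneg)
    next
      case False
      then obtain d where d: "d \<in> S" "aprimedivisor d = p" by auto
      then have "prime p" using aprimedivisor_nat[of d] by (auto simp: S_def dest: primepow_gt_Suc_0)
      then have p: "prime p" "p \<ge> 2" by (auto intro: prime_ge_2_nat)
      define K where "K = multiplicity p ` {d\<in>S. aprimedivisor d = p}"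
      have eq: "d = p ^ multiplicity p d" if "d \<in> S" "aprimedivisor d = p" for d
      proof -
        have "primepow d" using that(1) by (simp add: S_def)
        from primepow_decompose[OF this, unfolded that(2)] show ?thesis by (rule sym)
      qed
      have inj: "inj_on (multiplicity p) {d\<in>S. aprimedivisor d = p}"
      proof (rule inj_onI)
        fix d e assume de: "d \<in> {d\<in>S. aprimedivisor d = p}" "e \<in> {d\<in>S. aprimedivisor d = p}"
          and m: "multiplicity p d = multiplicity p e"
        have "d = p ^ multiplicity p d" using eq[of d] de(1) by blast
        also have "\<dots> = p ^ multiplicity p e" by (simp only: m)
        also have "\<dots> = e" using eq[of e, symmetric] de(2) by blast
        finally show "d = e" .
      qed
      have "(\<Sum>d\<in>{d\<in>S. aprimedivisor d = p}. vonMangoldt d / real d) =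
          (\<Sum>d\<in>{d\<in>S. aprimedivisor d = p}. vonMangoldt p * (1 / real p ^ multiplicity p d))"
      proof (intro sum.cong refl)
        fix d assume d: "d \<in> {d\<in>S. aprimedivisor d = p}"
        then have "vonMangoldt d = ln (real p)" by (auto simp: S_def mangoldt_def)
        moreover have "vonMangoldt p = ln (real p)" using p by simp
        moreover have "real d = real p ^ multiplicity p d" 
          using arg_cong[OF eq[of d], of real] d by (simp only: mem_Collect_eq of_nat_power)
        ultimately show "vonMangoldt d / real d = vonMangoldt p * (1 / real p ^ multiplicity p d)"
          by simp
      qed
      also have "\<dots> = vonMangoldt p * (\<Sum>k\<in>K. 1 / real p ^ k)"
        unfolding K_def by (subst sum.reindex[OF inj]) (simp add: sum_distrib_left)
      also have "\<dots> \<le> vonMangoldt p * (2 / X)"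
      proof (intro mult_left_mono sum_inverse_powers_le)
        fix k assume "k \<in> K"
        then obtain d where d: "d \<in> S" "aprimedivisor d = p" "k = multiplicity p d" by (auto simp: K_def)
        then have "real d = real p ^ k" using arg_cong[OF eq[of d], of real] by (simp only: of_nat_power)
        moreover have "real d > X" using d(1) by (simp add: S_def)
        ultimately show "real p ^ k > X" by (simp only:)
      qed (use p assms fin in \<open>auto simp: K_def mangoldt_nonneg\<close>)
      finally show ?thesis .
    qed
  qed
  also have "\<dots> = Chebyshev (nat \<lfloor>y\<rfloor>) * (2 / X)" unfolding Chebyshev_def P_def by (rule sum_distrib_right[symmetric])
  also have "\<dots> \<le> 3 * real (nat \<lfloor>y\<rfloor>) * (2 / X)"
    using assms by (intro mult_right_mono Chebyshev_upper) auto
  also have "\<dots> \<le> 3 * y * (2 / X)" using assms by (intro mult_right_mono) auto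
  finally show ?thesis by simp
qed

section \<open>Growth of the counting function of smooth numbers\<close>

lemma one_minus_powr_ge:
  fixes b v :: real
  assumes "0 \<le> v" "v < 1" "b \<ge> 0"
  shows "(1 - v) powr (-b) \<ge> 1 + b * v"
proof -
  have "ln (1 - v) \<le> -v" using ln_le_minus_one[of "1 - v"] assms by simp
  then have "b * v \<le> b * (-ln (1 - v))" using assms by (intro mult_left_mono) auto
  then have "1 + b * v \<le> 1 + (- b * ln (1 - v))" by simp
  also have "\<dots> \<le> exp (- b * ln (1 - v))" by (rule exp_ge_add_one_self)
  also have "\<dots> = (1 - v) powr (-b)" using assms by (simp add: powr_def)
  finally show ?thesis .
qed

lemma two_powr_minus_three_quarters: "(2::real) powr (-(3/4)) \<le> 3/5"
proof -
  have "((2::real) powr (-(3/4))) ^ 4 = 2 powr (-3)"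
    by (subst powr_power) auto
  also have "\<dots> = 1/8" by (simp add: powr_minus powr_numeral)
  also have "\<dots> \<le> (3/5) ^ 4" by (simp add: power_divide)
  finally show ?thesis by (rule power_le_imp_le_base[of _ 3, simplified]) auto
qed

section \<open>Hildebrand's induction: setting and upper growth\<close>

locale smooth_growth =
  fixes x y :: real
  assumes x_ge_1: "x \<ge> 1"
    and y_large: "y \<ge> exp 60"
    and y_ge: "(1 + ln x) powr (3200 * exp 22) \<le> y"
begin

definition L :: real where "L = ln y"

text \<open>The size is dictated by \<open>lower_growth_step\<close>, where
  \<open>rate / (50 * exp 22) = 16\<close> has to beat the error terms. The exponent assumed for
  \<open>y\<close> is \<open>4 * rate\<close>, which keeps the loss in \<open>lower_growth\<close>
  below \<open>z powr (1/4)\<close>.\<close>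

definition rate :: real where "rate = 800 * exp 22"

lemma L_ge: "L \<ge> 60" 
  unfolding L_def using y_large by (subst ln_ge_iff) (auto intro: less_le_trans[OF exp_gt_zero])

lemma y_pos: "y > 0"
  using y_large exp_gt_zero[of "60::real"] by linarith

lemma exp_L: "exp L = y"
  using y_pos by (simp add: L_def)

lemma y_gt_2: "y > 2" 
  using y_large exp_ge_add_one_self[of "60::real"] by linarith

lemma ln_x_nonneg: "ln x \<ge> 0"
  using x_ge_1 by simp

lemma one_plus_ln_le: "1 + ln x \<le> exp (L / (4 * rate))"
proof -
  have "ln ((1 + ln x) powr (3200 * exp 22)) \<le> ln y"
    using y_ge ln_x_nonneg y_pos by (subst ln_le_cancel_iff) auto
  then have "(3200 * exp 22) * ln (1 + ln x) \<le> L" using ln_x_nonneg by (simp add: L_def ln_powr)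
  then have "ln (1 + ln x) \<le> L / (4 * rate)" by (simp add: rate_def field_simps)
  then have "exp (ln (1 + ln x)) \<le> exp (L / (4 * rate))" by (simp only: exp_le_cancel_iff)
  then show ?thesis using ln_x_nonneg by simp
qed

lemma exp_22_ge: "exp (22::real) \<ge> 1" by simp

lemma rate_ge: "rate \<ge> 800" using exp_22_ge by (simp add: rate_def)

lemma ln_x_le: "8 * ln x \<le> exp (L / 8)"
proof -
  have "ln x \<le> exp (L / (4 * rate))" using one_plus_ln_le by linarith
  also have "L / (4 * rate) \<le> L / 24"
    using L_ge rate_ge by (intro divide_left_mono) auto
  then have "exp (L / (4 * rate)) \<le> exp (L / 24)" by simp
  finally have 1: "ln x \<le> exp (L / 24)" .
  \<comment> \<open>The bound \<open>L >= 60\<close> gives \<open>L / 24 >= 5/2\<close>, so the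
    factor 8 costs no more than \<open>exp (L / 24)\<close>.\<close>
  have "8 \<le> exp (5/2::real)"
  proof -
    have "(8::real) \<le> (1 + 5/2/8) ^ 8" by (simp add: power_divide)
    also have "\<dots> \<le> exp (5/2::real)" using exp_ge_one_plus_x_over_n_power_n[of 8 "5/2"] by simp
    finally show ?thesis .
  qed
  also have "\<dots> \<le> exp (L / 24)" using L_ge by simp
  finally have "8 * ln x \<le> exp (L / 24) * exp (L / 24)"
    using 1 ln_x_nonneg by (intro mult_mono) auto
  also have "\<dots> = exp (L / 24 + L / 24)" by (simp only: exp_add)
  also have "\<dots> \<le> exp (L / 8)" using L_ge by simp
  finally show ?thesis .
qed

text \<open>Following Hildebrand, the two growth conditions are proved together by induction on \<open>X\<close>.
  In the identity \<open>sum_ln_smooth\<close> the step from \<open>X / d\<close> to \<open>X\<close> costs a factor \<open>1 - ln z / ln X\<close>,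
  which the exponent of \<open>1 + ln X\<close> absorbs provided that the moduli \<open>d\<close> larger than a fixed power
  of \<open>y\<close> carry a positive proportion of the weight; this last fact needs \<open>upper_growth\<close>.\<close>
definition lower_growth :: "real \<Rightarrow> bool" where
  "lower_growth X \<longleftrightarrow> (\<forall>z. 1 \<le> z \<longrightarrow> z \<le> sqrt y \<longrightarrow>
     z / 8 * (1 + ln X) powr (-(rate * ln z / L)) * real (Psi X y) \<le> real (Psi (z * X) y))"

definition upper_growth :: "real \<Rightarrow> bool" where
  "upper_growth X \<longleftrightarrow> (\<forall>c\<ge>exp 22. real (Psi (c * X) y) \<le> 2 * c * real (Psi X y))"

lemma sqrt_y: "sqrt y = exp (L / 2)"
proof -
  have "exp (L / 2) ^ 2 = y" by (simp add: exp_L flip: exp_double)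
  then show ?thesis by (intro real_sqrt_unique) auto
qed

text \<open>The power of \<open>1 + ln X\<close> costs at most \<open>z powr (1/4)\<close>, leaving
  decay with exponent 3/4. That this exceeds 1/2 is what matters later: its square is summable over
  primes.\<close>

lemma lower_growthD:
  assumes "lower_growth X" "1 \<le> X" "X \<le> x" "1 \<le> z" "z \<le> sqrt y"
  shows "real (Psi X y) \<le> 8 * z powr (-(3/4)) * real (Psi (z * X) y)"
proof -
  have "(1 + ln X) powr (rate * ln z / L) \<le> (exp (L / (4 * rate))) powr (rate * ln z / L)"
  proof (intro powr_mono2)
    have "ln X \<le> ln x" using assms by simp
    then show "1 + ln X \<le> exp (L / (4 * rate))" using one_plus_ln_le by linarith
  qed (use assms rate_ge L_ge in auto)
  also have "\<dots> = z powr (1/4)" using assms rate_ge L_ge by (simp add: powr_def)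
  finally have "(1 + ln X) powr (rate * ln z / L) \<le> z powr (1/4)" .
  then have "z powr (-(1/4)) \<le> (1 + ln X) powr (-(rate * ln z / L))"
    using assms ln_ge_zero[of X] by (auto simp: powr_minus add_nonneg_eq_0_iff intro!: le_imp_inverse_le)
  then have "z / 8 * z powr (-(1/4)) * real (Psi X y) \<le>
      z / 8 * (1 + ln X) powr (-(rate * ln z / L)) * real (Psi X y)"
    using assms by (intro mult_right_mono mult_left_mono) auto
  also have "\<dots> \<le> real (Psi (z * X) y)" using assms by (auto simp: lower_growth_def)
  finally have *: "z / 8 * z powr (-(1/4)) * real (Psi X y) \<le> real (Psi (z * X) y)" .
  have "8 * z powr (-(3/4)) * (z / 8 * z powr (-(1/4)) * real (Psi X y)) = 
      z powr (-(3/4)) * z powr (-(1/4)) * z * real (Psi X y)" by simp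
  also have "z powr (-(3/4)) * z powr (-(1/4)) * z = 1"
    using assms by (simp add: powr_minus field_simps flip: powr_add)
  finally have "real (Psi X y) = 8 * z powr (-(3/4)) * (z / 8 * z powr (-(1/4)) * real (Psi X y))" by simp
  also have "\<dots> \<le> 8 * z powr (-(3/4)) * real (Psi (z * X) y)"
    by (intro mult_left_mono *) auto
  finally show ?thesis .
qed

text \<open>A full step by \<open>sqrt y\<close> loses no constant and can therefore be iterated:
  \<open>8 * ln X\<close> is at most \<open>exp (L / 8)\<close>, and
  \<open>exp (L / 8 - L / 2)\<close> is the power \<open>-3/4\<close> of
  \<open>sqrt y\<close>.\<close>

lemma Psi_sqrt_le:
  assumes "0 < X" "X \<le> x"
  shows "real (Psi (X / sqrt y) y) \<le> sqrt y powr (-(3/4)) * real (Psi X y)"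
proof (cases "X \<ge> 1")
  case True
  have "1 + L / 2 \<le> exp (L / 2)" by (rule exp_ge_add_one_self)
  then have "2 \<le> exp (L / 2)" using L_ge by linarith
  moreover have "exp (L / 2) \<le> exp L" using L_ge by simp
  ultimately have "2 \<le> sqrt y" "sqrt y \<le> y" by (simp_all add: sqrt_y exp_L)
  then have "real (Psi (X / sqrt y) y) \<le> 8 * ln X / sqrt y * real (Psi X y)"
    using Psi_divide_le[OF True] by simp
  also have "8 * ln X / sqrt y \<le> exp (L / 8) / sqrt y"
  proof (intro divide_right_mono)
    have "ln X \<le> ln x" using assms by simp
    then show "8 * ln X \<le> exp (L / 8)" using ln_x_le by linarith
  qed (use y_pos in auto)
  also have "\<dots> = sqrt y powr (-(3/4))"
    unfolding sqrt_y by (simp add: powr_def flip: exp_diff)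
  finally show ?thesis by (simp add: mult_right_mono)
next
  case False
  have "X / sqrt y \<le> X / 1" using assms y_gt_2 by (intro divide_left_mono) auto
  then have "Psi (X / sqrt y) y = 0" using False by (intro Psi_eq_0) auto
  then show ?thesis by simp
qed

lemma Psi_sqrt_le':
  assumes "1 \<le> X" "X \<le> x"
  shows "2 * ln X * real (Psi (X / sqrt y) y) \<le> real (Psi X y)"
proof -
  have "2 * ln X * real (Psi (X / sqrt y) y) \<le> exp (L / 8) * (sqrt y powr (-(3/4)) * real (Psi X y))"
  proof (intro mult_mono Psi_sqrt_le)
    have "ln X \<le> ln x" using assms by simp
    moreover have "ln X \<ge> 0" using assms by simp
    ultimately show "2 * ln X \<le> exp (L / 8)" using ln_x_le by linarith
  qed (use assms in auto)
  also have "\<dots> = exp (- (L / 4)) * real (Psi X y)"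
    unfolding sqrt_y by (simp add: powr_def flip: exp_add)
  also have "\<dots> \<le> 1 * real (Psi X y)" using L_ge by (intro mult_right_mono) auto
  finally show ?thesis by simp
qed

text \<open>As long as \<open>2 ^ i <= sqrt y\<close>, lower growth gives decay with ratio 3/5, in
  total at most \<open>8 * (3/2) = 12\<close>. The terms between \<open>sqrt y\<close> and
  \<open>X\<close> are at most \<open>2 * ln X\<close> in number and bounded by \<open>Q\<close>,
  together at most one more \<open>Psi X y\<close>. Beyond \<open>X\<close> the terms
  vanish.\<close>

lemma sum_Psi_powers_le:
  assumes "1 \<le> X" "X \<le> x" and IH: "\<And>X'. 1 \<le> X' \<Longrightarrow> X' \<le> X / 2 \<Longrightarrow> lower_growth X'"
  shows "(\<Sum>i\<in>{1..N}. real (Psi (X / 2 ^ i) y)) \<le> 13 * real (Psi X y)"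
proof -
  define Q where "Q = real (Psi (X / sqrt y) y)"
  define J where "J = {i\<in>{1..N}. (2::real) ^ i \<le> X}"
  have "J \<subseteq> {1..nat \<lfloor>log 2 X\<rfloor>}"
  proof
    fix i assume "i \<in> J"
    then have "real i \<le> log 2 X" "i \<ge> 1" using assms by (auto simp: J_def le_log_iff powr_realpow)
    then show "i \<in> {1..nat \<lfloor>log 2 X\<rfloor>}" by (simp add: le_nat_iff le_floor_iff)
  qed
  from card_mono[OF _ this] have "real (card J) \<le> real (nat \<lfloor>log 2 X\<rfloor>)" by simp
  also have "\<dots> \<le> log 2 X" using assms by (simp add: of_nat_nat)
  also have "\<dots> \<le> ln X / (1/2)"
    unfolding log_def using assms ln2_ge_two_thirds by (intro divide_left_mono) auto
  finally have cardJ: "real (card J) \<le> 2 * ln X" by simp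
  have "(\<Sum>i\<in>{1..N}. real (Psi (X / 2 ^ i) y)) \<le>
      (\<Sum>i\<in>{1..N}. 8 * (3/5) ^ i * real (Psi X y) + (if i \<in> J then Q else 0))"
  proof (intro sum_mono)
    fix i assume i: "i \<in> {1..N}"
    consider "2 ^ i > X" | "2 ^ i \<le> X" "2 ^ i \<le> sqrt y" | "2 ^ i \<le> X" "2 ^ i > sqrt y" by linarith
    then show "real (Psi (X / 2 ^ i) y) \<le> 8 * (3/5) ^ i * real (Psi X y) + (if i \<in> J then Q else 0)"
    proof cases
      case 1
      then have "Psi (X / 2 ^ i) y = 0" by (intro Psi_eq_0) auto
      then show ?thesis by (auto simp: Q_def)
    next
      case 2
      have "(2::real) ^ 1 \<le> 2 ^ i" using i by (intro power_increasing) auto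
      then have "X / 2 ^ i \<le> X / 2" using assms by (intro divide_left_mono) auto
      moreover have "X / 2 \<le> X" using assms by simp
      moreover from calculation have "X / 2 ^ i \<le> x" using assms(2) by linarith
      moreover have "1 \<le> X / 2 ^ i" "(1::real) \<le> 2 ^ i" using 2 by auto
      ultimately have "real (Psi (X / 2 ^ i) y) \<le> 8 * (2 ^ i) powr (-(3/4)) * real (Psi (2 ^ i * (X / 2 ^ i)) y)"
        using 2 by (intro lower_growthD IH) simp_all
      also have "((2::real) ^ i) powr (-(3/4)) = (2 powr (-(3/4))) ^ i"
        by (simp add: powr_powr mult.commute flip: powr_realpow)
      also have "8 * (2 powr (-(3/4))) ^ i * real (Psi (2 ^ i * (X / 2 ^ i)) y) \<le> 8 * (3/5) ^ i * real (Psi X y)"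
        using two_powr_minus_three_quarters by (auto intro!: mult_right_mono power_mono)
      finally show ?thesis by (auto simp: Q_def)
    next
      case 3
      have "X / 2 ^ i \<le> X / sqrt y" using 3 assms y_pos by (intro divide_left_mono) auto
      then have "real (Psi (X / 2 ^ i) y) \<le> Q" unfolding Q_def by (simp add: Psi_mono)
      moreover have "i \<in> J" using i 3 by (auto simp: J_def)
      ultimately show ?thesis by (simp add: add_increasing)
    qed
  qed
  also have "\<dots> = 8 * real (Psi X y) * (\<Sum>i\<in>{1..N}. (3/5) ^ i) + real (card J) * Q"
  proof -
    have "{1..N} \<inter> J = J" by (auto simp: J_def)
    then show ?thesis
      unfolding sum.distrib by (subst sum.If_cases) (simp_all add: sum_distrib_left mult_ac)
  qed
  also have "\<dots> \<le> 8 * real (Psi X y) * (3/2) + 2 * ln X * Q"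
  proof (intro add_mono mult_left_mono mult_right_mono cardJ)
    have "(1 - q) * (\<Sum>i\<in>{1..N}. q ^ i) = q - q ^ Suc N" for q :: real
    proof (induction N)
      case (Suc N)
      have "(1 - q) * (\<Sum>i\<in>{1..Suc N}. q ^ i) = (1 - q) * (\<Sum>i\<in>{1..N}. q ^ i) + (1 - q) * q ^ Suc N"
        by (simp add: distrib_left)
      also have "\<dots> = q - q ^ Suc N + (1 - q) * q ^ Suc N" by (simp only: Suc)
      also have "\<dots> = q - q ^ Suc (Suc N)" by (simp add: algebra_simps)
      finally show ?case .
    qed simp
    from this[of "3/5"] have "2 * (\<Sum>i\<in>{1..N}. (3/5) ^ i) \<le> (3::real)" by simp
    then show "(\<Sum>i\<in>{1..N}. (3/5) ^ i) \<le> (3/2::real)" by linarith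
  qed (auto simp: Q_def)
  also have "\<dots> \<le> 13 * real (Psi X y)"
    using Psi_sqrt_le'[OF assms(1,2)] by (simp add: Q_def)
  finally show ?thesis .
qed

lemma sum_ln_quotient_le_14:
  assumes "1 \<le> X" "X \<le> x" "\<And>X'. 1 \<le> X' \<Longrightarrow> X' \<le> X / 2 \<Longrightarrow> lower_growth X'"
  shows "(\<Sum>n\<in>smooth_upto X y. ln (X / real n)) \<le> 14 * real (Psi X y)"
proof -
  obtain N where "X \<le> 2 ^ N" using real_arch_pow[of 2 X] by (auto intro: less_imp_le)
  then have "(\<Sum>n\<in>smooth_upto X y. ln (X / real n)) \<le> (\<Sum>i\<le>N. real (Psi (X / 2 ^ i) y))"
    using assms by (intro sum_ln_quotient_le) auto
  also have "{..N} = insert 0 {1..N}" by auto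
  finally show ?thesis using sum_Psi_powers_le[OF assms, of N] by simp
qed

lemma upper_growth_base:
  assumes "1 \<le> X" "X \<le> y"
  shows "upper_growth X"
  unfolding upper_growth_def
proof safe
  fix c :: real assume c: "exp 22 \<le> c"
  then have c0: "c > 0" by (rule less_le_trans[OF exp_gt_zero])
  have "real (Psi (c * X) y) \<le> c * X" using assms c0 by (intro Psi_le) auto
  also have "\<dots> \<le> c * (2 * real (Psi X y))" using Psi_ge_half[OF assms] c0 by (intro mult_left_mono) auto
  finally show "real (Psi (c * X) y) \<le> 2 * c * real (Psi X y)" by simp
qed

text \<open>The logarithmic identity is applied at \<open>c * X\<close>. Moduli up to
  \<open>X\<close> are treated inductively and recombine to at most \<open>ln X * Psi X y\<close>;
  moduli beyond \<open>X\<close> use the trivial bound for \<open>Psi\<close> and cost a multiple of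
  \<open>c * y\<close>, hence of \<open>c * Psi X y\<close> because \<open>y < X\<close>. The
  surplus \<open>ln c\<close> in \<open>ln (c * X)\<close> pays for all constants.\<close>

lemma upper_growth_step:
  assumes "y < X" "X \<le> x"
    and IHl: "\<And>X'. 1 \<le> X' \<Longrightarrow> X' \<le> X / 2 \<Longrightarrow> lower_growth X'"
    and IHu: "\<And>X'. 1 \<le> X' \<Longrightarrow> X' \<le> X / 2 \<Longrightarrow> upper_growth X'"
  shows "upper_growth X"
  unfolding upper_growth_def
proof safe
  fix c :: real assume c: "exp 22 \<le> c"
  then have c0: "c > 0" by (rule less_le_trans[OF exp_gt_zero])
  have c1: "c \<ge> 1" using c exp_22_ge by linarith
  have X1: "X \<ge> 1" using assms y_gt_2 by linarith
  have lnc: "ln c \<ge> 22" using c c0 by (simp add: ln_ge_iff)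
  let ?P = "real (Psi X y)" and ?Q = "real (Psi (c * X) y)"
  have P: "y \<le> 2 * ?P"
    using Psi_ge_half[of y y] y_gt_2 Psi_mono[of y X y] assms by linarith
  define S where "S = smooth_upto (c * X) y"
  have S: "S = smooth_upto X y \<union> {d\<in>S. real d > X}"
  proof -
    have "X \<le> c * X" using X1 c1 mult_right_mono[of 1 c X] by simp
    then show ?thesis by (force simp: S_def smooth_upto_iff)
  qed
  have "(\<Sum>d\<in>S. vonMangoldt d * real (Psi (c * X / real d) y)) =
      (\<Sum>d\<in>smooth_upto X y. vonMangoldt d * real (Psi (c * X / real d) y)) +
      (\<Sum>d\<in>{d\<in>S. real d > X}. vonMangoldt d * real (Psi (c * X / real d) y))"
  proof (subst S, rule sum.union_disjoint)
    show "finite {d\<in>S. real d > X}" by (simp add: S_def)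
  qed (auto simp: smooth_upto_iff)
  also have "(\<Sum>d\<in>smooth_upto X y. vonMangoldt d * real (Psi (c * X / real d) y)) \<le>
      (\<Sum>d\<in>smooth_upto X y. vonMangoldt d * (2 * c * real (Psi (X / real d) y)))"
  proof (intro sum_mono)
    fix d assume d: "d \<in> smooth_upto X y"
    show "vonMangoldt d * real (Psi (c * X / real d) y) \<le> vonMangoldt d * (2 * c * real (Psi (X / real d) y))"
    proof (cases "d \<ge> 2")
      case True
      then have "1 \<le> X / real d" using d by (simp add: smooth_upto_iff)
      moreover have "X / real d \<le> X / 2" using True X1 by (intro divide_left_mono) auto
      ultimately have "upper_growth (X / real d)" by (rule IHu)
      then have "real (Psi (c * (X / real d)) y) \<le> 2 * c * real (Psi (X / real d) y)"
        using c by (auto simp: upper_growth_def)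
      then show ?thesis by (intro mult_left_mono) (auto simp: mangoldt_nonneg)
    next
      case False
      \<comment> \<open>\<open>vonMangoldt\<close> vanishes at 0 and 1, so the inductive hypothesis
        is only called at arguments up to \<open>X / 2\<close>.\<close>
      then have "d = 0 \<or> d = 1" by auto
      then show ?thesis by auto
    qed
  qed
  also have "\<dots> = 2 * c * (\<Sum>d\<in>smooth_upto X y. vonMangoldt d * real (Psi (X / real d) y))"
    by (simp add: sum_distrib_left mult_ac)
  also have "\<dots> \<le> 2 * c * (ln X * ?P)"
    using X1 c0 by (intro mult_left_mono sum_mangoldt_Psi_le) (auto simp: smooth_upto_iff)
  also have "(\<Sum>d\<in>{d\<in>S. real d > X}. vonMangoldt d * real (Psi (c * X / real d) y)) \<le>
      (\<Sum>d\<in>{d\<in>S. real d > X}. (vonMangoldt d / real d) * (c * X))"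
  proof (intro sum_mono)
    fix d
    have "vonMangoldt d * real (Psi (c * X / real d) y) \<le> vonMangoldt d * (c * X / real d)"
      using c0 X1 by (intro mult_left_mono Psi_le) (auto simp: mangoldt_nonneg)
    then show "vonMangoldt d * real (Psi (c * X / real d) y) \<le> (vonMangoldt d / real d) * (c * X)" by simp
  qed
  also have "\<dots> = (\<Sum>d\<in>{d\<in>S. real d > X}. vonMangoldt d / real d) * (c * X)"
    by (rule sum_distrib_right[symmetric])
  also have "\<dots> \<le> 6 * y / X * (c * X)"
    unfolding S_def using X1 y_pos c0 by (intro mult_right_mono sum_mangoldt_tail_le) auto
  also have "\<dots> = 6 * c * y" using X1 by simp
  also have "6 * c * y \<le> 6 * c * (2 * ?P)" using P c0 by (intro mult_left_mono) auto
  finally have main: "(\<Sum>d\<in>S. vonMangoldt d * real (Psi (c * X / real d) y)) \<le> 2 * c * (ln X * ?P) + 12 * c * ?P"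
    by simp
  obtain N where N: "c * X \<le> 2 ^ N" using real_arch_pow[of 2 "c * X"] by (auto intro: less_imp_le)
  have "(\<Sum>n\<in>S. ln (c * X / real n)) \<le> (\<Sum>i\<le>N. real (Psi (c * X / 2 ^ i) y))"
    unfolding S_def using N c0 X1 by (intro sum_ln_quotient_le) auto
  also have "{..N} = insert 0 {1..N}" by auto
  also have "(\<Sum>i\<in>insert 0 {1..N}. real (Psi (c * X / 2 ^ i) y)) = ?Q + (\<Sum>i\<in>{1..N}. real (Psi (c * X / 2 ^ i) y))"
    by simp
  also have "(\<Sum>i\<in>{1..N}. real (Psi (c * X / 2 ^ i) y)) \<le>
      (\<Sum>i\<in>{1..N}. 2 * c * real (Psi (X / 2 ^ i) y) + (if 2 ^ i > X then c * X * (1 / real 2 ^ i) else 0))"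
  proof (intro sum_mono)
    fix i assume i: "i \<in> {1..N}"
    show "real (Psi (c * X / 2 ^ i) y) \<le>
      2 * c * real (Psi (X / 2 ^ i) y) + (if 2 ^ i > X then c * X * (1 / real 2 ^ i) else 0)"
    proof (cases "2 ^ i > X")
      case True
      then show ?thesis using Psi_le[of "c * X / 2 ^ i" y] c0 X1 by (auto simp: Psi_eq_0)
    next
      case False
      have "(2::real) ^ 1 \<le> 2 ^ i" using i by (intro power_increasing) auto
      then have "X / 2 ^ i \<le> X / 2" using X1 by (intro divide_left_mono) auto
      moreover have "1 \<le> X / 2 ^ i" using False by simp
      ultimately have "upper_growth (X / 2 ^ i)" by (intro IHu) auto
      then have "real (Psi (c * (X / 2 ^ i)) y) \<le> 2 * c * real (Psi (X / 2 ^ i) y)"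
        using c by (auto simp: upper_growth_def)
      with False show ?thesis by simp
    qed
  qed
  also have "\<dots> = 2 * c * (\<Sum>i\<in>{1..N}. real (Psi (X / 2 ^ i) y)) +
      c * X * (\<Sum>i\<in>{i\<in>{1..N}. 2 ^ i > X}. 1 / real 2 ^ i)"
    unfolding sum.distrib by (subst sum.If_cases) (auto simp: sum_distrib_left Int_def mult_ac)
  also have "\<dots> \<le> 2 * c * (13 * ?P) + c * X * (2 / X)"
  proof (intro add_mono mult_left_mono)
    show "(\<Sum>i\<in>{1..N}. real (Psi (X / 2 ^ i) y)) \<le> 13 * ?P"
      using X1 assms by (intro sum_Psi_powers_le IHl) auto
    have "(\<Sum>i\<in>{i\<in>{1..N}. 2 ^ i > X}. 1 / real 2 ^ i) \<le> 2 / X"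
      using X1 by (intro sum_inverse_powers_le) auto
    then show "(\<Sum>i\<in>{i\<in>{1..N}. 2 ^ i > X}. 1 / real 2 ^ i) \<le> 2 / X" .
  qed (use c0 X1 in auto)
  also have "c * X * (2 / X) \<le> 2 * c * ?P"
    using X1 c0 Psi_ge_1[OF X1, of y] by simp
  finally have E: "(\<Sum>n\<in>S. ln (c * X / real n)) \<le> ?Q + 28 * c * ?P" by simp
  have "?Q * (ln X + ln c) = ?Q * ln (c * X)" using c0 X1 by (simp add: ln_mult)
  also have "\<dots> \<le> 2 * c * (ln X * ?P) + 12 * c * ?P + (?Q + 28 * c * ?P)"
    using sum_ln_smooth_split[of "c * X" y] c0 X1 main E by (simp add: S_def)
  finally have "?Q * (ln X + ln c - 1) \<le> 2 * c * ?P * (ln X + 20)" by (simp add: algebra_simps)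
  \<comment> \<open>The errors 12 and 28 add up to \<open>2 * 20\<close>, and one \<open>?Q\<close>
    has moved to the left. So \<open>ln c\<close> has to be at least 21, which is why
    \<open>upper_growth\<close> is restricted to \<open>c >= exp 22\<close>.\<close>
  also have "\<dots> \<le> 2 * c * ?P * (ln X + ln c - 1)"
    using lnc c0 by (intro mult_left_mono) auto
  finally show "?Q \<le> 2 * c * ?P" using lnc ln_ge_zero[OF X1] by (subst (asm) mult_le_cancel_right) auto
qed

end

section \<open>Hildebrand's induction: the weight of large moduli and lower growth\<close>

context smooth_growth
begin

text \<open>About \<open>y powr (1/4)\<close>: the moduli up to its square are at most
  \<open>sqrt y\<close>, hence smooth and below \<open>X\<close> when \<open>X > sqrt y\<close>,
  while \<open>ln D\<close> is still comparable with \<open>L\<close>.\<close>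

definition D :: nat where "D = nat \<lfloor>exp (L / 4)\<rfloor>"

lemma D_le: "real D \<le> exp (L / 4)"
  by (simp add: D_def)

lemma ln_D_ge: "ln (real D) \<ge> L / 5"
proof -
  have "exp (L / 4) - 1 \<le> real D" unfolding D_def by linarith
  moreover have "exp (L / 5) + 1 \<le> exp (L / 4)"
  proof -
    have "exp (L / 5) * (1 + L / 20) \<le> exp (L / 5) * exp (L / 20)"
      by (intro mult_left_mono exp_ge_add_one_self) auto
    also have "\<dots> = exp (L / 4)" by (simp flip: exp_add)
    finally have "exp (L / 5) * (1 + L / 20) \<le> exp (L / 4)" .
    moreover have "1 * 1 \<le> exp (L / 5) * (L / 20)" using L_ge by (intro mult_mono) auto
    ultimately show ?thesis by (simp add: algebra_simps)
  qed
  ultimately have "exp (L / 5) \<le> real D" by linarith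
  moreover from this have "real D > 0" using exp_gt_zero[of "L / 5"] by linarith
  ultimately show ?thesis by (subst ln_ge_iff)
qed

lemma D_gt: "D > 1"
proof (rule ccontr)
  assume "\<not> D > 1"
  then have "D = 0 \<or> D = 1" by auto
  then have "ln (real D) = 0" by auto
  with ln_D_ge L_ge show False by simp
qed

lemma D_square_le: "real (D\<^sup>2) \<le> sqrt y"
proof -
  have "real D ^ 2 \<le> exp (L / 4) ^ 2" using D_le by (intro power_mono) auto
  also have "\<dots> = sqrt y" unfolding sqrt_y by (simp flip: exp_double)
  finally show ?thesis by simp
qed

lemma sqrt_y_le: "sqrt y \<le> y"
proof -
  have "exp (L / 2) \<le> exp L" using L_ge by simp
  then show ?thesis by (simp add: sqrt_y exp_L)
qed

definition mass :: "real \<Rightarrow> nat set \<Rightarrow> real" where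
  "mass X A = (\<Sum>d\<in>A. vonMangoldt d * real (Psi (X / real d) y))"

text \<open>By \<open>upper_growth\<close>, the weight of the moduli up to \<open>D\<close> is dominated by the weight of those
  between \<open>D\<close> and \<open>D\<^sup>2\<close>: compare each \<open>d\<close> with each \<open>e\<close> and average over \<open>e\<close>
  with the Mertens weights.\<close>
lemma mass_small_le:
  assumes "sqrt y < X" and IHu: "\<And>X'. 1 \<le> X' \<Longrightarrow> X' \<le> X / 2 \<Longrightarrow> upper_growth X'"
  shows "mass X {1..D} \<le> 4 * exp 22 * mass X {D<..D\<^sup>2}"
proof -
  have X0: "X > 0" using assms y_pos by (meson le_less_trans less_imp_le real_sqrt_ge_zero)
  have le: "real (Psi (X / real d) y) \<le> 2 * exp 22 * (real e / real d) * real (Psi (X / real e) y)"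
    if d: "d \<in> {1..D}" and e: "e \<in> {D<..D\<^sup>2}" for d e
  proof -
    have e0: "e \<ge> 2" using e D_gt by auto
    have "real e \<le> sqrt y" using e D_square_le by (meson greaterThanAtMost_iff of_nat_le_iff order_trans)
    then have "1 \<le> X / real e" using assms(1) e0 by simp
    moreover have "X / real e \<le> X / 2" using e0 X0 by (intro divide_left_mono) auto
    ultimately have u: "upper_growth (X / real e)" by (rule IHu)
    define c where "c = real e / real d"
    have c: "c \<ge> 1" using d e by (auto simp: c_def)
    have X: "X / real d = c * (X / real e)" using e0 by (simp add: c_def)
    have "real (Psi (c * (X / real e)) y) \<le> 2 * exp 22 * c * real (Psi (X / real e) y)"
    \<comment> \<open>\<open>upper_growth\<close> says nothing about ratios below
      \<open>exp 22\<close>. There the ratio is enlarged to \<open>exp 22\<close>, which explains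
      the extra factor in the comparison.\<close>
    proof (cases "c \<ge> exp 22")
      case True
      then have "real (Psi (c * (X / real e)) y) \<le> 2 * c * real (Psi (X / real e) y)"
        using u by (auto simp: upper_growth_def)
      also have "\<dots> = 1 * (2 * c * real (Psi (X / real e) y))" by simp
      also have "\<dots> \<le> exp 22 * (2 * c * real (Psi (X / real e) y))"
        using c by (intro mult_right_mono exp_22_ge) auto
      finally show ?thesis by simp
    next
      case False
      then have "c * (X / real e) \<le> exp 22 * (X / real e)" using X0 by (intro mult_right_mono) auto
      then have "real (Psi (c * (X / real e)) y) \<le> real (Psi (exp 22 * (X / real e)) y)"
        by (simp add: Psi_mono)
      also have "\<dots> \<le> 2 * exp 22 * real (Psi (X / real e) y)"
        using u by (auto simp: upper_growth_def)
      also have "\<dots> = 1 * (2 * exp 22 * real (Psi (X / real e) y))" by simp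
      also have "\<dots> \<le> c * (2 * exp 22 * real (Psi (X / real e) y))"
        using c by (intro mult_right_mono) auto
      finally show ?thesis by (simp add: mult_ac)
    qed
    then show ?thesis unfolding X by (simp add: c_def)
  qed
  define F where "F = (\<lambda>e. vonMangoldt e / real e)"
  have "mass X {1..D} * (\<Sum>e\<in>{D<..D\<^sup>2}. F e) =
      (\<Sum>d\<in>{1..D}. \<Sum>e\<in>{D<..D\<^sup>2}. vonMangoldt d * real (Psi (X / real d) y) * F e)"
    by (simp add: mass_def sum_product)
  also have "\<dots> \<le> (\<Sum>d\<in>{1..D}. \<Sum>e\<in>{D<..D\<^sup>2}. 2 * exp 22 * (F d * (vonMangoldt e * real (Psi (X / real e) y))))"
  proof (intro sum_mono)
    fix d e assume d: "d \<in> {1..D}" and e: "e \<in> {D<..D\<^sup>2}"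
    have "vonMangoldt d * real (Psi (X / real d) y) * F e \<le>
        vonMangoldt d * (2 * exp 22 * (real e / real d) * real (Psi (X / real e) y)) * F e"
      using le[OF d e] by (intro mult_right_mono mult_left_mono) (auto simp: F_def mangoldt_nonneg)
    also have "\<dots> = 2 * exp 22 * (F d * (vonMangoldt e * real (Psi (X / real e) y)))"
      using d e by (simp add: F_def)
    finally show "vonMangoldt d * real (Psi (X / real d) y) * F e \<le> \<dots>" .
  qed
  also have "\<dots> = 2 * exp 22 * ((\<Sum>d\<in>{1..D}. F d) * mass X {D<..D\<^sup>2})"
    unfolding mass_def sum_product by (simp only: sum_distrib_left)
  also have "\<dots> \<le> 2 * exp 22 * ((ln (real D) + 3) * mass X {D<..D\<^sup>2})"
    using Mertens_first(1)[of D] D_gt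
    by (intro mult_left_mono mult_right_mono) (auto simp: F_def mass_def mangoldt_nonneg intro!: sum_nonneg)
  finally have 1: "mass X {1..D} * (\<Sum>e\<in>{D<..D\<^sup>2}. F e) \<le> 2 * exp 22 * ((ln (real D) + 3) * mass X {D<..D\<^sup>2})" .
  have mass0: "mass X A \<ge> 0" for A by (auto simp: mass_def mangoldt_nonneg intro!: sum_nonneg)
  have "D \<le> D\<^sup>2" by (simp add: power2_eq_square)
  then have "{1..D\<^sup>2} = {1..D} \<union> {D<..D\<^sup>2}" by auto
  then have "(\<Sum>d\<in>{1..D\<^sup>2}. F d) = (\<Sum>d\<in>{1..D}. F d) + (\<Sum>d\<in>{D<..D\<^sup>2}. F d)"
    by (simp only:) (rule sum.union_disjoint, auto)
  moreover have "(\<Sum>d\<in>{1..D\<^sup>2}. F d) \<ge> ln (real (D\<^sup>2)) - 1"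
    unfolding F_def using D_gt by (intro Mertens_first(2)) auto
  moreover have "ln (real (D\<^sup>2)) = 2 * ln (real D)" using D_gt by (simp add: ln_realpow)
  moreover have "(\<Sum>d\<in>{1..D}. F d) \<le> ln (real D) + 3"
    unfolding F_def using D_gt by (intro Mertens_first(1)) auto
  ultimately have "(\<Sum>e\<in>{D<..D\<^sup>2}. F e) \<ge> ln (real D) - 4" by linarith
  \<comment> \<open>With 11 the inequality \<open>ln D - 4 >= (ln D + 3) / 2\<close> holds, so the
    Mertens weight between \<open>D\<close> and its square is at least half of the bound for the
    weight up to \<open>D\<close>.\<close>
  moreover have lnD: "ln (real D) \<ge> 11" using ln_D_ge L_ge by linarith
  ultimately have "mass X {1..D} * ((ln (real D) + 3) / 2) \<le> mass X {1..D} * (\<Sum>e\<in>{D<..D\<^sup>2}. F e)"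
    by (intro mult_left_mono mass0) auto
  also note 1
  finally have "(ln (real D) + 3) * mass X {1..D} \<le> (ln (real D) + 3) * (4 * exp 22 * mass X {D<..D\<^sup>2})"
    by (simp add: algebra_simps)
  then show ?thesis using lnD by simp
qed

text \<open>By \<open>mass_small_le\<close> the moduli above \<open>D\<close> carry at least the
  proportion \<open>1 / (5 * exp 22)\<close> of the total. The error 14 in the total is absorbed
  because \<open>ln X >= 30\<close> makes \<open>ln X - 14\<close> at least
  \<open>ln X / 2\<close>.\<close>

lemma mass_large_ge:
  assumes "sqrt y < X" "X \<le> x"
    and IHl: "\<And>X'. 1 \<le> X' \<Longrightarrow> X' \<le> X / 2 \<Longrightarrow> lower_growth X'"
    and IHu: "\<And>X'. 1 \<le> X' \<Longrightarrow> X' \<le> X / 2 \<Longrightarrow> upper_growth X'"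
  shows "mass X (smooth_upto X y) \<ge> (ln X - 14) * real (Psi X y)"
    and "mass X {d\<in>smooth_upto X y. d > D} \<ge> ln X / (10 * exp 22) * real (Psi X y)"
proof -
  have "1 \<le> sqrt y" using y_gt_2 by simp
  then have X1: "X \<ge> 1" using assms by linarith
  let ?S = "smooth_upto X y"
  let ?B = "{d\<in>?S. d > D}"
  show tot: "mass X ?S \<ge> (ln X - 14) * real (Psi X y)"
    using sum_ln_smooth_split[of X y] sum_ln_quotient_le_14[OF X1 assms(2) IHl] X1
    by (simp add: mass_def algebra_simps)
  have lnX: "ln X \<ge> 30"
  proof -
    have "exp (L / 2) \<le> X" using assms(1) by (simp add: sqrt_y)
    then have "ln (exp (L / 2)) \<le> ln X" using X1 by (subst ln_le_cancel_iff) auto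
    then have "L / 2 \<le> ln X" by simp
    then show ?thesis using L_ge by simp
  qed
  have "{D<..D\<^sup>2} \<subseteq> ?B"
  proof
    fix e assume e: "e \<in> {D<..D\<^sup>2}"
    then have "real e \<le> sqrt y" using D_square_le by (meson greaterThanAtMost_iff of_nat_le_iff order_trans)
    then show "e \<in> ?B" using e assms(1) sqrt_y_le by (auto simp: smooth_upto_iff intro!: smooth_le)
  qed
  then have "mass X {D<..D\<^sup>2} \<le> mass X ?B"
    unfolding mass_def by (intro sum_mono2) (auto simp: mangoldt_nonneg)
  have "?S = ?B \<union> {d\<in>?S. d \<le> D}" by auto
  then have "mass X ?S = mass X (?B \<union> {d\<in>?S. d \<le> D})" by simp
  also have "\<dots> = mass X ?B + mass X {d\<in>?S. d \<le> D}"
    unfolding mass_def by (intro sum.union_disjoint) auto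
  also have "mass X {d\<in>?S. d \<le> D} \<le> mass X {1..D}"
    unfolding mass_def by (intro sum_mono2) (auto simp: mangoldt_nonneg smooth_upto_iff smooth_def)
  also have "\<dots> \<le> 4 * exp 22 * mass X {D<..D\<^sup>2}" by (rule mass_small_le[OF assms(1) IHu])
  also have "\<dots> \<le> 4 * exp 22 * mass X ?B"
    using \<open>mass X {D<..D\<^sup>2} \<le> mass X ?B\<close> by (intro mult_left_mono) auto
  also have "mass X ?B + 4 * exp 22 * mass X ?B \<le> 5 * exp 22 * mass X ?B"
  proof -
    have "1 * mass X ?B \<le> exp 22 * mass X ?B"
      by (intro mult_right_mono exp_22_ge) (auto simp: mass_def mangoldt_nonneg intro!: sum_nonneg)
    then show ?thesis by linarith
  qed
  finally have "mass X ?S \<le> 5 * exp 22 * mass X ?B" by linarith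
  moreover have "ln X / 2 * real (Psi X y) \<le> (ln X - 14) * real (Psi X y)"
    using lnX by (intro mult_right_mono) auto
  ultimately have "ln X / 2 * real (Psi X y) \<le> 5 * exp 22 * mass X ?B" using tot by linarith
  then show "mass X ?B \<ge> ln X / (10 * exp 22) * real (Psi X y)" by (simp add: field_simps)
qed

lemma lower_growth_base:
  assumes "1 \<le> X" "X \<le> sqrt y"
  shows "lower_growth X"
  unfolding lower_growth_def
proof (intro allI impI)
  fix z assume z: "1 \<le> z" "z \<le> sqrt y"
  have "z * X \<le> sqrt y * sqrt y" using assms z y_pos by (intro mult_mono) auto
  then have zX: "1 \<le> z * X" "z * X \<le> y" using assms z y_pos mult_mono[of 1 z 1 X] by auto
  have "z / 8 * (1 + ln X) powr (-(rate * ln z / L)) * real (Psi X y) \<le> z / 8 * 1 * X"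
    using z assms L_ge rate_ge
    by (intro mult_mono Psi_le) (auto simp: powr_minus inverse_le_1_iff intro!: ge_one_powr_ge_zero)
  also have "\<dots> \<le> real (Psi (z * X) y)" using Psi_ge_half[OF zX] assms z by linarith
  finally show "z / 8 * (1 + ln X) powr (-(rate * ln z / L)) * real (Psi X y) \<le> real (Psi (z * X) y)" .
qed

text \<open>Passing from \<open>X / d\<close> to \<open>X\<close> changes
  \<open>(1 + ln X) powr (-b)\<close> by a factor at least \<open>1 + b * ln d / (1 + t)\<close>, by
  Bernoulli's inequality. Weighted over all \<open>d\<close>, this gain must exceed
  \<open>(14 + ln z) * Psi X y\<close>: the 14 is the error of the identity at \<open>X\<close>, and
  \<open>ln z\<close> comes from \<open>ln (z * X)\<close> on the other side. Moduli above
  \<open>D\<close> suffice, as each has \<open>ln d >= L / 5\<close>.\<close>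

lemma lower_growth_step:
  assumes "sqrt y < X" "X \<le> x"
    and IHl: "\<And>X'. 1 \<le> X' \<Longrightarrow> X' \<le> X / 2 \<Longrightarrow> lower_growth X'"
    and IHu: "\<And>X'. 1 \<le> X' \<Longrightarrow> X' \<le> X / 2 \<Longrightarrow> upper_growth X'"
  shows "lower_growth X"
  unfolding lower_growth_def
proof (intro allI impI)
  fix z assume z: "1 \<le> z" "z \<le> sqrt y"
  have "1 \<le> sqrt y" using y_gt_2 by simp
  then have X1: "X \<ge> 1" using assms by linarith
  define t where "t = ln X"
  have t1: "t \<ge> 1"
  proof -
    have "exp (L / 2) \<le> X" using assms(1) by (simp add: sqrt_y)
    then have "ln (exp (L / 2)) \<le> ln X" using X1 by (subst ln_le_cancel_iff) auto
    then have "L / 2 \<le> ln X" by simp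
    then show ?thesis using L_ge by (simp add: t_def)
  qed
  define b where "b = rate * ln z / L"
  have b0: "b \<ge> 0" using z rate_ge L_ge by (simp add: b_def)
  let ?P = "real (Psi X y)" and ?Q = "real (Psi (z * X) y)"
  have pw: "(1 + t) powr (-b) \<le> 1"
    using t1 b0 by (auto simp: powr_minus inverse_le_1_iff intro!: ge_one_powr_ge_zero)
  show "z / 8 * (1 + ln X) powr (-(rate * ln z / L)) * ?P \<le> ?Q"
  \<comment> \<open>The factor 1/8 in \<open>lower_growth\<close> makes small \<open>z\<close> a
    matter of monotonicity. For \<open>z > 8\<close> there is \<open>ln z >= 2\<close>, hence
    \<open>8 * ln z >= 14 + ln z\<close>, the inequality on which the gain rests.\<close>
  proof (cases "z \<le> 8")
    case True
    have "z / 8 * (1 + t) powr (-b) * ?P \<le> 1 * 1 * ?P"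
      using True z pw by (intro mult_right_mono mult_mono) auto
    also have "\<dots> \<le> ?Q" using z X1 mult_right_mono[of 1 z X] by (simp add: Psi_mono)
    finally show ?thesis by (simp add: t_def b_def)
  next
    case False
    have lnz: "ln z \<ge> 2"
    proof -
      have "3 * ln 2 = ln (2 ^ 3 :: real)" by (subst ln_realpow) auto
      also have "\<dots> \<le> ln z" using False by (subst ln_le_cancel_iff) auto
      finally show ?thesis using ln2_ge_two_thirds by linarith
    qed
    define S where "S = smooth_upto X y"
    have term_ge: "vonMangoldt d * real (Psi (z * X / real d) y) \<ge>
        z / 8 * (1 + t) powr (-b) * (vonMangoldt d * (1 + b / (1 + t) * ln (real d)) * real (Psi (X / real d) y))"
      if d: "d \<in> S" for d
    proof (cases "d \<ge> 2")
      case True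
      then have d1: "real d \<le> X" using d by (simp add: S_def smooth_upto_iff)
      have "X / real d \<le> X / 2" using True X1 by (intro divide_left_mono) auto
      moreover have "1 \<le> X / real d" using True d1 by simp
      ultimately have "lower_growth (X / real d)" by (intro IHl) auto
      then have "z / 8 * (1 + ln (X / real d)) powr (-b) * real (Psi (X / real d) y) \<le> real (Psi (z * (X / real d)) y)"
        using z by (auto simp: lower_growth_def b_def)
      moreover have "(1 + t) powr (-b) * (1 + b / (1 + t) * ln (real d)) \<le> (1 + ln (X / real d)) powr (-b)"
      proof -
        define v where "v = ln (real d) / (1 + t)"
        have "ln (real d) \<le> t" using d1 True X1 by (simp add: t_def)
        then have v: "0 \<le> v" "v < 1" using True t1 by (auto simp: v_def)
        have "(1 + t) * v = ln (real d)" using t1 by (simp add: v_def)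
        then have eq: "1 + ln (X / real d) = (1 + t) * (1 - v)"
          unfolding right_diff_distrib using True X1 by (simp add: t_def ln_div)
        have "(1 + t) powr (-b) * (1 + b * v) \<le> (1 + t) powr (-b) * (1 - v) powr (-b)"
          using v b0 by (intro mult_left_mono one_minus_powr_ge) auto
        also have "\<dots> = (1 + ln (X / real d)) powr (-b)" unfolding eq using t1 v by (simp add: powr_mult)
        finally show ?thesis by (simp add: v_def)
      qed
      then have "z / 8 * ((1 + t) powr (-b) * (1 + b / (1 + t) * ln (real d))) * real (Psi (X / real d) y) \<le>
          z / 8 * (1 + ln (X / real d)) powr (-b) * real (Psi (X / real d) y)"
        using z by (intro mult_right_mono mult_left_mono) auto
      ultimately have "z / 8 * ((1 + t) powr (-b) * (1 + b / (1 + t) * ln (real d))) * real (Psi (X / real d) y) \<le>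
          real (Psi (z * (X / real d)) y)" by linarith
      then have "vonMangoldt d * (z / 8 * ((1 + t) powr (-b) * (1 + b / (1 + t) * ln (real d))) * real (Psi (X / real d) y)) \<le>
          vonMangoldt d * real (Psi (z * (X / real d)) y)"
        by (intro mult_left_mono mangoldt_nonneg)
      then show ?thesis by (simp add: mult_ac)
    next
      case False
      then have "d = 0 \<or> d = 1" by auto
      then show ?thesis by auto
    qed
    have "(\<Sum>d\<in>S. vonMangoldt d * (1 + b / (1 + t) * ln (real d)) * real (Psi (X / real d) y)) =
        mass X S + b / (1 + t) * (\<Sum>d\<in>S. vonMangoldt d * ln (real d) * real (Psi (X / real d) y))"
      by (simp add: mass_def sum.distrib sum_distrib_left algebra_simps)
    moreover have "(\<Sum>d\<in>S. vonMangoldt d * ln (real d) * real (Psi (X / real d) y)) \<ge> L / 5 * (t / (10 * exp 22) * ?P)"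
    proof -
      have "L / 5 * (t / (10 * exp 22) * ?P) \<le> L / 5 * mass X {d\<in>S. d > D}"
        unfolding S_def t_def using L_ge by (intro mult_left_mono mass_large_ge(2) assms IHl IHu) auto
      also have "\<dots> = (\<Sum>d\<in>{d\<in>S. d > D}. vonMangoldt d * (L / 5) * real (Psi (X / real d) y))"
        by (simp add: mass_def sum_distrib_left mult_ac)
      also have "\<dots> \<le> (\<Sum>d\<in>{d\<in>S. d > D}. vonMangoldt d * ln (real d) * real (Psi (X / real d) y))"
      proof (intro sum_mono mult_right_mono mult_left_mono)
        fix d assume "d \<in> {d\<in>S. d > D}"
        then have "ln (real D) \<le> ln (real d)" using D_gt by simp
        then show "L / 5 \<le> ln (real d)" using ln_D_ge by linarith
      qed (auto simp: mangoldt_nonneg)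
      also have "\<dots> \<le> (\<Sum>d\<in>S. vonMangoldt d * ln (real d) * real (Psi (X / real d) y))"
        by (intro sum_mono2 mult_nonneg_nonneg)
           (auto simp: mangoldt_nonneg S_def smooth_upto_iff smooth_def)
      finally show ?thesis .
    qed
    moreover have "mass X S \<ge> (t - 14) * ?P"
      unfolding S_def t_def by (intro mass_large_ge(1) assms IHl IHu)
    ultimately have "(\<Sum>d\<in>S. vonMangoldt d * (1 + b / (1 + t) * ln (real d)) * real (Psi (X / real d) y)) \<ge>
        (t - 14) * ?P + b / (1 + t) * (L / 5 * (t / (10 * exp 22) * ?P))"
      (is "?W \<ge> _ + ?c * ?T")
    proof -
      assume eq: "?W = mass X S + ?c * (\<Sum>d\<in>S. vonMangoldt d * ln (real d) * real (Psi (X / real d) y))"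
        and T: "(\<Sum>d\<in>S. vonMangoldt d * ln (real d) * real (Psi (X / real d) y)) \<ge> ?T"
        and m: "mass X S \<ge> (t - 14) * ?P"
      have "?c \<ge> 0" using b0 t1 by simp
      from mult_left_mono[OF T this] m show ?thesis unfolding eq by linarith
    qed
    moreover have "b / (1 + t) * (L / 5 * (t / (10 * exp 22) * ?P)) \<ge> (14 + ln z) * ?P"
    proof -
      have "b / (1 + t) * (L / 5 * (t / (10 * exp 22) * ?P)) = 16 * ln z * (t / (1 + t)) * ?P"
      proof -
        have bL: "b * L = 800 * exp 22 * ln z" using L_ge by (simp add: b_def rate_def)
        define w where "w = t / (1 + t)"
        have "b / (1 + t) * (L / 5 * (t / (10 * exp 22) * ?P)) = (b * L) * w * ?P / (50 * exp 22)"
          by (simp add: w_def)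
        also have "\<dots> = 16 * ln z * w * ?P" unfolding bL by simp
        finally show ?thesis by (simp add: w_def)
      qed
      moreover have "16 * ln z * (1 / 2) * ?P \<le> 16 * ln z * (t / (1 + t)) * ?P"
        using lnz t1 by (intro mult_right_mono mult_left_mono) (auto simp: field_simps)
      moreover have "(14 + ln z) * ?P \<le> 16 * ln z * (1 / 2) * ?P"
        using lnz by (intro mult_right_mono) auto
      ultimately show ?thesis by linarith
    qed
    ultimately have "(t + ln z) * ?P \<le> (\<Sum>d\<in>S. vonMangoldt d * (1 + b / (1 + t) * ln (real d)) * real (Psi (X / real d) y))"
      by (simp add: algebra_simps)
    then have "z / 8 * (1 + t) powr (-b) * ((t + ln z) * ?P) \<le> z / 8 * (1 + t) powr (-b) * 
        (\<Sum>d\<in>S. vonMangoldt d * (1 + b / (1 + t) * ln (real d)) * real (Psi (X / real d) y))"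
      using z by (intro mult_left_mono) auto
    also have "\<dots> \<le> (\<Sum>d\<in>S. vonMangoldt d * real (Psi (z * X / real d) y))"
      unfolding sum_distrib_left by (intro sum_mono term_ge)
    also have "\<dots> \<le> ln (z * X) * ?Q"
      using z X1 mult_mono[of 1 z 1 X] by (intro sum_mangoldt_Psi_le) (auto simp: S_def smooth_upto_iff)
    also have "ln (z * X) = t + ln z" using z X1 by (simp add: ln_mult t_def)
    finally have "(t + ln z) * (z / 8 * (1 + t) powr (-b) * ?P) \<le> (t + ln z) * ?Q" by (simp add: mult_ac)
    then have "z / 8 * (1 + t) powr (-b) * ?P \<le> ?Q" using t1 lnz by simp
    then show ?thesis by (simp add: t_def b_def)
  qed
qed

lemma growth_induction:
  assumes "1 \<le> X" "X \<le> x"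
  shows "lower_growth X \<and> upper_growth X"
proof -
  have "\<forall>X. 1 \<le> X \<longrightarrow> X \<le> x \<longrightarrow> X \<le> 2 ^ n \<longrightarrow> lower_growth X \<and> upper_growth X" for n
  proof (induction n)
    case 0
    have "1 \<le> sqrt y" using y_gt_2 by simp
    then show ?case using lower_growth_base upper_growth_base y_gt_2 by simp
  next
    case (Suc n)
    show ?case
    proof (intro allI impI)
      fix X assume X: "1 \<le> X" "X \<le> x" "X \<le> 2 ^ Suc n"
      have IH: "lower_growth X'" "upper_growth X'" if "1 \<le> X'" "X' \<le> X / 2" for X'
        using Suc.IH that X by auto
      show "lower_growth X \<and> upper_growth X"
        using lower_growth_base[of X] upper_growth_base[of X] X
          lower_growth_step[OF _ X(2) IH] upper_growth_step[OF _ X(2) IH] by fastforce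
    qed
  qed
  moreover obtain n where "X \<le> 2 ^ n" using real_arch_pow[of 2 X] by (auto intro: less_imp_le)
  ultimately show ?thesis using assms by blast
qed

text \<open>Write \<open>Z = z * s ^ i\<close> with \<open>s = sqrt y\<close> and
  \<open>1 <= z <= s\<close>. The full steps lose no constant, so the factor 8 is paid only once,
  for \<open>z\<close>.\<close>

lemma Psi_divide_growth:
  assumes "Z \<ge> 1"
  shows "real (Psi (x / Z) y) \<le> 8 * Z powr (-(3/4)) * real (Psi x y)"
proof -
  define s where "s = sqrt y"
  have s1: "s > 1" using y_gt_2 by (simp add: s_def)
  define i where "i = nat \<lfloor>ln Z / ln s\<rfloor>"
  define z where "z = Z / s ^ i"
  have "real i \<le> ln Z / ln s" "ln Z / ln s < real i + 1"
    using assms s1 by (auto simp: i_def)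
  then have "ln (s ^ i) \<le> ln Z" "ln Z \<le> ln (s ^ (i + 1))" using s1 by (auto simp: ln_realpow field_simps ln_mult)
  then have "s ^ i \<le> Z" "Z \<le> s ^ (i + 1)" using s1 assms ln_le_cancel_iff[of "s ^ i" Z] ln_le_cancel_iff[of Z "s ^ (i + 1)"] by simp_all
  then have z: "1 \<le> z" "z \<le> s" using s1 by (auto simp: z_def field_simps)
  have xz: "x / z \<le> x" "x / z > 0" using z x_ge_1 by (auto simp: field_simps)
  have "real (Psi (x / z / s ^ j) y) \<le> (s powr (-(3/4))) ^ j * real (Psi (x / z) y)" for j
  proof (induction j)
    case (Suc j)
    have "1 \<le> s ^ j" using s1 by simp
    then have "x / z / s ^ j \<le> x / z / 1" using xz by (intro divide_left_mono) auto
    moreover have "x / z / s ^ j > 0" using z s1 x_ge_1 by (intro divide_pos_pos) auto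
    ultimately have "real (Psi (x / z / s ^ j / sqrt y) y) \<le> sqrt y powr (-(3/4)) * real (Psi (x / z / s ^ j) y)"
      using xz by (intro Psi_sqrt_le) auto
    also have "\<dots> \<le> s powr (-(3/4)) * ((s powr (-(3/4))) ^ j * real (Psi (x / z) y))"
      unfolding s_def by (intro mult_left_mono Suc.IH[unfolded s_def]) auto
    finally show ?case by (simp add: s_def mult_ac)
  qed simp
  from this[of i] have 1: "real (Psi (x / Z) y) \<le> (s powr (-(3/4))) ^ i * real (Psi (x / z) y)"
    using s1 by (simp add: z_def)
  have 2: "real (Psi (x / z) y) \<le> 8 * z powr (-(3/4)) * real (Psi x y)"
  proof (cases "x / z \<ge> 1")
    case True
    then have "real (Psi (x / z) y) \<le> 8 * z powr (-(3/4)) * real (Psi (z * (x / z)) y)"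
      using growth_induction xz z by (intro lower_growthD) (auto simp: s_def)
    then show ?thesis using z by simp
  qed (simp add: Psi_eq_0)
  have "real (Psi (x / Z) y) \<le> (s powr (-(3/4))) ^ i * (8 * z powr (-(3/4)) * real (Psi x y))"
    using 1 2 by (meson mult_left_mono order_trans powr_ge_zero zero_le_power)
  also have "\<dots> = 8 * ((s ^ i) powr (-(3/4)) * z powr (-(3/4))) * real (Psi x y)"
    using s1 by (simp add: powr_powr mult.commute flip: powr_realpow)
  also have "(s ^ i) powr (-(3/4)) * z powr (-(3/4)) = Z powr (-(3/4))"
    using s1 z by (subst powr_mult[symmetric]) (auto simp: z_def)
  finally show ?thesis .
qed

end

section \<open>Orthogonality\<close>

lemma has_bochner_integral_cis:
  fixes c :: int
  shows "has_bochner_integral lborel (\<lambda>t. indicator {0..2 * pi} t *\<^sub>R cis (of_int c * t))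
     (if c = 0 then complex_of_real (2 * pi) else 0)"
proof (cases "c = 0")
  case True
  have "has_bochner_integral lborel (\<lambda>t. indicator {0..2 * pi} t *\<^sub>R (1::complex))
      (complex_of_real (2 * pi) - complex_of_real 0)"
    by (rule has_bochner_integral_FTC_Icc)
       (auto intro!: derivative_eq_intros simp: has_vector_derivative_def scaleR_conv_of_real[abs_def])
  then show ?thesis using True by simp
next
  case False
  have "has_bochner_integral lborel (\<lambda>t. indicator {0..2 * pi} t *\<^sub>R cis (of_int c * t))
      (cis (of_int c * (2 * pi)) / (\<i> * of_int c) - cis (of_int c * 0) / (\<i> * of_int c))"
  proof (rule has_bochner_integral_FTC_Icc)
    fix t :: real
    have "((\<lambda>z. exp (\<i> * of_int c * z) / (\<i> * of_int c)) has_field_derivative exp (\<i> * of_int c * complex_of_real t))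
        (at (complex_of_real t))"
      using False by (auto intro!: derivative_eq_intros)
    from has_vector_derivative_real_field[OF this, of "{0..2 * pi}"]
    show "((\<lambda>t. cis (of_int c * t) / (\<i> * of_int c)) has_vector_derivative cis (of_int c * t))
       (at t within {0..2 * pi})"
      by (simp add: cis_conv_exp mult_ac)
  qed (auto intro!: continuous_intros)
  moreover have "cis (of_int c * (2 * pi)) = 1"
    using cis_multiple_2pi[of "of_int c"] by (simp add: mult_ac)
  ultimately show ?thesis using False by simp
qed

lemma circle_uniform_moment:
  shows "integrable circle_uniform (\<lambda>z. z ^ a * cnj z ^ b)"
    and "(\<integral>z. z ^ a * cnj z ^ b \<partial>circle_uniform) = (if a = b then 1 else 0)"
proof -
  define c where "c = int a - int b"
  let ?U = "uniform_measure lborel {0..2 * pi}"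
  have U: "?U = density lborel (\<lambda>t. ennreal (indicator {0..2 * pi} t / (2 * pi)))"
    unfolding uniform_measure_def
  proof (intro density_cong AE_I2)
    fix t :: real
    show "indicator {0..2 * pi} t / emeasure lborel {0..2 * pi} = ennreal (indicator {0..2 * pi} t / (2 * pi))"
      by (auto simp: indicator_def divide_ennreal[symmetric])
  qed auto
  have cis: "cis \<in> borel_measurable ?U"
    by (simp add: uniform_measure_def borel_measurable_continuous_onI continuous_intros)
  have meas: "(\<lambda>z. z ^ a * cnj z ^ b) \<in> borel_measurable borel"
    by (intro borel_measurable_continuous_onI continuous_intros)
  have eq: "cis t ^ a * cnj (cis t) ^ b = cis (of_int c * t)" for t
    unfolding cis_cnj Complex.DeMoivre cis_mult by (simp add: c_def algebra_simps)
  have meas': "(\<lambda>t. cis (of_int c * t)) \<in> borel_measurable lborel"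
    by (simp add: borel_measurable_continuous_onI continuous_intros)
  let ?g = "\<lambda>t. (indicator {0..2 * pi} t / (2 * pi)) *\<^sub>R cis (of_int c * t)"
  have hb: "has_bochner_integral lborel ?g (if a = b then 1 else 0)"
  proof -
    have "has_bochner_integral lborel (\<lambda>t. (1 / (2 * pi)) *\<^sub>R (indicator {0..2 * pi} t *\<^sub>R cis (of_int c * t)))
        ((1 / (2 * pi)) *\<^sub>R (if c = 0 then complex_of_real (2 * pi) else 0))"
      by (intro has_bochner_integral_scaleR_right has_bochner_integral_cis)
    moreover have "(1 / (2 * pi)) *\<^sub>R (if c = 0 then complex_of_real (2 * pi) else 0) = (if a = b then 1 else 0)"
      by (simp add: c_def scaleR_conv_of_real)
    moreover have "(1 / (2 * pi)) *\<^sub>R (indicator {0..2 * pi} t *\<^sub>R cis (of_int c * t)) = ?g t" for t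
      by (simp only: scaleR_scaleR) simp
    ultimately show ?thesis by simp
  qed
  have gm: "(\<lambda>t. indicator {0..2 * pi} t / (2 * pi)) \<in> borel_measurable lborel" "AE t in lborel. 0 \<le> indicator {0..2 * pi} t / (2 * pi)"
    by (auto simp: indicator_def)
  show "integrable circle_uniform (\<lambda>z. z ^ a * cnj z ^ b)"
    unfolding circle_uniform_def integrable_distr_eq[OF cis meas] eq unfolding U integrable_density[OF meas' gm]
    using hb by (simp only: has_bochner_integral_iff)
  show "(\<integral>z. z ^ a * cnj z ^ b \<partial>circle_uniform) = (if a = b then 1 else 0)"
    unfolding circle_uniform_def integral_distr[OF cis meas] eq unfolding U integral_density[OF meas' gm]
    using hb by (simp only: has_bochner_integral_iff)
qed

context random_completely_multiplicative
begin

lemma X_eq_prod: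
  assumes "n > 0" "\<omega> \<in> space M" "finite P" "prime_factors n \<subseteq> P" "\<And>p. p \<in> P \<Longrightarrow> prime p"
  shows "X n \<omega> = (\<Prod>p\<in>P. X p \<omega> ^ multiplicity p n)"
  unfolding multiplicative[OF assms(1,2)]
proof (intro prod.mono_neutral_left ballI)
  fix p assume "p \<in> P - prime_factors n"
  then have "multiplicity p n = 0"
    using assms by (auto simp: prime_factors_multiplicity)
  then show "X p \<omega> ^ multiplicity p n = 1" by simp
qed (use assms in auto)

lemma X_mult:
  assumes "m > 0" "n > 0" "\<omega> \<in> space M"
  shows "X (m * n) \<omega> = X m \<omega> * X n \<omega>"
proof -
  let ?P = "prime_factors (m * n)"
  have P: "prime_factors m \<subseteq> ?P" "prime_factors n \<subseteq> ?P" using assms by (auto simp: prime_factors_product)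
  have "X (m * n) \<omega> = (\<Prod>p\<in>?P. X p \<omega> ^ multiplicity p (m * n))"
    using assms by (intro multiplicative) auto
  also have "\<dots> = (\<Prod>p\<in>?P. X p \<omega> ^ multiplicity p m * X p \<omega> ^ multiplicity p n)"
    using assms by (intro prod.cong refl) (subst prime_elem_multiplicity_mult_distrib, auto simp: power_add)
  also have "\<dots> = X m \<omega> * X n \<omega>"
  proof -
    have "X m \<omega> = (\<Prod>p\<in>?P. X p \<omega> ^ multiplicity p m)" "X n \<omega> = (\<Prod>p\<in>?P. X p \<omega> ^ multiplicity p n)"
      using P assms by (intro X_eq_prod; auto)+
    then show ?thesis by (simp only: prod.distrib)
  qed
  finally show ?thesis .
qed

lemma X_one: "\<omega> \<in> space M \<Longrightarrow> X 1 \<omega> = 1"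
  using multiplicative[of 1 \<omega>] by simp

text \<open>Over the primes dividing \<open>m\<close> or \<open>n\<close> the integrand is a product
  of independent factors; the factor at \<open>p\<close> has mean 1 or 0 according to whether the
  two multiplicities of \<open>p\<close> agree.\<close>

lemma orthogonality:
  assumes "m > 0" "n > 0"
  shows "integrable M (\<lambda>\<omega>. X m \<omega> * cnj (X n \<omega>))"
    and "expectation (\<lambda>\<omega>. X m \<omega> * cnj (X n \<omega>)) = (if m = n then 1 else 0)"
proof -
  define P where "P = prime_factors m \<union> prime_factors n"
  have P: "finite P" "prime_factors m \<subseteq> P" "prime_factors n \<subseteq> P" "\<And>p. p \<in> P \<Longrightarrow> prime p"
    by (auto simp: P_def)
  define Y where "Y = (\<lambda>p z. z ^ multiplicity p m * cnj z ^ multiplicity p n :: complex)"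
  have eq: "X m \<omega> * cnj (X n \<omega>) = (\<Prod>p\<in>P. Y p (X p \<omega>))" if "\<omega> \<in> space M" for \<omega>
  proof -
    have "X m \<omega> = (\<Prod>p\<in>P. X p \<omega> ^ multiplicity p m)" "X n \<omega> = (\<Prod>p\<in>P. X p \<omega> ^ multiplicity p n)"
      using P assms that by (intro X_eq_prod; auto)+
    then show ?thesis unfolding Y_def by (simp only: prod.distrib cnj_prod complex_cnj_power)
  qed
  have Y: "Y p \<in> borel_measurable borel" for p
    unfolding Y_def by (intro borel_measurable_continuous_onI continuous_intros)
  have rv: "X p \<in> borel_measurable M" if "prime p" for p
    using indep that by (auto simp: indep_vars_def)
  have ind: "indep_vars (\<lambda>_. borel) (\<lambda>p \<omega>. Y p (X p \<omega>)) P"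
  proof (rule indep_vars_compose2[where Y = Y])
    show "indep_vars (\<lambda>_. borel) X P" using P(4) by (intro indep_vars_subset[OF indep]) auto
  qed (rule Y)
  have int: "integrable M (\<lambda>\<omega>. Y p (X p \<omega>))"
    and ex: "expectation (\<lambda>\<omega>. Y p (X p \<omega>)) = (if multiplicity p m = multiplicity p n then 1 else 0)"
    if "p \<in> P" for p
  proof -
    have p: "prime p" using P that by auto
    show "integrable M (\<lambda>\<omega>. Y p (X p \<omega>))"
      using integrable_distr_eq[OF rv[OF p] Y[of p]] uniform[OF p] circle_uniform_moment(1) by (simp add: Y_def)
    show "expectation (\<lambda>\<omega>. Y p (X p \<omega>)) = (if multiplicity p m = multiplicity p n then 1 else 0)"
      using integral_distr[OF rv[OF p] Y[of p]] uniform[OF p] circle_uniform_moment(2) by (simp add: Y_def)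
  qed
  show "integrable M (\<lambda>\<omega>. X m \<omega> * cnj (X n \<omega>))"
  proof (rule iffD2[OF Bochner_Integration.integrable_cong[OF refl]])
    show "integrable M (\<lambda>\<omega>. \<Prod>p\<in>P. Y p (X p \<omega>))" by (rule indep_vars_integrable[OF P(1) ind int])
  qed (rule eq)
  have "expectation (\<lambda>\<omega>. X m \<omega> * cnj (X n \<omega>)) = expectation (\<lambda>\<omega>. \<Prod>p\<in>P. Y p (X p \<omega>))"
    by (intro Bochner_Integration.integral_cong refl eq)
  also have "\<dots> = (\<Prod>p\<in>P. if multiplicity p m = multiplicity p n then 1 else 0)"
  proof -
    have "expectation (\<lambda>\<omega>. \<Prod>p\<in>P. Y p (X p \<omega>)) = (\<Prod>p\<in>P. expectation (\<lambda>\<omega>. Y p (X p \<omega>)))"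
      by (rule indep_vars_lebesgue_integral[OF P(1) ind int])
    also have "\<dots> = (\<Prod>p\<in>P. if multiplicity p m = multiplicity p n then 1 else 0)"
      by (intro prod.cong refl ex)
    finally show ?thesis .
  qed
  also have "\<dots> = (if m = n then 1 else 0)"
  proof (cases "m = n")
    case True
    then show ?thesis by (simp only: if_True refl prod.neutral_const)
  next
    case False
    have "\<exists>p\<in>P. multiplicity p m \<noteq> multiplicity p n"
    proof (rule ccontr)
      assume *: "\<not> (\<exists>p\<in>P. multiplicity p m \<noteq> multiplicity p n)"
      have "multiplicity p m = multiplicity p n" if "prime p" for p
      proof (cases "p \<in> P")
        case True
        with * show ?thesis by blast
      next
        case False
        then have "multiplicity p m = 0" "multiplicity p n = 0"
          using that by (simp_all add: P_def prime_factors_multiplicity)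
        then show ?thesis by (simp only:)
      qed
      from multiplicity_eq_nat[OF assms this] have "m = n" .
      with False show False by simp
    qed
    then have "(\<Prod>p\<in>P. if multiplicity p m = multiplicity p n then 1 else 0 :: complex) = 0"
      by (intro prod_zero P(1)) auto
    with False show ?thesis by (simp only: if_False)
  qed
  finally show "expectation (\<lambda>\<omega>. X m \<omega> * cnj (X n \<omega>)) = (if m = n then 1 else 0)" .
qed

end

section \<open>Even moments as counts of pairs of tuples\<close>

definition tuples :: "nat \<Rightarrow> nat set \<Rightarrow> nat list set" where
  "tuples k A = {xs. length xs = k \<and> set xs \<subseteq> A}"

lemma finite_tuples [intro]: "finite A \<Longrightarrow> finite (tuples k A)"
  using finite_lists_length_eq[of A k] by (simp add: tuples_def conj_commute)

lemma tuples_0 [simp]: "tuples 0 A = {[]}"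
  by (auto simp: tuples_def)

lemma sum_tuples_Suc:
  fixes f :: "nat list \<Rightarrow> 'b :: comm_monoid_add"
  assumes "finite A"
  shows "(\<Sum>xs\<in>tuples (Suc k) A. f xs) = (\<Sum>x\<in>A. \<Sum>xs\<in>tuples k A. f (x # xs))"
proof -
  have "(\<Sum>x\<in>A. \<Sum>xs\<in>tuples k A. f (x # xs)) = (\<Sum>(x, xs)\<in>A \<times> tuples k A. f (x # xs))"
    using assms by (subst sum.cartesian_product) auto
  also have "\<dots> = (\<Sum>xs\<in>tuples (Suc k) A. f xs)"
    by (rule sum.reindex_bij_witness[of _ "\<lambda>xs. (hd xs, tl xs)" "\<lambda>(x, xs). x # xs"])
       (auto simp: tuples_def length_Suc_conv)
  finally show ?thesis ..
qed

lemma sum_power_tuples: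
  fixes f :: "nat \<Rightarrow> 'b :: comm_semiring_1"
  assumes "finite A"
  shows "(\<Sum>x\<in>A. f x) ^ k = (\<Sum>xs\<in>tuples k A. prod_list (map f xs))"
  by (induction k) (simp_all add: sum_tuples_Suc[OF assms] sum_product)

lemma prod_list_pos: "xs \<in> tuples k A \<Longrightarrow> (\<And>a. a \<in> A \<Longrightarrow> a > 0) \<Longrightarrow> prod_list xs > (0::nat)"
  unfolding tuples_def by (induction xs arbitrary: k) auto

context random_completely_multiplicative
begin

lemma X_prod_list:
  assumes "\<And>a. a \<in> A \<Longrightarrow> a > 0" "\<omega> \<in> space M" "xs \<in> tuples k A"
  shows "X (prod_list xs) \<omega> = prod_list (map (\<lambda>n. X n \<omega>) xs)"
  using assms(3)
proof (induction k arbitrary: xs)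
  case 0
  then show ?case using X_one[OF assms(2)] by simp
next
  case (Suc k)
  then obtain y ys where xs: "xs = y # ys" "y \<in> A" "ys \<in> tuples k A"
    by (auto simp: tuples_def length_Suc_conv)
  then have "prod_list ys > 0" using assms(1) prod_list_pos by blast
  then show ?case using xs assms X_mult[of y "prod_list ys" \<omega>] Suc.IH[of ys] by simp
qed

lemma moment_eq_count:
  assumes "finite A" "\<And>a. a \<in> A \<Longrightarrow> a > 0"
  shows "expectation (\<lambda>\<omega>. norm (\<Sum>n\<in>A. X n \<omega>) ^ (2 * k)) =
     (\<Sum>xs\<in>tuples k A. \<Sum>ys\<in>tuples k A. if prod_list xs = prod_list ys then 1 else 0)"
proof -
  let ?T = "tuples k A"
  have T: "finite ?T" using assms by auto
  have eq: "complex_of_real (norm (\<Sum>n\<in>A. X n \<omega>) ^ (2 * k)) =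
      (\<Sum>xs\<in>?T. \<Sum>ys\<in>?T. X (prod_list xs) \<omega> * cnj (X (prod_list ys) \<omega>))" if "\<omega> \<in> space M" for \<omega>
  proof -
    have D: "(\<Sum>n\<in>A. X n \<omega>) ^ k = (\<Sum>xs\<in>?T. X (prod_list xs) \<omega>)"
      unfolding sum_power_tuples[OF assms(1)] using X_prod_list[OF assms(2) that] by simp
    have "complex_of_real (norm (\<Sum>n\<in>A. X n \<omega>) ^ (2 * k)) = (complex_of_real ((norm (\<Sum>n\<in>A. X n \<omega>))\<^sup>2)) ^ k"
      by (simp add: power_mult)
    also have "\<dots> = (\<Sum>n\<in>A. X n \<omega>) ^ k * cnj ((\<Sum>n\<in>A. X n \<omega>) ^ k)"
      unfolding complex_norm_square by (simp add: power_mult_distrib)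
    finally show ?thesis unfolding D by (simp add: sum_product)
  qed
  have int: "integrable M (\<lambda>\<omega>. X (prod_list xs) \<omega> * cnj (X (prod_list ys) \<omega>))"
    and ex: "expectation (\<lambda>\<omega>. X (prod_list xs) \<omega> * cnj (X (prod_list ys) \<omega>)) =
       (if prod_list xs = prod_list ys then 1 else 0)"
    if "xs \<in> ?T" "ys \<in> ?T" for xs ys
  proof -
    have pos: "prod_list xs > 0" "prod_list ys > 0"
      using that assms(2) by (auto intro: prod_list_pos)
    show "integrable M (\<lambda>\<omega>. X (prod_list xs) \<omega> * cnj (X (prod_list ys) \<omega>))"
      by (rule orthogonality(1)[OF pos])
    show "expectation (\<lambda>\<omega>. X (prod_list xs) \<omega> * cnj (X (prod_list ys) \<omega>)) =
       (if prod_list xs = prod_list ys then 1 else 0)"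
      by (rule orthogonality(2)[OF pos])
  qed
  have "complex_of_real (expectation (\<lambda>\<omega>. norm (\<Sum>n\<in>A. X n \<omega>) ^ (2 * k))) =
      expectation (\<lambda>\<omega>. complex_of_real (norm (\<Sum>n\<in>A. X n \<omega>) ^ (2 * k)))"
    by (rule integral_complex_of_real[symmetric])
  also have "\<dots> = expectation (\<lambda>\<omega>. \<Sum>xs\<in>?T. \<Sum>ys\<in>?T. X (prod_list xs) \<omega> * cnj (X (prod_list ys) \<omega>))"
    by (intro Bochner_Integration.integral_cong refl eq)
  also have "\<dots> = (\<Sum>xs\<in>?T. \<Sum>ys\<in>?T. if prod_list xs = prod_list ys then 1 else 0)"
    using int ex by (subst Bochner_Integration.integral_sum, auto)
  also have "\<dots> = complex_of_real (\<Sum>xs\<in>?T. \<Sum>ys\<in>?T. if prod_list xs = prod_list ys then 1 else 0)"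
    by (simp add: if_distrib cong: if_cong)
  finally show ?thesis by (simp only: of_real_eq_iff)
qed

end

section \<open>Tuples with equal products\<close>

text \<open>Ordered factorisations, to match \<open>tuples\<close>. For \<open>n = 0\<close> and
  \<open>k >= 2\<close> the set is infinite and \<open>card\<close> returns 0, which is why
  positivity is assumed throughout.\<close>

definition divs :: "nat \<Rightarrow> nat \<Rightarrow> nat" where
  "divs k n = card {xs. length xs = k \<and> prod_list xs = n}"

lemma divs_set_eq:
  assumes "n > 0"
  shows "{xs. length xs = k \<and> prod_list xs = n} = {xs\<in>tuples k {d. d dvd n}. prod_list xs = n}"
  by (auto simp: tuples_def prod_list_dvd)

lemma finite_divs_set:
  assumes "n > 0"
  shows "finite {xs. length xs = k \<and> prod_list xs = (n::nat)}"
proof -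
  have "finite {d. d dvd n}" using assms by simp
  then show ?thesis unfolding divs_set_eq[OF assms]
    by (rule finite_subset[OF _ finite_tuples, rotated]) auto
qed

lemma divs_0: "divs 0 n = (if n = 1 then 1 else 0)"
proof -
  have "{xs. length xs = 0 \<and> prod_list xs = n} = (if n = 1 then {[]} else {})" by auto
  then show ?thesis unfolding divs_def by simp
qed

lemma divs_Suc:
  assumes "n > 0"
  shows "divs (Suc k) n = (\<Sum>d | d dvd n. divs k (n div d))"
proof -
  have fin: "finite {d. d dvd n}" using assms by simp
  have "{xs. length xs = Suc k \<and> prod_list xs = n} =
      (\<Union>d\<in>{d. d dvd n}. (#) d ` {xs. length xs = k \<and> prod_list xs = n div d})"
  proof (intro set_eqI iffI)
    fix xs assume "xs \<in> {xs. length xs = Suc k \<and> prod_list xs = n}"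
    then obtain d ys where "xs = d # ys" "length ys = k" "n = d * prod_list ys"
      by (auto simp: length_Suc_conv)
    then show "xs \<in> (\<Union>d\<in>{d. d dvd n}. (#) d ` {xs. length xs = k \<and> prod_list xs = n div d})"
      using assms by (intro UN_I[of d]) auto
  qed auto
  then have "divs (Suc k) n = (\<Sum>d | d dvd n. card ((#) d ` {xs. length xs = k \<and> prod_list xs = n div d}))"
    unfolding divs_def using fin assms
    by (subst card_UN_disjoint[symmetric]) (auto intro!: finite_imageI finite_divs_set div_greater_zero_iff[THEN iffD2] dest: dvd_imp_le dvd_pos_nat)
  then show ?thesis unfolding divs_def by (simp add: card_image)
qed

text \<open>Every divisor of \<open>m * n\<close> is a divisor of \<open>m\<close> times a divisor
  of \<open>n\<close>, possibly in several ways, hence an inequality. It needs no coprimality, so it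
  applies to tuples whose entries share primes.\<close>

lemma divs_submult:
  assumes "m > 0" "n > 0"
  shows "divs k (m * n) \<le> divs k m * divs k n"
  using assms
proof (induction k arbitrary: m n)
  case 0
  then show ?case by (auto simp: divs_0)
next
  case (Suc k)
  let ?A = "{d. d dvd m}" and ?B = "{d. d dvd n}"
  have fin: "finite ?A" "finite ?B" using Suc by auto
  have img: "{d. d dvd m * n} = (\<lambda>(a, b). a * b) ` (?A \<times> ?B)"
    by (auto simp: image_iff mult_dvd_mono dest: division_decomp)
  have "divs (Suc k) (m * n) = (\<Sum>d\<in>(\<lambda>(a, b). a * b) ` (?A \<times> ?B). divs k (m * n div d))"
    using Suc by (subst divs_Suc) (auto simp: img)
  also have "\<dots> \<le> (\<Sum>(a, b)\<in>?A \<times> ?B. divs k (m * n div (a * b)))"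
    using fin by (intro order_trans[OF sum_image_le]) (auto simp: case_prod_unfold)
  also have "\<dots> \<le> (\<Sum>(a, b)\<in>?A \<times> ?B. divs k (m div a) * divs k (n div b))"
  proof (intro sum_mono, safe)
    fix a b assume ab: "a dvd m" "b dvd n"
    have "divs k ((m div a) * (n div b)) \<le> divs k (m div a) * divs k (n div b)"
      using Suc ab by (intro Suc.IH) (auto simp: div_greater_zero_iff dest: dvd_imp_le dvd_pos_nat)
    then show "divs k (m * n div (a * b)) \<le> divs k (m div a) * divs k (n div b)"
      using ab by (simp add: div_mult_div_if_dvd)
  qed
  also have "\<dots> = (\<Sum>a\<in>?A. divs k (m div a)) * (\<Sum>b\<in>?B. divs k (n div b))"
    by (simp add: sum_product sum.cartesian_product)
  also have "\<dots> = divs (Suc k) m * divs (Suc k) n" using Suc by (simp add: divs_Suc)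
  finally show ?case .
qed

lemma divs_prod_list_le:
  assumes "xs \<in> tuples j R" "\<And>r. r \<in> R \<Longrightarrow> r > 0"
  shows "divs k (prod_list xs) \<le> prod_list (map (divs k) xs)"
  using assms(1)
proof (induction j arbitrary: xs)
  case 0
  have "{xs::nat list. length xs = k \<and> prod_list xs = 1} = {replicate k 1}"
  proof (intro set_eqI iffI)
    fix xs :: "nat list" assume xs: "xs \<in> {xs. length xs = k \<and> prod_list xs = 1}"
    then have "y = 1" if "y \<in> set xs" for y using prod_list_dvd[OF that] by simp
    then show "xs \<in> {replicate k 1}" using xs by (auto intro: replicate_eqI)
  qed auto
  then show ?case using 0 by (auto simp: divs_def)
next
  case (Suc j)
  then obtain y ys where xs: "xs = y # ys" "y \<in> R" "ys \<in> tuples j R"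
    by (auto simp: tuples_def length_Suc_conv)
  then have "prod_list ys > 0" using assms(2) prod_list_pos by blast
  then have "divs k (prod_list xs) \<le> divs k y * divs k (prod_list ys)"
    using xs assms(2) by (auto intro!: divs_submult)
  also have "\<dots> \<le> divs k y * prod_list (map (divs k) ys)" using xs by (intro mult_left_mono Suc.IH) auto
  finally show ?case using xs by simp
qed

text \<open>The sum is regrouped along the fibres of \<open>\<rho>\<close>, whose sizes become
  weights. \<open>g\<close> must stay arbitrary in the induction because it absorbs the first
  entry.\<close>

lemma sum_tuples_map:
  fixes g :: "nat list \<Rightarrow> real"
  assumes "finite A"
  shows "(\<Sum>xs\<in>tuples k A. g (map \<rho> xs)) =
    (\<Sum>rs\<in>tuples k (\<rho> ` A). prod_list (map (\<lambda>r. real (card {a\<in>A. \<rho> a = r})) rs) * g rs)"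
proof (induction k arbitrary: g)
  case 0
  then show ?case by simp
next
  case (Suc k)
  let ?N = "\<lambda>r. real (card {a\<in>A. \<rho> a = r})"
  define h where "h = (\<lambda>r. \<Sum>rs\<in>tuples k (\<rho> ` A). prod_list (map ?N rs) * g (r # rs))"
  have "(\<Sum>xs\<in>tuples (Suc k) A. g (map \<rho> xs)) = (\<Sum>x\<in>A. \<Sum>xs\<in>tuples k A. g (\<rho> x # map \<rho> xs))"
    by (simp add: sum_tuples_Suc assms)
  also have "\<dots> = (\<Sum>x\<in>A. h (\<rho> x))"
    unfolding h_def by (intro sum.cong refl Suc.IH)
  also have "\<dots> = (\<Sum>r\<in>\<rho> ` A. \<Sum>x\<in>{a\<in>A. \<rho> a = r}. h (\<rho> x))"
    by (rule sum.image_gen[OF assms])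
  also have "\<dots> = (\<Sum>r\<in>\<rho> ` A. ?N r * h r)"
    by (intro sum.cong refl) simp
  also have "\<dots> = (\<Sum>rs\<in>tuples (Suc k) (\<rho> ` A). prod_list (map ?N rs) * g rs)"
    using assms by (simp add: sum_tuples_Suc h_def sum_distrib_left mult_ac)
  finally show ?case .
qed

lemma prod_list_map_power2: "prod_list (map f xs) ^ 2 = prod_list (map (\<lambda>x. (f x)\<^sup>2) xs)"
  for f :: "'b \<Rightarrow> real"
  by (induction xs) (auto simp: power_mult_distrib)

lemma prod_list_map_mult:
  "prod_list (map (\<lambda>x. f x * g x) xs) = prod_list (map f xs) * prod_list (map g xs)"
  for f g :: "'b \<Rightarrow> real"
  by (induction xs) (auto simp: mult_ac)

lemma prod_list_map_of_nat: "real (prod_list (map f xs)) = prod_list (map (\<lambda>x. real (f x)) xs)"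
  by (induction xs) auto

text \<open>After the Cauchy--Schwarz step in the form \<open>2 * G * H \<le> G\<^sup>2 + H\<^sup>2\<close>, the number of tuples with
  a prescribed product is controlled by the submultiplicative function \<open>divs k\<close>.\<close>
lemma count_le:
  fixes A :: "nat set" and \<rho> :: "nat \<Rightarrow> nat"
  assumes "finite A" "\<And>a. a \<in> A \<Longrightarrow> \<rho> a > 0"
    and mult: "\<And>xs. xs \<in> tuples k A \<Longrightarrow> \<rho> (prod_list xs) = prod_list (map \<rho> xs)"
  shows "(\<Sum>xs\<in>tuples k A. \<Sum>ys\<in>tuples k A. if prod_list xs = prod_list ys then 1 else 0) \<le>
    (\<Sum>r\<in>\<rho> ` A. real (card {a\<in>A. \<rho> a = r}) ^ 2 * real (divs k r)) ^ k"
proof -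
  define R where "R = \<rho> ` A"
  have R: "finite R" "\<And>r. r \<in> R \<Longrightarrow> r > 0" using assms by (auto simp: R_def)
  define N where "N = (\<lambda>r. real (card {a\<in>A. \<rho> a = r}))"
  define G where "G = (\<lambda>rs. prod_list (map N rs))"
  define E where "E = (\<lambda>rs qs :: nat list. if prod_list rs = prod_list qs then 1 else 0 :: real)"
  have finT: "finite (tuples k R)" using R by auto
  have "(\<Sum>xs\<in>tuples k A. \<Sum>ys\<in>tuples k A. if prod_list xs = prod_list ys then 1 else 0) \<le>
      (\<Sum>xs\<in>tuples k A. \<Sum>ys\<in>tuples k A. E (map \<rho> xs) (map \<rho> ys))"
  proof (intro sum_mono)
    fix xs ys assume xy: "xs \<in> tuples k A" "ys \<in> tuples k A"
    show "(if prod_list xs = prod_list ys then 1 else 0) \<le> E (map \<rho> xs) (map \<rho> ys)"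
    proof (cases "prod_list xs = prod_list ys")
      case True
      then have "prod_list (map \<rho> xs) = prod_list (map \<rho> ys)"
        using mult[OF xy(1)] mult[OF xy(2)] by (simp only: True)
      then show ?thesis by (simp add: E_def)
    qed (simp add: E_def)
  qed
  also have "\<dots> = (\<Sum>xs\<in>tuples k A. \<Sum>qs\<in>tuples k R. G qs * E (map \<rho> xs) qs)"
    unfolding R_def G_def N_def by (intro sum.cong refl sum_tuples_map assms(1))
  also have "\<dots> = (\<Sum>rs\<in>tuples k R. G rs * (\<Sum>qs\<in>tuples k R. G qs * E rs qs))"
    unfolding R_def G_def N_def by (rule sum_tuples_map[OF assms(1)])
  also have "\<dots> = (\<Sum>rs\<in>tuples k R. \<Sum>qs\<in>tuples k R. G rs * G qs * E rs qs)"
    by (simp add: sum_distrib_left mult_ac)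
  also have "\<dots> \<le> (\<Sum>rs\<in>tuples k R. \<Sum>qs\<in>tuples k R. (G rs ^ 2 + G qs ^ 2) / 2 * E rs qs)"
  proof (intro sum_mono mult_right_mono)
    fix rs qs
    show "G rs * G qs \<le> (G rs ^ 2 + G qs ^ 2) / 2"
      using sum_squares_bound[of "G rs" "G qs"] by simp
  qed (auto simp: E_def)
  also have "\<dots> = (\<Sum>rs\<in>tuples k R. \<Sum>qs\<in>tuples k R. G rs ^ 2 / 2 * E rs qs) +
      (\<Sum>rs\<in>tuples k R. \<Sum>qs\<in>tuples k R. G qs ^ 2 / 2 * E rs qs)"
    by (simp add: sum.distrib add_divide_distrib distrib_right)
  also have "(\<Sum>rs\<in>tuples k R. \<Sum>qs\<in>tuples k R. G qs ^ 2 / 2 * E rs qs) =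
      (\<Sum>rs\<in>tuples k R. \<Sum>qs\<in>tuples k R. G rs ^ 2 / 2 * E rs qs)"
    by (subst sum.swap) (simp add: E_def eq_commute)
  also have "(\<Sum>rs\<in>tuples k R. \<Sum>qs\<in>tuples k R. G rs ^ 2 / 2 * E rs qs) +
      (\<Sum>rs\<in>tuples k R. \<Sum>qs\<in>tuples k R. G rs ^ 2 / 2 * E rs qs) =
      (\<Sum>rs\<in>tuples k R. G rs ^ 2 * (\<Sum>qs\<in>tuples k R. E rs qs))"
    unfolding sum.distrib[symmetric] sum_distrib_left by (intro sum.cong refl) simp
  also have "\<dots> \<le> (\<Sum>rs\<in>tuples k R. G rs ^ 2 * prod_list (map (\<lambda>r. real (divs k r)) rs))"
  proof (intro sum_mono mult_left_mono)
    fix rs assume rs: "rs \<in> tuples k R"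
    then have pos: "prod_list rs > 0" using R(2) by (rule prod_list_pos)
    have "(\<Sum>qs\<in>tuples k R. E rs qs) = real (card {qs\<in>tuples k R. prod_list qs = prod_list rs})"
      unfolding E_def using finT by (simp add: sum.If_cases Int_def eq_commute)
    also have "card {qs\<in>tuples k R. prod_list qs = prod_list rs} \<le> divs k (prod_list rs)"
      unfolding divs_def using finite_divs_set[OF pos] by (intro card_mono) (auto simp: tuples_def)
    also have "divs k (prod_list rs) \<le> prod_list (map (divs k) rs)"
      using rs R(2) by (rule divs_prod_list_le)
    finally show "(\<Sum>qs\<in>tuples k R. E rs qs) \<le> prod_list (map (\<lambda>r. real (divs k r)) rs)"
      by (simp add: prod_list_map_of_nat)
  qed auto
  also have "\<dots> = (\<Sum>r\<in>R. N r ^ 2 * real (divs k r)) ^ k"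
    by (simp add: sum_power_tuples[OF R(1)] prod_list_map_mult G_def prod_list_map_power2)
  finally show ?thesis by (simp add: R_def N_def)
qed

section \<open>Euler products for completely multiplicative weights\<close>

locale completely_multiplicative =
  fixes f :: "nat \<Rightarrow> real"
  assumes f_nonneg: "f n \<ge> 0"
    and f_1: "f 1 = 1"
    and f_mult: "m > 0 \<Longrightarrow> n > 0 \<Longrightarrow> f (m * n) = f m * f n"
begin

lemma f_power: "n > 0 \<Longrightarrow> f (n ^ a) = f n ^ a"
  using f_1 by (induction a) (auto simp: f_mult)

lemma f_prod_list: "(\<And>x. x \<in> set xs \<Longrightarrow> x > 0) \<Longrightarrow> f (prod_list xs) = prod_list (map f xs)"
proof (induction xs)
  case (Cons x xs)
  have "prod_list xs > 0" using Cons.prems by (intro prod_list_pos[of xs "length xs" "set xs"]) (auto simp: tuples_def)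
  then show ?case using Cons by (simp add: f_mult)
qed (use f_1 in simp)

text \<open>The primes are removed one at a time: \<open>n\<close> is determined by its exponent at
  \<open>p\<close> and its cofactor, so the sum is dominated by a geometric series times the sum for
  the remaining primes.\<close>

lemma sum_le_prod:
  assumes "finite P" "\<And>p. p \<in> P \<Longrightarrow> prime p \<and> f p < 1"
    and "finite A" "\<And>n. n \<in> A \<Longrightarrow> n > 0 \<and> prime_factors n \<subseteq> P"
  shows "(\<Sum>n\<in>A. f n) \<le> (\<Prod>p\<in>P. 1 / (1 - f p))"
  using assms
proof (induction P arbitrary: A rule: finite_induct)
  case empty
  have "n = 1" if n: "n \<in> A" for n
  proof (rule ccontr)
    assume "n \<noteq> 1"
    then obtain p where "prime p" "p dvd n" using prime_factor_nat by blast
    moreover have "n > 0" "prime_factors n = {}" using empty.prems(3)[OF n] by auto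
    ultimately have "p \<in> prime_factors n" by (simp add: prime_factors_dvd)
    then show False using \<open>prime_factors n = {}\<close> by blast
  qed
  then have "A \<subseteq> {1}" by auto
  then have "(\<Sum>n\<in>A. f n) \<le> (\<Sum>n\<in>{1}. f n)" by (intro sum_mono2) (auto simp: f_nonneg)
  then show ?case using f_1 by simp
next
  case (insert p P)
  have p: "prime p" "f p < 1" using insert.prems by auto
  define g where "g = (\<lambda>n. (multiplicity p n, n div p ^ multiplicity p n))"
  have gn: "p ^ fst (g n) * snd (g n) = n" for n
    by (simp add: g_def multiplicity_dvd)
  have inj: "inj_on g A" by (rule inj_onI) (metis gn)
  define B where "B = snd ` g ` A"
  define K where "K = fst ` g ` A"
  have fin: "finite B" "finite K" using insert.prems by (auto simp: B_def K_def)
  have B: "b > 0 \<and> prime_factors b \<subseteq> P" if "b \<in> B" for b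
  proof -
    from that obtain n where n: "n \<in> A" "b = n div p ^ multiplicity p n" by (auto simp: B_def g_def)
    have n0: "n > 0" "prime_factors n \<subseteq> insert p P" using insert.prems(3)[OF n(1)] by auto
    have eq: "n = p ^ multiplicity p n * b" using gn[of n] n by (simp add: g_def)
    then have b0: "b > 0" using n0 by (metis gr0I mult_0_right)
    have "\<not> p dvd b" 
      using multiplicity_decompose[of n p] n0 p n(2) prime_gt_1_nat[OF p(1)] by auto
    moreover have "prime_factors b \<subseteq> prime_factors n"
      using eq n0 by (intro dvd_prime_factors) (auto intro: dvdI[of n b "p ^ multiplicity p n"] simp: mult.commute)
    ultimately show ?thesis using b0 n0 by (auto simp: prime_factors_dvd)
  qed
  obtain m where m: "K \<subseteq> {..<m}" using finite_nat_iff_bounded fin(2) by blast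
  have "(\<Sum>n\<in>A. f n) = (\<Sum>n\<in>A. f p ^ fst (g n) * f (snd (g n)))"
  proof (intro sum.cong refl)
    fix n assume n: "n \<in> A"
    then have "snd (g n) > 0" using B by (auto simp: B_def)
    then have "f (p ^ fst (g n) * snd (g n)) = f p ^ fst (g n) * f (snd (g n))"
      using prime_gt_0_nat[OF p(1)] by (simp add: f_mult f_power)
    then show "f n = f p ^ fst (g n) * f (snd (g n))" by (simp only: gn)
  qed
  also have "\<dots> = (\<Sum>(a, b)\<in>g ` A. f p ^ a * f b)"
    by (simp add: sum.reindex[OF inj] case_prod_unfold)
  also have "\<dots> \<le> (\<Sum>(a, b)\<in>{..<m} \<times> B. f p ^ a * f b)"
  proof (intro sum_mono2)
    have "g ` A \<subseteq> K \<times> B" unfolding K_def B_def by (metis subset_fst_snd)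
    also have "\<dots> \<subseteq> {..<m} \<times> B" using m by auto
    finally show "g ` A \<subseteq> {..<m} \<times> B" .
  qed (use fin in \<open>auto simp: f_nonneg\<close>)
  also have "\<dots> = (\<Sum>a<m. f p ^ a) * (\<Sum>b\<in>B. f b)"
    by (simp add: sum_product sum.cartesian_product)
  also have "\<dots> \<le> (1 / (1 - f p)) * (\<Prod>p\<in>P. 1 / (1 - f p))"
  proof (intro mult_mono)
    have "(\<Sum>a<m. f p ^ a) = (1 - f p ^ m) / (1 - f p)" using p by (simp add: sum_gp_strict)
    also have "\<dots> \<le> 1 / (1 - f p)" using p f_nonneg[of p] by (intro divide_right_mono) auto
    finally show "(\<Sum>a<m. f p ^ a) \<le> 1 / (1 - f p)" .
    show "(\<Sum>b\<in>B. f b) \<le> (\<Prod>p\<in>P. 1 / (1 - f p))"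
      using insert.prems B fin by (intro insert.IH) auto
  qed (use p in \<open>auto intro!: sum_nonneg simp: f_nonneg\<close>)
  also have "\<dots> = (\<Prod>p\<in>insert p P. 1 / (1 - f p))" using insert by simp
  finally show ?case .
qed

text \<open>For \<open>v >= 0\<close> the inequality \<open>(1 - v) * (1 + 4 * v) >= 1\<close> holds
  exactly up to \<open>v = 3/4\<close>. This threshold lies above \<open>2 powr (-1/2)\<close>, so
  Rankin's method with exponent at least 1/2 may include the prime 2.\<close>

lemma sum_le_exp:
  assumes "finite P" "\<And>p. p \<in> P \<Longrightarrow> prime p \<and> f p \<le> 3/4"
    and "finite A" "\<And>n. n \<in> A \<Longrightarrow> n > 0 \<and> prime_factors n \<subseteq> P"
  shows "(\<Sum>n\<in>A. f n) \<le> exp (4 * (\<Sum>p\<in>P. f p))"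
proof -
  have "(\<Sum>n\<in>A. f n) \<le> (\<Prod>p\<in>P. 1 / (1 - f p))"
  proof (rule sum_le_prod)
    fix p assume "p \<in> P"
    then show "prime p \<and> f p < 1" using assms(2)[of p] by auto
  qed (use assms in auto)
  also have "\<dots> \<le> (\<Prod>p\<in>P. exp (4 * f p))"
  proof (intro prod_mono conjI)
    fix p assume p: "p \<in> P"
    define v where "v = f p"
    have v: "0 \<le> v" "v \<le> 3/4" using assms(2)[OF p] f_nonneg by (auto simp: v_def)
    have "1 \<le> (1 - v) * (1 + 4 * v)"
      using mult_nonneg_nonneg[of v "3 - 4 * v"] v by (simp add: algebra_simps)
    also have "\<dots> \<le> (1 - v) * exp (4 * v)" using v by (intro mult_left_mono exp_ge_add_one_self) auto
    finally show "1 / (1 - f p) \<le> exp (4 * f p)" using v by (simp add: v_def field_simps)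
    show "0 \<le> 1 / (1 - f p)" using v by (simp add: v_def)
  qed
  also have "\<dots> = exp (4 * (\<Sum>p\<in>P. f p))" using assms(1) by (simp add: exp_sum sum_distrib_left)
  finally show ?thesis .
qed

text \<open>Since \<open>R\<close> is closed under divisors, all factorisations of its members
  appear when the \<open>k\<close>-th power is expanded over \<open>tuples k R\<close>.\<close>

lemma sum_divs_le:
  assumes "finite R" "\<And>r d. r \<in> R \<Longrightarrow> d dvd r \<Longrightarrow> d \<in> R" "\<And>r. r \<in> R \<Longrightarrow> r > 0"
  shows "(\<Sum>r\<in>R. real (divs k r) * f r) \<le> (\<Sum>r\<in>R. f r) ^ k"
proof -
  let ?T = "tuples k R"
  have eq: "{xs. length xs = k \<and> prod_list xs = r} = {xs\<in>?T. prod_list xs = r}" if "r \<in> R" for r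
    using assms(2)[OF that] by (auto simp: tuples_def prod_list_dvd)
  have "(\<Sum>r\<in>R. real (divs k r) * f r) = (\<Sum>r\<in>R. \<Sum>xs\<in>{xs\<in>?T. prod_list xs = r}. f (prod_list xs))"
    by (intro sum.cong refl) (simp add: divs_def eq)
  also have "\<dots> = (\<Sum>xs\<in>{xs\<in>?T. prod_list xs \<in> R}. f (prod_list xs))"
  proof -
    have "(\<Sum>xs\<in>{xs\<in>?T. prod_list xs \<in> R}. f (prod_list xs)) =
        (\<Sum>r\<in>R. \<Sum>xs\<in>{xs\<in>{xs\<in>?T. prod_list xs \<in> R}. prod_list xs = r}. f (prod_list xs))"
      using assms(1) by (intro sum.group[symmetric]) (auto intro: finite_subset[OF _ finite_tuples[OF assms(1)]])
    also have "\<dots> = (\<Sum>r\<in>R. \<Sum>xs\<in>{xs\<in>?T. prod_list xs = r}. f (prod_list xs))"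
      by (intro sum.cong refl) auto
    finally show ?thesis ..
  qed
  also have "\<dots> \<le> (\<Sum>xs\<in>?T. f (prod_list xs))"
    using assms(1) by (intro sum_mono2) (auto simp: f_nonneg)
  also have "\<dots> = (\<Sum>xs\<in>?T. prod_list (map f xs))"
    using assms(3) by (intro sum.cong refl f_prod_list) (auto simp: tuples_def)
  also have "\<dots> = (\<Sum>r\<in>R. f r) ^ k" by (rule sum_power_tuples[OF assms(1), symmetric])
  finally show ?thesis .
qed

end

section \<open>Rough parts and the reduction of the moment to a sum over primes\<close>

definition rough_part :: "real \<Rightarrow> nat \<Rightarrow> nat" where
  "rough_part w n = prod_mset (filter_mset (\<lambda>p. real p > w) (prime_factorization n))"

definition smooth_part :: "real \<Rightarrow> nat \<Rightarrow> nat" where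
  "smooth_part w n = prod_mset (filter_mset (\<lambda>p. \<not> real p > w) (prime_factorization n))"

lemma rough_times_smooth: "n > 0 \<Longrightarrow> rough_part w n * smooth_part w n = n"
  unfolding rough_part_def smooth_part_def
  by (simp flip: prod_mset_Un multiset_partition add: prod_mset_prime_factorization_nat)

lemma prime_factorization_rough: 
  "prime_factorization (rough_part w n) = filter_mset (\<lambda>p. real p > w) (prime_factorization n)"
  unfolding rough_part_def by (rule prime_factorization_prod_mset_primes) auto

lemma prime_factorization_smooth_part: 
  "prime_factorization (smooth_part w n) = filter_mset (\<lambda>p. \<not> real p > w) (prime_factorization n)"
  unfolding smooth_part_def by (rule prime_factorization_prod_mset_primes) auto

lemma rough_part_pos: "n > 0 \<Longrightarrow> rough_part w n > 0"
  using rough_times_smooth[of n w] by (metis gr0I mult_0)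

lemma smooth_part_pos: "n > 0 \<Longrightarrow> smooth_part w n > 0"
  using rough_times_smooth[of n w] by (metis gr0I mult_0_right)

lemma rough_part_mult: "m > 0 \<Longrightarrow> n > 0 \<Longrightarrow> rough_part w (m * n) = rough_part w m * rough_part w n"
  by (simp add: rough_part_def prime_factorization_mult)

lemma rough_part_prod_list:
  "(\<And>a. a \<in> A \<Longrightarrow> a > 0) \<Longrightarrow> xs \<in> tuples k A \<Longrightarrow> rough_part w (prod_list xs) = prod_list (map (rough_part w) xs)"
proof (induction k arbitrary: xs)
  case 0
  then show ?case by (simp add: rough_part_def)
next
  case (Suc k)
  then obtain y ys where xs: "xs = y # ys" "y \<in> A" "ys \<in> tuples k A"
    by (auto simp: tuples_def length_Suc_conv)
  then have "prod_list ys > 0" using Suc.prems(1) prod_list_pos by blast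
  then show ?case using xs Suc by (simp add: rough_part_mult)
qed

definition rough_upto :: "real \<Rightarrow> real \<Rightarrow> nat set" where
  "rough_upto x w = {r. r > 0 \<and> real r \<le> x \<and> (\<forall>p\<in>prime_factors r. real p > w)}"

definition primes_between :: "real \<Rightarrow> real \<Rightarrow> nat set" where
  "primes_between w x = {p. prime p \<and> real p > w \<and> real p \<le> x}"

lemma finite_rough_upto: "finite (rough_upto x w)"
  by (rule finite_subset[OF _ finite_ints_upto[of x]]) (auto simp: rough_upto_def ints_upto_def)

lemma finite_primes_between: "finite (primes_between w x)"
  by (rule finite_subset[OF _ finite_ints_upto[of x]]) (auto simp: primes_between_def ints_upto_def prime_gt_0_nat)

lemma card_rough_part_le:
  assumes "A \<subseteq> ints_upto x"
  shows "card {a\<in>A. rough_part w a = r} \<le> Psi (x / real r) w"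
proof -
  have "smooth_part w ` {a\<in>A. rough_part w a = r} \<subseteq> smooth_upto (x / real r) w"
  proof safe
    fix a assume a: "a \<in> A" and r: "r = rough_part w a"
    have a0: "a > 0" "real a \<le> x" using a assms by (auto simp: ints_upto_def)
    have "real (rough_part w a) * real (smooth_part w a) \<le> x"
      using a0 rough_times_smooth[OF a0(1), of w] by (simp flip: of_nat_mult)
    then have "real (smooth_part w a) \<le> x / real (rough_part w a)"
      using rough_part_pos[OF a0(1), of w] by (simp add: field_simps)
    then show "smooth_part w a \<in> smooth_upto (x / real (rough_part w a)) w"
      using smooth_part_pos[OF a0(1)] by (auto simp: smooth_upto_def prime_factorization_smooth_part)
  qed
  moreover have "inj_on (smooth_part w) {a\<in>A. rough_part w a = r}"
  proof (rule inj_onI)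
    fix a b assume ab: "a \<in> {a\<in>A. rough_part w a = r}" "b \<in> {a\<in>A. rough_part w a = r}"
      and eq: "smooth_part w a = smooth_part w b"
    have "a > 0" "b > 0" using ab assms by (auto simp: ints_upto_def)
    then have "a = rough_part w a * smooth_part w a" "b = rough_part w b * smooth_part w b"
      by (simp_all add: rough_times_smooth)
    moreover have "rough_part w a = rough_part w b" using ab by simp
    ultimately show "a = b" using eq by (simp only:)
  qed
  ultimately show ?thesis unfolding Psi_def by (metis card_image card_mono finite_smooth_upto)
qed

text \<open>Since \<open>w <= y\<close>, an integer that is not \<open>y\<close>-smooth has rough
  part different from 1. Omitting \<open>r = 1\<close> from the Euler product yields the
  \<open>- 1\<close>, so the bound is small when the prime sum is small.\<close>

lemma (in random_completely_multiplicative) moment_le: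
  assumes "w \<le> y" "completely_multiplicative f" "B \<ge> 0"
    and Psi: "\<And>r. r \<in> rough_upto x w \<Longrightarrow> r \<noteq> 1 \<Longrightarrow> real (Psi (x / real r) w) ^ 2 \<le> B * f r"
    and f_le: "\<And>p. p \<in> primes_between w x \<Longrightarrow> f p \<le> 3/4"
  shows "expectation (\<lambda>\<omega>. norm ((\<Sum>n\<in>ints_upto x. X n \<omega>) - Psi0 x y (\<lambda>n. X n \<omega>)) ^ (2 * k)) \<le>
    (B * (exp (4 * real k * (\<Sum>p\<in>primes_between w x. f p)) - 1)) ^ k"
proof -
  interpret f: completely_multiplicative f by fact
  define A where "A = ints_upto x - smooth_upto x y"
  have A: "finite A" "A \<subseteq> ints_upto x" by (auto simp: A_def)
  have A_pos: "\<And>a. a \<in> A \<Longrightarrow> a > 0" by (auto simp: A_def ints_upto_def)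
  let ?\<rho> = "rough_part w"
  let ?R = "rough_upto x w"
  have D: "(\<Sum>n\<in>ints_upto x. X n \<omega>) - Psi0 x y (\<lambda>n. X n \<omega>) = (\<Sum>n\<in>A. X n \<omega>)" for \<omega>
    unfolding A_def Psi0_def by (rule sum_diff[symmetric]) (auto simp: smooth_upto_subset)
  have img: "?\<rho> ` A \<subseteq> ?R - {1}"
  proof safe
    fix a assume a: "a \<in> A"
    then have a0: "a > 0" "real a \<le> x" "a \<notin> smooth_upto x y" by (auto simp: A_def ints_upto_def)
    have "?\<rho> a dvd a" using rough_times_smooth[OF a0(1), of w] by (metis dvd_triv_left)
    then have "real (?\<rho> a) \<le> x" using a0 dvd_imp_le[of "?\<rho> a" a] by linarith
    then show "?\<rho> a \<in> ?R" using rough_part_pos[OF a0(1)] by (auto simp: rough_upto_def prime_factorization_rough)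
    obtain p where "p \<in> prime_factors a" "real p > y" using a0 by (auto simp: smooth_upto_def not_le)
    then have "p \<in> prime_factors (?\<rho> a)" using assms(1) by (simp add: prime_factorization_rough)
    moreover assume "?\<rho> a = 1"
    ultimately show False by simp
  qed
  have "expectation (\<lambda>\<omega>. norm ((\<Sum>n\<in>ints_upto x. X n \<omega>) - Psi0 x y (\<lambda>n. X n \<omega>)) ^ (2 * k)) =
      (\<Sum>xs\<in>tuples k A. \<Sum>ys\<in>tuples k A. if prod_list xs = prod_list ys then 1 else 0)"
    unfolding D by (rule moment_eq_count[OF A(1) A_pos])
  also have "\<dots> \<le> (\<Sum>r\<in>?\<rho> ` A. real (card {a\<in>A. ?\<rho> a = r}) ^ 2 * real (divs k r)) ^ k"
    using A A_pos rough_part_pos by (intro count_le rough_part_prod_list[of A]) auto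
  also have "\<dots> \<le> (B * (exp (4 * real k * (\<Sum>p\<in>primes_between w x. f p)) - 1)) ^ k"
  proof (intro power_mono sum_nonneg)
    have "(\<Sum>r\<in>?\<rho> ` A. real (card {a\<in>A. ?\<rho> a = r}) ^ 2 * real (divs k r)) \<le>
        (\<Sum>r\<in>?\<rho> ` A. (B * f r) * real (divs k r))"
    proof (intro sum_mono mult_right_mono)
      fix r assume "r \<in> ?\<rho> ` A"
      then have "r \<in> ?R" "r \<noteq> 1" using img by auto
      have "real (card {a\<in>A. ?\<rho> a = r}) ^ 2 \<le> real (Psi (x / real r) w) ^ 2"
        using card_rough_part_le[OF A(2), of w r] by (intro power_mono) auto
      also have "\<dots> \<le> B * f r" using Psi \<open>r \<in> ?R\<close> \<open>r \<noteq> 1\<close> by blast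
      finally show "real (card {a\<in>A. ?\<rho> a = r}) ^ 2 \<le> B * f r" .
    qed auto
    also have "\<dots> \<le> (\<Sum>r\<in>?R - {1}. (B * f r) * real (divs k r))"
      using img assms(3) finite_rough_upto by (intro sum_mono2) (auto simp: f.f_nonneg)
    also have "\<dots> = B * (\<Sum>r\<in>?R - {1}. real (divs k r) * f r)"
      by (simp add: sum_distrib_left mult_ac)
    also have "\<dots> \<le> B * (exp (4 * real k * (\<Sum>p\<in>primes_between w x. f p)) - 1)"
    proof (intro mult_left_mono assms(3))
      show "(\<Sum>r\<in>?R - {1}. real (divs k r) * f r) \<le> exp (4 * real k * (\<Sum>p\<in>primes_between w x. f p)) - 1"
      proof (cases "1 \<in> ?R")
        case False
        then have "?R = {}" by (auto simp: rough_upto_def)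
        then show ?thesis by (auto intro!: sum_nonneg mult_nonneg_nonneg simp: f.f_nonneg)
      next
        case True
        have "divs k 1 \<ge> 1"
        proof -
          let ?S = "{xs. length xs = k \<and> prod_list xs = (1::nat)}"
          have "finite ?S" by (rule finite_divs_set) simp
          moreover have "replicate k 1 \<in> ?S" by auto
          then have "?S \<noteq> {}" by blast
          ultimately have "card ?S > 0" unfolding card_gt_0_iff by blast
          then show ?thesis by (simp add: divs_def)
        qed
        then have "1 + (\<Sum>r\<in>?R - {1}. real (divs k r) * f r) \<le> (\<Sum>r\<in>?R. real (divs k r) * f r)"
          using True f.f_1 by (subst sum.remove[OF finite_rough_upto True]) auto
        also have "\<dots> \<le> (\<Sum>r\<in>?R. f r) ^ k"
        proof (intro f.sum_divs_le finite_rough_upto)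
          fix r d assume r: "r \<in> ?R" and d: "d dvd r"
          then have "r > 0" "d \<le> r" by (auto simp: rough_upto_def intro: dvd_imp_le)
          moreover have "d > 0" using d \<open>r > 0\<close> by (rule dvd_pos_nat[rotated])
          moreover have "prime_factors d \<subseteq> prime_factors r" using d \<open>r > 0\<close> by (intro dvd_prime_factors) auto
          ultimately show "d \<in> ?R" using r by (auto simp: rough_upto_def)
        qed (auto simp: rough_upto_def)
        also have "\<dots> \<le> exp (4 * (\<Sum>p\<in>primes_between w x. f p)) ^ k"
        proof (intro power_mono f.sum_le_exp finite_rough_upto finite_primes_between)
          fix r assume r: "r \<in> ?R"
          have "p \<le> r" if "p \<in> prime_factors r" for p
            using r that by (auto simp: rough_upto_def prime_factors_dvd intro: dvd_imp_le)
          then show "r > 0 \<and> prime_factors r \<subseteq> primes_between w x"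
            using r by (force simp: rough_upto_def primes_between_def)
        qed (use f_le in \<open>auto simp: primes_between_def intro!: sum_nonneg f.f_nonneg\<close>)
        also have "\<dots> = exp (4 * real k * (\<Sum>p\<in>primes_between w x. f p))"
          by (simp add: exp_of_nat_mult[symmetric] mult_ac)
        finally show ?thesis by linarith
      qed
    qed
    finally show "(\<Sum>r\<in>?\<rho> ` A. real (card {a\<in>A. ?\<rho> a = r}) ^ 2 * real (divs k r)) \<le>
      B * (exp (4 * real k * (\<Sum>p\<in>primes_between w x. f p)) - 1)" .
  qed auto
  finally show ?thesis .
qed

section \<open>Sums over primes and the Rankin bound\<close>

lemma powr_difference_ge:
  fixes s :: real
  assumes "s > 1" "m > 0"
  shows "real m powr (1 - s) - real (Suc m) powr (1 - s) \<ge> (s - 1) * real (Suc m) powr (-s)"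
proof -
  define n where "n = real (Suc m)"
  have n: "n \<ge> 2" using assms by (simp add: n_def)
  have "n powr (1 - s) * (1 + (s - 1) * (1 / n)) \<le> n powr (1 - s) * (1 - 1 / n) powr (-(s - 1))"
    using n assms by (intro mult_left_mono one_minus_powr_ge) auto
  also have "\<dots> = (n * (1 - 1 / n)) powr (1 - s)" using n by (subst powr_mult) auto
  also have "n * (1 - 1 / n) = real m" using n by (simp add: n_def field_simps)
  finally have *: "n powr (1 - s) + (s - 1) * (n powr (1 - s) / n) \<le> real m powr (1 - s)"
    by (simp add: algebra_simps)
  have "n powr (1 - s) / n = n powr (-s)" using n by (simp add: powr_diff powr_minus field_simps)
  from *[unfolded this] show ?thesis unfolding n_def by linarith
qed

text \<open>Primality is discarded. The first integer beyond \<open>w\<close> accounts for the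
  summand 1, the telescoping tail for \<open>1 / (s - 1)\<close>.\<close>

lemma sum_primes_powr_le:
  assumes "s > 1" "w \<ge> 1"
  shows "(\<Sum>p\<in>primes_between w x. real p powr (-s)) \<le> w powr (1 - s) * (1 + 1 / (s - 1))"
proof -
  define m where "m = Suc (nat \<lfloor>w\<rfloor>)"
  have m: "real m \<ge> w" "m \<ge> 1" unfolding m_def using assms by linarith+
  have tele: "(\<Sum>n\<in>{m<..m + j}. real n powr (-s)) \<le> (real m powr (1 - s) - real (m + j) powr (1 - s)) / (s - 1)" for j
  proof (induction j)
    case (Suc j)
    have "{m<..m + Suc j} = insert (m + Suc j) {m<..m + j}" by auto
    then have "(\<Sum>n\<in>{m<..m + Suc j}. real n powr (-s)) =
        real (m + Suc j) powr (-s) + (\<Sum>n\<in>{m<..m + j}. real n powr (-s))" by simp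
    also have "real (m + Suc j) powr (-s) \<le> (real (m + j) powr (1 - s) - real (m + Suc j) powr (1 - s)) / (s - 1)"
      using powr_difference_ge[of s "m + j"] assms m by (simp add: field_simps)
    finally show ?case using Suc by (simp add: diff_divide_distrib)
  qed simp
  define N where "N = nat \<lfloor>x\<rfloor>"
  have "primes_between w x \<subseteq> insert m {m<..m + N}"
  proof
    fix p assume p: "p \<in> primes_between w x"
    then have "w < real p" "real p \<le> x" by (auto simp: primes_between_def)
    then have "p \<ge> m" "p \<le> N" unfolding m_def N_def using assms by (auto simp: le_nat_floor Suc_le_eq nat_less_iff floor_less_iff)
    then show "p \<in> insert m {m<..m + N}" by auto
  qed
  then have "(\<Sum>p\<in>primes_between w x. real p powr (-s)) \<le> (\<Sum>p\<in>insert m {m<..m + N}. real p powr (-s))"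
    by (intro sum_mono2) auto
  also have "\<dots> = real m powr (-s) + (\<Sum>n\<in>{m<..m + N}. real n powr (-s))" by simp
  also have "(\<Sum>n\<in>{m<..m + N}. real n powr (-s)) \<le> (real m powr (1 - s) - real (m + N) powr (1 - s)) / (s - 1)"
    by (rule tele)
  also have "\<dots> \<le> real m powr (1 - s) / (s - 1)" using assms by (intro divide_right_mono) auto
  also have "real m powr (1 - s) / (s - 1) \<le> w powr (1 - s) / (s - 1)"
    using assms m by (intro divide_right_mono powr_mono2') auto
  also have "real m powr (-s) \<le> w powr (-s)" using assms m by (intro powr_mono2') auto
  also have "w powr (-s) \<le> w powr (1 - s)" using assms by (intro powr_mono) auto
  finally show ?thesis by (simp add: algebra_simps)
qed

lemma sum_powr_le:
  fixes a :: real
  assumes "0 < a" "a \<le> 1"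
  shows "(\<Sum>m\<in>{1..n}. real m powr (a - 1)) \<le> 2 * real n powr a / a"
proof (induction n)
  case (Suc m)
  define n where "n = real (Suc m)"
  have n: "n \<ge> 1" by (simp add: n_def)
  have "a * n powr (a - 1) \<le> 2 * (n powr a - real m powr a)"
  proof (cases "m = 0")
    case True
    then show ?thesis using assms by (simp add: n_def)
  next
    case False
    then have n2: "n \<ge> 2" by (simp add: n_def)
    define v where "v = 1 / n"
    have v: "0 < v" "v < 1" using n2 by (auto simp: v_def)
    have "real m = n * (1 - v)" using n by (simp add: n_def v_def field_simps)
    then have "real m powr a = n powr a * (1 - v) powr a" using n v by (simp add: powr_mult)
    also have "(1 - v) powr a = 1 / (1 - v) powr (-a)" by (simp add: powr_minus field_simps)
    also have "\<dots> \<le> 1 / (1 + a * v)"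
    proof (intro divide_left_mono one_minus_powr_ge mult_pos_pos)
      show "0 < (1 - v) powr (-a)" using v by simp
      show "0 < 1 + a * v" using assms v by (intro add_pos_nonneg) auto
    qed (use assms v in auto)
    also have "1 / (1 + a * v) \<le> 1 - a * v / 2"
    proof -
      define c where "c = a * v"
      have c: "0 \<le> c" "c \<le> 1" using assms v mult_mono[of a 1 v 1] by (auto simp: c_def)
      then have "0 \<le> c * (1 - c)" by (intro mult_nonneg_nonneg) auto
      then have "1 \<le> (1 - c / 2) * (1 + c)" by (simp add: algebra_simps)
      then have "1 / (1 + c) \<le> 1 - c / 2" using c by (simp add: divide_le_eq)
      then show ?thesis by (simp add: c_def)
    qed
    finally have *: "real m powr a \<le> n powr a * (1 - a * v / 2)" by (simp add: mult_left_mono)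
    have "n powr a * v = n powr (a - 1)" using n by (simp add: v_def powr_diff)
    then have "n powr a * (1 - a * v / 2) = n powr a - a * n powr (a - 1) / 2"
      by (simp add: algebra_simps)
    from *[unfolded this] show ?thesis by (simp add: field_simps)
  qed
  then have "n powr (a - 1) \<le> 2 * n powr a / a - 2 * real m powr a / a"
    using assms by (simp add: field_simps)
  then show ?case using Suc by (simp add: n_def)
qed (use assms in simp)

lemma completely_multiplicative_powr: "completely_multiplicative (\<lambda>n. real n powr s)"
  by unfold_locales (auto simp: powr_mult)

text \<open>Primes beyond \<open>sqrt w\<close> satisfy
  \<open>1 <= 2 * vonMangoldt p / ln w\<close>, which gains the factor \<open>1 / ln w\<close> in
  the main term; smaller primes are bounded by all integers up to \<open>sqrt w\<close>. The gain is
  essential: the loss in Rankin's method must be exponential in \<open>ln x / ln y\<close> rather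
  than in \<open>ln x\<close>.\<close>

lemma primes_upto_powr_le:
  assumes "w > 1" "0 < a" "a \<le> 1"
  shows "(\<Sum>p\<in>primes_between 0 w. real p powr (a - 1)) \<le> (2 * w powr (a / 2) + 12 * w powr a / ln w) / a"
proof -
  define P where "P = primes_between 0 w"
  define n m where "n = nat \<lfloor>w\<rfloor>" and "m = nat \<lfloor>sqrt w\<rfloor>"
  have finP: "finite P" by (simp add: P_def finite_primes_between)
  have nm: "real n \<le> w" "real m \<le> sqrt w" using assms by (auto simp: n_def m_def)
  have lw: "ln w > 0" using assms by simp
  have Pn: "P \<subseteq> {1..n}"
    by (auto simp: P_def primes_between_def n_def le_nat_floor prime_ge_Suc_0_nat)
  have "(\<Sum>p\<in>P. real p powr (a - 1)) \<le>
      (\<Sum>p\<in>P. (if p \<le> m then real p powr (a - 1) else 0) + 2 / ln w * (vonMangoldt p * real p powr (a - 1)))"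
  proof (intro sum_mono)
    fix p assume p: "p \<in> P"
    then have pr: "prime p" by (auto simp: P_def primes_between_def)
    then have p1: "p \<ge> 1" by (rule prime_ge_1_nat)
    show "real p powr (a - 1) \<le>
        (if p \<le> m then real p powr (a - 1) else 0) + 2 / ln w * (vonMangoldt p * real p powr (a - 1))"
    proof (cases "p \<le> m")
      case True
      then show ?thesis using lw by (simp add: mangoldt_nonneg)
    next
      case False
      then have "real p > sqrt w" unfolding m_def using assms by (simp add: not_le nat_less_iff floor_less_iff)
      then have "sqrt w ^ 2 < real p ^ 2" using assms by (intro power_strict_mono) auto
      then have "w < real p ^ 2" using assms by simp
      then have "ln w \<le> ln (real p ^ 2)" using assms p1 by (subst ln_le_cancel_iff) auto
      then have "1 \<le> 2 / ln w * vonMangoldt p" using lw pr p1 by (simp add: ln_realpow field_simps)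
      then have "1 * real p powr (a - 1) \<le> 2 / ln w * vonMangoldt p * real p powr (a - 1)"
        by (intro mult_right_mono) auto
      then show ?thesis using False by (simp add: mult_ac)
    qed
  qed
  also have "\<dots> = (\<Sum>p\<in>{p\<in>P. p \<le> m}. real p powr (a - 1)) + 2 / ln w * (\<Sum>p\<in>P. vonMangoldt p * real p powr (a - 1))"
    by (simp add: sum.distrib sum_distrib_left sum.If_cases[OF finP] Int_def)
  also have "\<dots> \<le> 2 * real m powr a / a + 2 / ln w * (3 * (2 * real n powr a / a))"
  proof (intro add_mono mult_left_mono)
    have "(\<Sum>p\<in>{p\<in>P. p \<le> m}. real p powr (a - 1)) \<le> (\<Sum>p\<in>{1..m}. real p powr (a - 1))"
      using Pn by (intro sum_mono2) auto
    also have "\<dots> \<le> 2 * real m powr a / a" by (rule sum_powr_le[OF assms(2,3)])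
    finally show "(\<Sum>p\<in>{p\<in>P. p \<le> m}. real p powr (a - 1)) \<le> 2 * real m powr a / a" .
    have "(\<Sum>p\<in>P. vonMangoldt p * real p powr (a - 1)) \<le> (\<Sum>p\<in>{1..n}. vonMangoldt p * real p powr (a - 1))"
      using Pn by (intro sum_mono2) (auto simp: mangoldt_nonneg)
    also have "\<dots> \<le> 3 * (\<Sum>m\<in>{1..n}. real m powr (a - 1))"
      using assms by (intro sum_mangoldt_antimono powr_mono2') auto
    also have "\<dots> \<le> 3 * (2 * real n powr a / a)"
      by (intro mult_left_mono sum_powr_le[OF assms(2,3)]) simp
    finally show "(\<Sum>p\<in>P. vonMangoldt p * real p powr (a - 1)) \<le> 3 * (2 * real n powr a / a)" .
  qed (use lw in simp)
  also have "\<dots> \<le> 2 * w powr (a / 2) / a + 2 / ln w * (3 * (2 * w powr a / a))"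
  proof (intro add_mono mult_left_mono divide_right_mono powr_mono2 nm)
    have "real m powr a \<le> sqrt w powr a" using nm assms by (intro powr_mono2) auto
    also have "\<dots> = w powr (a / 2)" using assms by (simp add: powr_half_sqrt[symmetric] powr_powr)
    finally show "real m powr a \<le> w powr (a / 2)" .
  qed (use assms lw in auto)
  also have "\<dots> = (2 * w powr (a / 2) + 12 * w powr a / ln w) / a"
    using assms lw by (simp add: field_simps)
  finally show ?thesis by (simp add: P_def)
qed

lemma Rankin_bound:
  assumes "X > 0" "1/2 \<le> \<sigma>"
  shows "real (Psi X w) \<le> X powr \<sigma> * exp (4 * (\<Sum>p\<in>primes_between 0 w. real p powr (-\<sigma>)))"
proof -
  interpret completely_multiplicative "\<lambda>n. real n powr (-\<sigma>)"
    by (rule completely_multiplicative_powr)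
  have "real (Psi X w) = (\<Sum>n\<in>smooth_upto X w. 1)" by (simp add: Psi_def)
  also have "\<dots> \<le> (\<Sum>n\<in>smooth_upto X w. X powr \<sigma> * real n powr (-\<sigma>))"
  proof (intro sum_mono)
    fix n assume "n \<in> smooth_upto X w"
    then have n: "n > 0" "real n \<le> X" by (auto simp: smooth_upto_def)
    have "1 \<le> (X / real n) powr \<sigma>" using n assms by (intro ge_one_powr_ge_zero) auto
    also have "\<dots> = X powr \<sigma> * real n powr (-\<sigma>)"
      using n assms by (simp add: powr_divide powr_minus field_simps)
    finally show "1 \<le> X powr \<sigma> * real n powr (-\<sigma>)" .
  qed
  also have "\<dots> = X powr \<sigma> * (\<Sum>n\<in>smooth_upto X w. real n powr (-\<sigma>))" by (simp add: sum_distrib_left)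
  also have "\<dots> \<le> X powr \<sigma> * exp (4 * (\<Sum>p\<in>primes_between 0 w. real p powr (-\<sigma>)))"
  proof (intro mult_left_mono sum_le_exp finite_primes_between finite_smooth_upto)
    fix p assume "p \<in> primes_between 0 w"
    then have p: "prime p" "p \<ge> 2" by (auto simp: primes_between_def prime_ge_2_nat)
    have "real p powr (-\<sigma>) \<le> 2 powr (-\<sigma>)" using p assms by (intro powr_mono2') auto
    also have "\<dots> \<le> 2 powr (-(1/2))" using assms by (intro powr_mono) auto
    also have "\<dots> \<le> 3/4"
    proof -
      have "4/3 \<le> sqrt 2" by (rule real_le_rsqrt) (simp add: power2_eq_square)
      then show ?thesis by (simp add: powr_minus powr_half_sqrt field_simps)
    qed
    finally show "prime p \<and> real p powr (-\<sigma>) \<le> 3/4" using p by blast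
  next
    fix n assume n: "n \<in> smooth_upto X w"
    then show "n > 0 \<and> prime_factors n \<subseteq> primes_between 0 w"
      by (auto simp: smooth_upto_def primes_between_def intro: prime_gt_0_nat)
  qed auto
  finally show ?thesis .
qed

lemma Psi_divide_power_le:
  assumes "y \<ge> 2" "x \<ge> 1" "0 < X" "X \<le> x"
  shows "real (Psi (X / y ^ j) y) \<le> (8 * ln x / y) ^ j * real (Psi X y)"
proof (induction j)
  case (Suc j)
  have "1 \<le> y ^ j" using assms by simp
  then have le: "X / y ^ j \<le> x" using assms divide_left_mono[of 1 "y ^ j" X] by simp
  show ?case
  proof (cases "X / y ^ j \<ge> 1")
    case True
    have "real (Psi (X / y ^ j / y) y) \<le> 8 * ln (X / y ^ j) / y * real (Psi (X / y ^ j) y)"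
      using True assms by (intro Psi_divide_le) auto
    also have "\<dots> \<le> 8 * ln x / y * real (Psi (X / y ^ j) y)"
    proof (intro mult_right_mono divide_right_mono mult_left_mono)
      show "ln (X / y ^ j) \<le> ln x" using True le by (subst ln_le_cancel_iff) auto
    qed (use assms in auto)
    also have "\<dots> \<le> 8 * ln x / y * ((8 * ln x / y) ^ j * real (Psi X y))"
      using assms by (intro mult_left_mono Suc.IH) auto
    finally show ?thesis by (simp add: mult_ac)
  next
    case False
    have "X / y ^ j / y \<le> X / y ^ j / 1" using assms by (intro divide_left_mono) auto
    then have "Psi (X / y ^ j / y) y = 0" using False by (intro Psi_eq_0) linarith
    then show ?thesis using assms by (simp add: mult_ac)
  qed
qed simp

text \<open>Descend from \<open>x\<close> by factors \<open>y\<close> until the argument is about to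
  drop below 1; each step costs at most \<open>8 * ln x / y\<close>. Rounding the number of steps
  down costs at most a factor \<open>y\<close>, whence \<open>- ln y\<close>.\<close>

lemma Psi_lower_bound:
  assumes "x \<ge> exp 1" "y \<ge> 2" "8 * ln x \<le> y"
  shows "exp (ln x - ln x / ln y * ln (8 * ln x) - ln y) \<le> real (Psi x y)"
proof -
  define t L u where "t = ln x" and "L = ln y" and "u = t / L"
  have x0: "x > 0" "x \<ge> 1" using assms(1) less_le_trans[OF exp_gt_zero] exp_ge_add_one_self[of "1::real"] by force+
  have t1: "t \<ge> 1" unfolding t_def using assms(1) x0 by (subst ln_ge_iff) auto
  have L0: "L > 0" using assms by (simp add: L_def)
  define j where "j = nat \<lfloor>u\<rfloor>"
  have u0: "u \<ge> 0" using t1 L0 by (simp add: u_def)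
  have j: "real j \<le> u" "u - 1 \<le> real j" using u0 by (auto simp: j_def)
  have "y ^ j \<le> x"
  proof -
    have "ln (y ^ j) = real j * L" using assms by (simp add: ln_realpow L_def)
    also have "\<dots> \<le> u * L" using j L0 by (intro mult_right_mono) auto
    also have "\<dots> = ln x" using L0 by (simp add: u_def t_def)
    finally show ?thesis using assms x0 by (subst (asm) ln_le_cancel_iff) auto
  qed
  then have "1 \<le> real (Psi (x / y ^ j) y)" using Psi_ge_1[of "x / y ^ j" y] assms by simp
  also have "\<dots> \<le> (8 * t / y) ^ j * real (Psi x y)"
    unfolding t_def using assms x0 by (intro Psi_divide_power_le) auto
  finally have *: "1 \<le> (8 * t / y) ^ j * real (Psi x y)" .
  define l where "l = ln (8 * t)"
  have l: "0 \<le> l" "l \<le> L" using t1 assms by (auto simp: l_def L_def t_def)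
  have "8 * t / y = exp (l - L)" using t1 assms by (simp add: l_def L_def exp_diff)
  then have "(8 * t / y) ^ j = exp (real j * (l - L))" by (simp add: exp_of_nat_mult)
  also have "\<dots> \<le> exp ((u - 1) * (l - L))"
    using j(2) l by (simp add: mult_right_mono_neg)
  finally have "1 \<le> exp ((u - 1) * (l - L)) * real (Psi x y)"
    using * by (meson mult_right_mono of_nat_0_le_iff order_trans)
  from mult_left_mono[OF this, of "exp (- ((u - 1) * (l - L)))"]
  have "exp (- ((u - 1) * (l - L))) \<le> real (Psi x y)"
    by (simp add: exp_add[symmetric] mult.assoc[symmetric])
  moreover have "t - u * l - L \<le> - ((u - 1) * (l - L))"
  proof -
    have "u * L = t" using L0 by (simp add: u_def)
    then show ?thesis using l by (simp add: algebra_simps)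
  qed
  then have "exp (t - u * l - L) \<le> exp (- ((u - 1) * (l - L)))" by simp
  ultimately have "exp (t - u * l - L) \<le> real (Psi x y)" by linarith
  then show ?thesis by (simp add: t_def u_def l_def L_def)
qed

lemma powr_root_le:
  fixes E W :: real
  assumes "0 \<le> E" "E \<le> W ^ (2 * k)" "W \<ge> 0" "k > 0"
  shows "E powr (1 / (2 * real k)) \<le> W"
proof (cases "W = 0")
  case True
  then have "E = 0" using assms by (simp add: power_0_left)
  then show ?thesis using assms by simp
next
  case False
  then have W: "W > 0" using assms by simp
  have "E powr (1 / (2 * real k)) \<le> (W ^ (2 * k)) powr (1 / (2 * real k))"
    using assms by (intro powr_mono2) auto
  also have "\<dots> = W" using W assms by (simp add: powr_powr flip: powr_realpow)
  finally show ?thesis .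
qed

section \<open>The two ranges of the smoothness parameter\<close>

context random_completely_multiplicative
begin

definition remainder_moment :: "real \<Rightarrow> real \<Rightarrow> nat \<Rightarrow> real" where
  "remainder_moment x y k =
     expectation (\<lambda>\<omega>. norm ((\<Sum>n\<in>ints_upto x. X n \<omega>) - Psi0 x y (\<lambda>n. X n \<omega>)) ^ (2 * k))"

lemma remainder_moment_nonneg: "remainder_moment x y k \<ge> 0"
  unfolding remainder_moment_def by (intro Bochner_Integration.integral_nonneg) auto

lemma remainder_moment_large_y:
  assumes "x \<le> y" "k > 0"
  shows "remainder_moment x y k = 0"
proof -
  have "smooth_upto x y = ints_upto x"
    using smooth_le[of _ y] assms by (fastforce simp: smooth_upto_iff ints_upto_def dest: smooth_pos)
  then show ?thesis using assms by (simp add: remainder_moment_def Psi0_def power_0_left)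
qed

lemma moment_sparse_range:
  assumes "smooth_growth x y" "k > 0" "ln x \<ge> 3"
  shows "remainder_moment x y k powr (1 / (2 * real k)) \<le>
    224 * real (Psi x y) * sqrt (real k * ln y * (ln x)\<^sup>2 / y) * exp (384 * (real k * (ln x)\<^sup>2 * ln (ln x) / y))"
proof -
  interpret g: smooth_growth x y by fact
  define t where "t = ln x"
  define P where "P = real (Psi x y)"
  have t: "t \<ge> 3" using assms by (simp add: t_def)
  have y: "y > 2" "y > 0" using g.y_gt_2 by auto
  have x1: "x \<ge> 1" by (rule g.x_ge_1)
  have ty: "8 * t \<le> sqrt y"
  proof -
    have "8 * t \<le> exp (g.L / 8)" using g.ln_x_le by (simp add: t_def)
    also have "\<dots> \<le> exp (g.L / 2)" using g.L_ge by simp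
    finally show ?thesis by (simp add: g.sqrt_y)
  qed
  have tyy: "(8 * t)\<^sup>2 \<le> y"
  proof -
    have "(8 * t)\<^sup>2 \<le> (sqrt y)\<^sup>2" using ty t by (intro power_mono) auto
    then show ?thesis using y by simp
  qed
  \<comment> \<open>If \<open>r\<close> has \<open>j\<close> prime factors, all beyond
    \<open>y\<close>, then \<open>r = y ^ j * Z\<close> with \<open>Z >= 1\<close>. The steps by
    \<open>y\<close> cost \<open>(8 * t / y) ^ j\<close> and \<open>Z\<close> costs
    \<open>8 * Z powr (-(3/4))\<close>; squared and expressed in \<open>r\<close> this is 64 times
    \<open>q ^ j * r powr (-(3/2))\<close>. The factor \<open>q\<close> lowers the order of the
    prime sum from \<open>y powr (-1/2)\<close> to \<open>t^2 / y\<close>.\<close>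
  define q where "q = (8 * t)\<^sup>2 / sqrt y"
  have q: "q > 0" using t y by (simp add: q_def)
  define f where "f = (\<lambda>n. real n powr (-(3/2)) * q ^ size (prime_factorization n))"
  have f: "completely_multiplicative f"
    by unfold_locales (use q in \<open>auto simp: f_def powr_mult prime_factorization_mult power_add\<close>)
  have fp: "f p = q * real p powr (-(3/2))" if "prime p" for p
    using that by (simp add: f_def prime_factorization_prime)
  define U where "U = (\<Sum>p\<in>primes_between y x. f p)"
  have U: "U \<le> 192 * t\<^sup>2 / y"
  proof -
    have "U = q * (\<Sum>p\<in>primes_between y x. real p powr (-(3/2)))"
      unfolding U_def sum_distrib_left by (intro sum.cong refl fp) (simp add: primes_between_def)
    also have "\<dots> \<le> q * (y powr (1 - 3/2) * (1 + 1 / (3/2 - 1)))"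
      using q y by (intro mult_left_mono sum_primes_powr_le) auto
    also have "y powr (1 - 3/2) = 1 / sqrt y" using y by (simp add: powr_minus powr_half_sqrt field_simps)
    also have "q * (1 / sqrt y * (1 + 1 / (3/2 - 1))) = 192 * t\<^sup>2 / (sqrt y * sqrt y)"
      by (simp add: q_def power_mult_distrib)
    finally show ?thesis using y by simp
  qed
  have "remainder_moment x y k \<le> ((64 * P\<^sup>2) * (exp (4 * real k * U) - 1)) ^ k"
    unfolding remainder_moment_def U_def
  proof (rule moment_le[OF order_refl f])
    fix p assume p: "p \<in> primes_between y x"
    have "f p = q * real p powr (-(3/2))" using p by (intro fp) (simp add: primes_between_def)
    also have "\<dots> \<le> sqrt y * y powr (-(3/2))"
    proof (intro mult_mono powr_mono2')
      show "q \<le> sqrt y" using tyy y by (simp add: q_def divide_le_eq)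
    qed (use p y in \<open>auto simp: primes_between_def\<close>)
    also have "\<dots> = 1 / y"
    proof -
      have "sqrt y * y powr (-(3/2)) = y powr (1/2) * y powr (-(3/2))" using y by (simp add: powr_half_sqrt)
      also have "\<dots> = y powr (-1)" by (simp flip: powr_add)
      finally show ?thesis using y by (simp add: powr_minus field_simps)
    qed
    also have "\<dots> \<le> 3/4" using y by (simp add: field_simps)
    finally show "f p \<le> 3/4" .
  next
    fix r assume r: "r \<in> rough_upto x y" "r \<noteq> 1"
    define j where "j = size (prime_factorization r)"
    have r0: "r > 0" using r by (simp add: rough_upto_def)
    have rj: "y ^ j \<le> real r"
    proof -
      have "y ^ size A \<le> real (prod_mset A)" if "\<And>p. p \<in># A \<Longrightarrow> real p > y" for A
        using that
      proof (induction A)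
        case (add p A)
        then have "y \<le> real p" "y ^ size A \<le> real (prod_mset A)" by (auto intro: less_imp_le)
        then show ?case using y by (simp add: mult_mono)
      qed simp
      from this[of "prime_factorization r"] show ?thesis
        using r r0 by (auto simp: rough_upto_def j_def prod_mset_prime_factorization_nat)
    qed
    define Z where "Z = real r / y ^ j"
    have Z: "Z \<ge> 1" using rj y by (simp add: Z_def)
    have "real (Psi (x / real r) y) = real (Psi (x / Z / y ^ j) y)" using y by (simp add: Z_def)
    also have "\<dots> \<le> (8 * t / y) ^ j * real (Psi (x / Z) y)"
      unfolding t_def using y x1 Z divide_left_mono[of 1 Z x] by (intro Psi_divide_power_le) auto
    also have "\<dots> \<le> (8 * t / y) ^ j * (8 * Z powr (-(3/4)) * P)"
      unfolding P_def using t y by (intro mult_left_mono g.Psi_divide_growth Z) auto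
    finally have "real (Psi (x / real r) y) ^ 2 \<le> ((8 * t / y) ^ j * (8 * Z powr (-(3/4)) * P)) ^ 2"
      by (intro power_mono) auto
    also have "\<dots> = 64 * P\<^sup>2 * (((8 * t / y) ^ j) ^ 2 * (Z powr (-(3/4))) ^ 2)"
      by (simp add: power_mult_distrib)
    also have "(Z powr (-(3/4))) ^ 2 = Z powr (-(3/2))"
      using Z by (simp add: powr_power)
    also have "((8 * t / y) ^ j) ^ 2 * Z powr (-(3/2)) = f r"
    proof -
      have "Z powr (-(3/2)) = real r powr (-(3/2)) * (y powr (3/2)) ^ j"
        using y r0 by (simp add: Z_def powr_divide powr_minus powr_powr field_simps flip: powr_realpow)
      moreover have "((8 * t / y) ^ j) ^ 2 = ((8 * t / y)\<^sup>2) ^ j" by (simp add: mult.commute flip: power_mult)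
      moreover have "(8 * t / y)\<^sup>2 * y powr (3/2) = q"
      proof -
        have "y powr (3/2) = y * sqrt y"
        proof -
          have "y powr (3/2) = y powr (1 + 1/2)" by simp
          also have "\<dots> = y * sqrt y" using y by (simp only: powr_add powr_one powr_half_sqrt)
          finally show ?thesis .
        qed
        moreover have "sqrt y / y = 1 / sqrt y" using y by (simp add: real_div_sqrt field_simps)
        ultimately show ?thesis using y by (simp add: q_def power_divide power2_eq_square field_simps)
      qed
      ultimately show ?thesis by (simp add: f_def j_def mult_ac flip: power_mult_distrib)
    qed
    finally show "real (Psi (x / real r) y) ^ 2 \<le> 64 * P\<^sup>2 * f r" .
  qed (simp add: P_def)
  also have "\<dots> \<le> ((28 * 8 * P * sqrt (real k * ln y * t\<^sup>2 / y) * exp (384 * (real k * t\<^sup>2 * ln t / y))) ^ 2) ^ k"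
  proof (intro power_mono)
    have lny: "ln y \<ge> 1" using g.L_ge by (simp add: g.L_def)
    have lnt: "ln t \<ge> 1"
    proof -
      have "exp 1 \<le> t" using t exp_le by linarith
      then show ?thesis using t by (simp add: ln_ge_iff)
    qed
    define v where "v = real k * t\<^sup>2 / y"
    have v0: "v \<ge> 0" using y by (simp add: v_def)
    have "4 * real k * U \<le> 4 * real k * (192 * t\<^sup>2 / y)" using U by (intro mult_left_mono) auto
    also have "\<dots> = 768 * v" by (simp add: v_def)
    finally have "exp (4 * real k * U) - 1 \<le> exp (768 * v) - 1" by simp
    \<comment> \<open>From \<open>exp s - 1 <= s * exp s\<close>: the linear factor becomes the
      square root in the claim.\<close>
    also have "\<dots> \<le> 768 * v * exp (768 * v)"
      using mult_left_mono[OF exp_ge_add_one_self[of "-(768 * v)"], of "exp (768 * v)"]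
      by (simp add: algebra_simps exp_minus)
    \<comment> \<open>768 is rounded up to the square of 28, so that the root of
      \<open>64 * 784\<close> is 224. Here \<open>ln y\<close> and \<open>ln t\<close>, both at
      least 1, are inserted to match the claimed shape.\<close>
    also have "\<dots> \<le> 784 * (v * ln y) * exp (768 * (v * ln t))"
    proof (rule mult_mono)
      have "v * 1 \<le> v * ln y" using v0 lny by (intro mult_left_mono) auto
      then show "768 * v \<le> 784 * (v * ln y)" using v0 by linarith
      have "v * 1 \<le> v * ln t" using v0 lnt by (intro mult_left_mono) auto
      then show "exp (768 * v) \<le> exp (768 * (v * ln t))" by simp
    qed (use v0 lny in auto)
    finally have "64 * P\<^sup>2 * (exp (4 * real k * U) - 1) \<le> 64 * P\<^sup>2 * (784 * (v * ln y) * exp (768 * (v * ln t)))"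
      by (intro mult_left_mono) auto
    also have "\<dots> = (28 * 8 * P * sqrt (v * ln y) * exp (384 * (v * ln t))) ^ 2"
      using v0 lny by (simp add: power_mult_distrib flip: exp_double)
    finally show "64 * P\<^sup>2 * (exp (4 * real k * U) - 1) \<le>
      (28 * 8 * P * sqrt (real k * ln y * t\<^sup>2 / y) * exp (384 * (real k * t\<^sup>2 * ln t / y))) ^ 2"
      by (simp add: v_def mult_ac)
    have "U \<ge> 0" unfolding U_def by (intro sum_nonneg) (use q in \<open>auto simp: f_def\<close>)
    then show "0 \<le> 64 * P\<^sup>2 * (exp (4 * real k * U) - 1)" by (intro mult_nonneg_nonneg) auto
  qed
  also have "\<dots> = (28 * 8 * P * sqrt (real k * ln y * t\<^sup>2 / y) * exp (384 * (real k * t\<^sup>2 * ln t / y))) ^ (2 * k)"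
    by (simp add: power_mult)
  finally have "remainder_moment x y k powr (1 / (2 * real k)) \<le>
      28 * 8 * P * sqrt (real k * ln y * t\<^sup>2 / y) * exp (384 * (real k * t\<^sup>2 * ln t / y))"
    using assms y g.L_ge[unfolded g.L_def] by (intro powr_root_le remainder_moment_nonneg) (auto simp: P_def)
  then show ?thesis by (simp add: P_def t_def)
qed

text \<open>Lowering the smoothness level from \<open>y\<close> to \<open>w = y / exp \<kappa>\<close> costs only a constant factor in
  the exponent of the moment bound, but it makes the Rankin bound smaller than \<open>Psi x y\<close> by a factor
  exponential in \<open>ln x / ln y\<close>, which beats every power of \<open>y\<close> in this range.\<close>
lemma moment_dense_range:
  fixes N \<kappa> x y :: real
  assumes x0: "x > 0" and N: "N \<ge> 1" and \<kappa>: "\<kappa> = N * (104 * N + 4)" and "k \<ge> 2"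
    and t: "ln x \<ge> 3" "N * ln (ln x) \<le> sqrt (ln x)" "2 * (N * ln (ln x))\<^sup>2 \<le> ln x"
    and y: "exp (2 * \<kappa> + 3) * (ln x)\<^sup>2 \<le> y" "ln y \<le> N * ln (ln x)" "y < x"
  shows "remainder_moment x y k powr (1 / (2 * real k)) \<le>
    real (Psi x y) * sqrt (real k * ln y * (ln x)\<^sup>2 / y) * exp (4 * exp \<kappa> * N * (real k * (ln x)\<^sup>2 * ln (ln x) / y))"
proof -
  define t L u l where "t = ln x" and "L = ln y" and "u = t / L" and "l = ln t"
  have t3: "t \<ge> 3" using t by (simp add: t_def)
  have kap0: "\<kappa> \<ge> 0" using N \<kappa> by simp
  have l1: "l \<ge> 1"
  proof -
    have "exp 1 \<le> t" using t3 exp_le by linarith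
    then show ?thesis using t3 by (simp add: l_def ln_ge_iff)
  qed
  have "exp (2 * \<kappa> + 3) * t\<^sup>2 > 0" using t3 by simp
  then have y0: "y > 0" using y(1) unfolding t_def by linarith
  have L: "L \<ge> 2 * \<kappa> + 3 + 2 * l"
  proof -
    have "ln (exp (2 * \<kappa> + 3) * t\<^sup>2) \<le> L"
      unfolding L_def using y(1) y0 t3 by (subst ln_le_cancel_iff) (auto simp: t_def intro!: mult_pos_pos)
    then show ?thesis using t3 by (simp add: ln_mult ln_realpow l_def)
  qed
  have LN: "L \<le> N * l" using y by (simp add: L_def l_def t_def)
  define lw where "lw = L - \<kappa>"
  define w where "w = exp lw"
  have lw: "lw \<ge> 2 * l + 1" "lw \<ge> L / 2" "lw \<le> L" using L kap0 l1 by (auto simp: lw_def)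
  have lw0: "lw > 0" and L0: "L > 0" using lw l1 by auto
  have yL: "y = exp L" using y0 by (simp add: L_def)
  have wy: "w \<le> y" unfolding w_def yL using lw by simp
  have w1: "w > 1" using lw0 by (simp add: w_def)
  \<comment> \<open>Chosen so that \<open>w powr a = t\<close>. At the exponent
    \<open>\<sigma> = 1 - a\<close> the primes up to \<open>w\<close> then contribute a bounded
    multiple of \<open>u\<close>, and the primes beyond \<open>w\<close> enter at
    \<open>2 * \<sigma>\<close> with the factor \<open>t^2 / w\<close>.\<close>
  define a where "a = l / lw"
  define \<sigma> where "\<sigma> = 1 - a"
  have a: "0 < a" "a \<le> 1/2" "1 / N \<le> a"
  proof -
    show "0 < a" "a \<le> 1/2" using l1 lw lw0 by (auto simp: a_def field_simps)
    have "lw \<le> N * l" using lw LN by simp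
    then show "1 / N \<le> a" using N lw0 by (simp add: a_def field_simps)
  qed
  have wa: "w powr a = t" using lw0 t3 by (simp add: w_def a_def powr_def l_def)
  define Z where "Z = exp (4 * (\<Sum>p\<in>primes_between 0 w. real p powr (-\<sigma>)))"
  have u0: "u \<ge> 0" using t3 L0 by (simp add: u_def)
  have Z: "Z \<le> exp (104 * N * u)"
  proof -
    have "(\<Sum>p\<in>primes_between 0 w. real p powr (a - 1)) \<le> (2 * w powr (a / 2) + 12 * w powr a / ln w) / a"
      using a w1 by (intro primes_upto_powr_le) auto
    also have "w powr (a / 2) = sqrt t"
    proof -
      have "w powr (a / 2) = (w powr a) powr (1/2)" by (simp add: powr_powr)
      then show ?thesis using t3 by (simp add: wa powr_half_sqrt)
    qed
    also have "ln w = lw" by (simp add: w_def)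
    also have "(2 * sqrt t + 12 * w powr a / lw) / a \<le> (26 * u) / a"
    proof (intro divide_right_mono)
      have "sqrt t \<le> u"
      proof -
        have "L \<le> sqrt t" using LN t by (simp add: l_def t_def)
        then have "L * sqrt t \<le> sqrt t * sqrt t" using t3 by (intro mult_right_mono) auto
        then show ?thesis using L0 t3 by (simp add: u_def field_simps)
      qed
      moreover have "12 * t / lw \<le> 12 * t / (L / 2)" using lw L0 t3 by (intro divide_left_mono) auto
      then have "12 * t / lw \<le> 24 * u" by (simp add: u_def)
      ultimately show "2 * sqrt t + 12 * w powr a / lw \<le> 26 * u" by (simp add: wa)
    qed (use a in auto)
    also have "\<dots> \<le> (26 * u) / (1 / N)" using a N u0 by (intro divide_left_mono) auto
    finally show ?thesis by (simp add: Z_def \<sigma>_def mult_ac)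
  qed
  define f where "f = (\<lambda>n. real n powr (-(2 * \<sigma>)))"
  have f: "completely_multiplicative f" unfolding f_def by (rule completely_multiplicative_powr)
  define U where "U = (\<Sum>p\<in>primes_between w x. f p)"
  define V where "V = real k * t\<^sup>2 * l / y"
  have U: "real k * U \<le> 2 * exp \<kappa> * N * V"
  proof -
    \<comment> \<open>The lower bound on \<open>y\<close> keeps \<open>lw\<close> at least
      \<open>2 * l + 1\<close>, which separates \<open>2 * \<sigma>\<close> from 1 by
      \<open>1 / lw\<close>. The resulting factor \<open>lw <= N * l\<close> is the log log x in the
      exponent of the claim.\<close>
    have s1: "1 / (2 * \<sigma> - 1) \<le> lw" "2 * \<sigma> > 1"
    proof -
      have "2 * \<sigma> - 1 = (lw - 2 * l) / lw" using lw0 by (simp add: \<sigma>_def a_def field_simps)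
      moreover have "(lw - 2 * l) / lw \<ge> 1 / lw" using lw lw0 by (intro divide_right_mono) auto
      ultimately have *: "2 * \<sigma> - 1 \<ge> 1 / lw" by simp
      then show "2 * \<sigma> > 1" using lw0 by (smt (verit) zero_less_divide_1_iff)
      then show "1 / (2 * \<sigma> - 1) \<le> lw" using * lw0 by (simp add: field_simps)
    qed
    have "U \<le> w powr (1 - 2 * \<sigma>) * (1 + 1 / (2 * \<sigma> - 1))"
      unfolding U_def f_def using s1 w1 by (intro sum_primes_powr_le) auto
    also have "\<dots> \<le> w powr (1 - 2 * \<sigma>) * (lw + lw)" using s1 lw l1 by (intro mult_left_mono) auto
    also have "w powr (1 - 2 * \<sigma>) = t\<^sup>2 / w"
    proof -
      have "w powr (1 - 2 * \<sigma>) = w powr (a + a - 1)" by (simp add: \<sigma>_def)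
      also have "\<dots> = t\<^sup>2 / w" using w1 by (simp only: powr_diff powr_add wa powr_one) (simp add: power2_eq_square)
      finally show ?thesis .
    qed
    also have "t\<^sup>2 / w = exp \<kappa> * t\<^sup>2 / y" by (simp add: w_def lw_def yL exp_diff)
    also have "exp \<kappa> * t\<^sup>2 / y * (lw + lw) \<le> exp \<kappa> * t\<^sup>2 / y * (2 * (N * l))"
      using lw LN y0 by (intro mult_left_mono) auto
    finally have "real k * U \<le> real k * (exp \<kappa> * t\<^sup>2 / y * (2 * (N * l)))" by (intro mult_left_mono) auto
    then show ?thesis by (simp add: V_def mult_ac)
  qed
  define Q where "Q = x powr \<sigma> * Z"
  have Q0: "Q \<ge> 0" by (simp add: Q_def Z_def)
  have "remainder_moment x y k \<le> (Q\<^sup>2 * (exp (4 * real k * U) - 1)) ^ k"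
    unfolding remainder_moment_def U_def
  proof (rule moment_le[OF wy f])
    fix p assume p: "p \<in> primes_between w x"
    then have "real p \<ge> 2" by (auto simp: primes_between_def dest: prime_ge_2_nat)
    then have "f p \<le> 2 powr (-(2 * \<sigma>))" unfolding f_def using a by (intro powr_mono2') (auto simp: \<sigma>_def)
    also have "\<dots> \<le> 2 powr (-1)" using a by (intro powr_mono) (auto simp: \<sigma>_def)
    also have "\<dots> \<le> 3/4" by (simp add: powr_minus)
    finally show "f p \<le> 3/4" .
  next
    fix r assume r: "r \<in> rough_upto x w" "r \<noteq> 1"
    then have r0: "r > 0" by (simp add: rough_upto_def)
    have "real (Psi (x / real r) w) \<le> (x / real r) powr \<sigma> * Z"
      unfolding Z_def using r0 x0 a by (intro Rankin_bound) (auto simp: \<sigma>_def)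
    also have "\<dots> = Q * real r powr (-\<sigma>)"
      using r0 x0 by (simp add: Q_def powr_divide powr_minus field_simps)
    finally have "real (Psi (x / real r) w) ^ 2 \<le> (Q * real r powr (-\<sigma>)) ^ 2" by (intro power_mono) auto
    also have "\<dots> = Q\<^sup>2 * f r" using r0 by (simp add: power_mult_distrib f_def powr_power mult.commute)
    finally show "real (Psi (x / real r) w) ^ 2 \<le> Q\<^sup>2 * f r" .
  qed simp
  also have "\<dots> \<le> ((Q * exp (4 * exp \<kappa> * N * V)) ^ 2) ^ k"
  proof (intro power_mono)
    have "4 * real k * U \<le> 8 * exp \<kappa> * N * V" using U by linarith
    then have "exp (4 * real k * U) \<le> exp (8 * exp \<kappa> * N * V)" by simp
    then have "exp (4 * real k * U) - 1 \<le> exp (8 * exp \<kappa> * N * V)" by linarith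
    then have "Q\<^sup>2 * (exp (4 * real k * U) - 1) \<le> Q\<^sup>2 * exp (8 * exp \<kappa> * N * V)"
      by (rule mult_left_mono) simp
    also have "\<dots> = (Q * exp (4 * exp \<kappa> * N * V)) ^ 2"
      by (simp add: power_mult_distrib flip: exp_double)
    finally show "Q\<^sup>2 * (exp (4 * real k * U) - 1) \<le> (Q * exp (4 * exp \<kappa> * N * V)) ^ 2" .
    have "U \<ge> 0" unfolding U_def by (intro sum_nonneg) (auto simp: f_def)
    then show "0 \<le> Q\<^sup>2 * (exp (4 * real k * U) - 1)" by (intro mult_nonneg_nonneg) auto
  qed
  also have "\<dots> = (Q * exp (4 * exp \<kappa> * N * V)) ^ (2 * k)" by (simp add: power_mult)
  finally have "remainder_moment x y k powr (1 / (2 * real k)) \<le> Q * exp (4 * exp \<kappa> * N * V)"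
    using Q0 assms by (intro powr_root_le remainder_moment_nonneg) auto
  also have "Q \<le> real (Psi x y) * sqrt (real k * L * t\<^sup>2 / y)"
  proof -
    have "exp (t - u * ln (8 * t) - L) \<le> real (Psi x y)"
      unfolding t_def L_def u_def
    proof (rule Psi_lower_bound)
      show "exp 1 \<le> x" using t x0 by (subst ln_ge_iff[symmetric]) auto
      have "exp 3 * t\<^sup>2 \<le> exp (2 * \<kappa> + 3) * t\<^sup>2" using kap0 by (intro mult_right_mono) auto
      also have "\<dots> \<le> y" using y by (simp add: t_def)
      finally have *: "exp 3 * t\<^sup>2 \<le> y" .
      have "4 \<le> exp (3::real)" using exp_ge_add_one_self[of "3::real"] by simp
      moreover have "3 * t \<le> t\<^sup>2" using t3 by (simp add: power2_eq_square)
      ultimately have "4 * (3 * t) \<le> exp 3 * t\<^sup>2" using t3 by (intro mult_mono) auto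
      with * t3 show "8 * ln x \<le> y" "2 \<le> y" by (auto simp: t_def)
    qed
    moreover have "Q \<le> exp (t - u * ln (8 * t) - L) * exp (- (L / 2))"
    proof -
      have "x powr \<sigma> = exp (t - t * a)" using x0 by (simp add: powr_def \<sigma>_def t_def algebra_simps)
      then have "Q \<le> exp (t - t * a) * exp (104 * N * u)" unfolding Q_def by (simp add: Z mult_left_mono)
      also have "\<dots> = exp (t - t * a + 104 * N * u)" by (simp add: exp_add)
      also have "\<dots> \<le> exp (t - u * ln (8 * t) - L - L / 2)"
      proof -
        \<comment> \<open>Lowering \<open>L\<close> to \<open>L - \<kappa>\<close> gains
          \<open>u * \<kappa> / N = u * (104 * N + 4)\<close>: the part \<open>104 * N\<close>
          cancels the Rankin factor \<open>Z\<close>, 3 covers the constant 8 in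
          \<open>Psi_lower_bound\<close>, and the last \<open>u\<close> covers
          \<open>L + L / 2\<close>.\<close>
        have "t * a \<ge> u * l + u * \<kappa> / N"
        proof -
          have "1 / L * (1 + \<kappa> / L) \<le> 1 / lw"
          proof -
            have "(L - \<kappa>) * (L + \<kappa>) \<le> L * L" by (simp add: algebra_simps)
            then show ?thesis using L0 lw0 by (simp add: lw_def field_simps)
          qed
          then have "t * l * (1 / L * (1 + \<kappa> / L)) \<le> t * l * (1 / lw)" using t3 l1 by (intro mult_left_mono) auto
          moreover have "t * l * (1 / L * (1 + \<kappa> / L)) = u * l + u * (\<kappa> * (l / L))"
            using L0 by (simp add: u_def field_simps)
          moreover have "\<kappa> * (1 / N) \<le> \<kappa> * (l / L)"
            using LN L0 N kap0 by (intro mult_left_mono) (auto simp: field_simps)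
          then have "u * (\<kappa> * (1 / N)) \<le> u * (\<kappa> * (l / L))" by (rule mult_left_mono[OF _ u0])
          ultimately show ?thesis by (simp add: a_def)
        qed
        moreover have "u * \<kappa> / N = u * (104 * N + 4)" using N by (simp add: \<kappa>)
        moreover have "u * ln (8 * t) \<le> u * l + u * 3"
        proof -
          have "ln (8 * t) = ln 8 + l" using t3 by (simp add: ln_mult l_def)
          moreover have "ln (8::real) = 3 * ln 2" using ln_realpow[of 2 3] by simp
          ultimately have "ln (8 * t) \<le> l + 3" using ln_2_less_1 by linarith
          then have "u * ln (8 * t) \<le> u * (l + 3)" using u0 by (intro mult_left_mono) auto
          then show ?thesis by (simp add: algebra_simps)
        qed
        moreover have "u \<ge> L + L / 2"
        proof -
          have "L\<^sup>2 \<le> (N * l)\<^sup>2" using LN L0 by (intro power_mono) auto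
          then have "2 * L\<^sup>2 \<le> t" using t by (simp add: l_def t_def)
          then have "2 * L \<le> u" using L0 by (simp add: u_def field_simps power2_eq_square)
          then show ?thesis using L0 by simp
        qed
        ultimately show ?thesis by (simp add: algebra_simps)
      qed
      also have "\<dots> = exp (t - u * ln (8 * t) - L) * exp (- (L / 2))" by (simp flip: exp_add)
      finally show ?thesis .
    qed
    moreover have "exp (- (L / 2)) \<le> sqrt (real k * L * t\<^sup>2 / y)"
    proof -
      have "exp (- (L / 2)) = sqrt (1 / y)"
      proof -
        have "exp (- (L / 2)) ^ 2 = exp (2 * (- (L / 2)))" by (rule exp_double[symmetric])
        also have "\<dots> = 1 / y" by (simp add: yL exp_minus field_simps)
        finally have "exp (- (L / 2)) ^ 2 = 1 / y" .
        then show ?thesis by (intro real_sqrt_unique[symmetric]) auto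
      qed
      also have "1 \<le> real k * L * t\<^sup>2"
      proof -
        have "1 * 1 * 1 \<le> real k * L * t\<^sup>2"
          using assms(4) L l1 kap0 t3 by (intro mult_mono one_le_power) auto
        then show ?thesis by simp
      qed
      then have "sqrt (1 / y) \<le> sqrt (real k * L * t\<^sup>2 / y)"
        using y0 by (intro real_sqrt_le_mono divide_right_mono) auto
      finally show ?thesis by simp
    qed
    ultimately show ?thesis by (meson exp_ge_zero mult_mono of_nat_0_le_iff order_trans)
  qed
  finally show ?thesis by (simp add: V_def t_def L_def l_def mult_right_mono)
qed

end

theorem theorem6p1:
  shows "\<exists>C A B :: real. C > 0 \<and> A > 0 \<and> B > 0 \<and>
    (\<forall>(M :: 'a measure) (X :: nat \<Rightarrow> 'a \<Rightarrow> complex) (k :: nat) (x :: real) (y :: real).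
      random_completely_multiplicative M X \<longrightarrow> k \<ge> 2 \<longrightarrow> x \<ge> 2 \<longrightarrow> y \<ge> C * (ln x)\<^sup>2 \<longrightarrow>
      prob_space.expectation M
        (\<lambda>\<omega>. norm ((\<Sum>n\<in>ints_upto x. X n \<omega>) - Psi0 x y (\<lambda>n. X n \<omega>)) ^ (2 * k))
          powr (1 / (2 * real k))
      \<le> A * real (Psi x y) * (real k * ln y * (ln x)\<^sup>2 / y) powr (1 / 2)
          * exp (B * \<bar>real k * (ln x)\<^sup>2 * ln (ln x) / y\<bar>))"
proof -
  \<comment> \<open>Twice the exponent in \<open>smooth_growth\<close>, because
    \<open>1 + t <= t powr 2\<close> is used to pass from \<open>1 + ln x\<close> to
    \<open>ln x\<close>.\<close>
  define N :: real where "N = 6400 * exp 22"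
  have N: "N \<ge> 6400" by (simp add: N_def)
  define \<kappa> where "\<kappa> = N * (104 * N + 4)"
  have kap0: "\<kappa> \<ge> 0" using N by (simp add: \<kappa>_def)
  have "eventually (\<lambda>t::real. t \<ge> 3 \<and> N * ln t \<le> sqrt t \<and> 2 * (N * ln t)\<^sup>2 \<le> t) at_top"
    unfolding eventually_conj_iff
  proof (intro conjI)
    have "((\<lambda>t::real. ln t / sqrt t) \<longlongrightarrow> 0) at_top" "((\<lambda>t::real. (ln t)\<^sup>2 / t) \<longlongrightarrow> 0) at_top"
      by real_asymp+
    from tendsto_mult_right_zero[OF this(1), of N] tendsto_mult_right_zero[OF this(2), of "2 * N\<^sup>2"]
    have "((\<lambda>t. N * ln t / sqrt t) \<longlongrightarrow> 0) at_top" "((\<lambda>t. 2 * (N * ln t)\<^sup>2 / t) \<longlongrightarrow> 0) at_top"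
      by (simp_all add: power_mult_distrib mult_ac)
    note ev = order_tendstoD(2)[OF this(1), of 1] order_tendstoD(2)[OF this(2), of 1]
    have "eventually (\<lambda>t. N * ln t / sqrt t < 1) at_top" "eventually (\<lambda>t. 2 * (N * ln t)\<^sup>2 / t < 1) at_top"
      by (rule ev; simp)+
    note ev' = eventually_conj[OF this(1) eventually_gt_at_top[of 0]] eventually_conj[OF this(2) eventually_gt_at_top[of 0]]
    from ev'(1) show "eventually (\<lambda>t. N * ln t \<le> sqrt t) at_top"
      by (rule eventually_mono) (auto simp: divide_less_eq)
    from ev'(2) show "eventually (\<lambda>t. 2 * (N * ln t)\<^sup>2 \<le> t) at_top"
      by (rule eventually_mono) (auto simp: divide_less_eq)
  qed (rule eventually_ge_at_top)
  then obtain T where T: "\<And>t. t \<ge> T \<Longrightarrow> t \<ge> 3 \<and> N * ln t \<le> sqrt t \<and> 2 * (N * ln t)\<^sup>2 \<le> t"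
    by (auto simp: eventually_at_top_linorder)
  \<comment> \<open>The summand \<open>\<bar>T\<bar>\<close> disposes of small \<open>x\<close>:
    since \<open>ln x >= 2/3\<close>, it forces \<open>y >= exp \<bar>T\<bar>\<close>, so
    \<open>y < x\<close> implies \<open>ln x >= T\<close>.\<close>
  define C where "C = exp (2 * \<kappa> + 3 + \<bar>T\<bar>)"
  define B where "B = 4 * exp \<kappa> * N + 384"
  have B: "B \<ge> 384" "B \<ge> 4 * exp \<kappa> * N" using N by (auto simp: B_def)
  show ?thesis
  proof (rule exI[of _ C], rule exI[of _ "224::real"], rule exI[of _ B], intro conjI allI impI)
    show "C > 0" "B > 0" using B by (auto simp: C_def)
    fix M :: "'a measure" and X :: "nat \<Rightarrow> 'a \<Rightarrow> complex" and k :: nat and x y :: real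
    assume M: "random_completely_multiplicative M X" and k: "k \<ge> 2" and x: "x \<ge> 2" and y: "y \<ge> C * (ln x)\<^sup>2"
    interpret random_completely_multiplicative M X by fact
    let ?E = "remainder_moment x y k powr (1 / (2 * real k))"
    let ?S = "sqrt (real k * ln y * (ln x)\<^sup>2 / y)"
    let ?V = "real k * (ln x)\<^sup>2 * ln (ln x) / y"
    have lnx: "ln x \<ge> 2/3" 
    proof -
      have "ln 2 \<le> ln x" using x by simp
      then show ?thesis using ln2_ge_two_thirds by linarith
    qed
    have y_ge: "y \<ge> C * (4/9)"
    proof -
      have "(2/3)\<^sup>2 \<le> (ln x)\<^sup>2" using lnx by (intro power_mono) auto
      then have "C * (4/9) \<le> C * (ln x)\<^sup>2" by (intro mult_left_mono) (auto simp: C_def power2_eq_square)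
      then show ?thesis using y by linarith
    qed
    have C3: "C * (4/9) \<ge> exp \<bar>T\<bar>"
    proof -
      have "C = exp (2 * \<kappa> + 3) * exp \<bar>T\<bar>" by (simp add: C_def flip: exp_add)
      moreover have "exp (2 * \<kappa> + 3) \<ge> 9/4" using exp_ge_add_one_self[of "2 * \<kappa> + 3"] kap0 by linarith
      then have "9/4 * exp \<bar>T\<bar> \<le> exp (2 * \<kappa> + 3) * exp \<bar>T\<bar>" by (intro mult_right_mono) auto
      ultimately show ?thesis by linarith
    qed
    have y1: "y \<ge> 1" using y_ge C3 by (smt (verit) one_le_exp_iff abs_ge_zero)
    have "?E \<le> 224 * real (Psi x y) * ?S * exp (B * \<bar>?V\<bar>)"
    \<comment> \<open>Every integer up to \<open>x\<close> is \<open>y\<close>-smooth in the first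
      case, so the moment vanishes. All \<open>x\<close> with \<open>ln (ln x) < 0\<close> fall
      under it; in the second case the absolute value can be removed.\<close>
    proof (cases "x \<le> y")
      case True
      then have "?E = 0" using remainder_moment_large_y[of x y k] k by simp
      then show ?thesis using y1 by simp
    next
      case False
      then have yx: "y < x" by simp
      define t where "t = ln x"
      have "exp \<bar>T\<bar> \<le> x" using yx y_ge C3 by linarith
      then have "t \<ge> \<bar>T\<bar>" unfolding t_def using x by (simp add: ln_ge_iff)
      then have tT: "t \<ge> 3" "N * ln t \<le> sqrt t" "2 * (N * ln t)\<^sup>2 \<le> t" using T[of t] by auto
      have lnt: "ln t \<ge> 1"
      proof -
        have "exp 1 \<le> t" using tT exp_le by linarith
        then show ?thesis using tT by (simp add: ln_ge_iff)
      qed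
      have V0: "?V \<ge> 0" using lnt y1 by (simp add: t_def)
      have S0: "?S \<ge> 0" using y1 by simp
      have le: "exp (c * ?V) \<le> exp (B * \<bar>?V\<bar>)" if "c \<le> B" for c
        unfolding abs_of_nonneg[OF V0] exp_le_cancel_iff by (rule mult_right_mono[OF that V0])
      show ?thesis
      proof (cases "ln y \<le> N * ln t")
        case True
        have "exp (2 * \<kappa> + 3) * t\<^sup>2 \<le> C * t\<^sup>2" by (intro mult_right_mono) (auto simp: C_def)
        then have "exp (2 * \<kappa> + 3) * t\<^sup>2 \<le> y" using y by (simp add: t_def)
        then have "?E \<le> real (Psi x y) * ?S * exp (4 * exp \<kappa> * N * ?V)"
          using N k tT yx True x unfolding t_def by (intro moment_dense_range \<kappa>_def) auto
        also have "\<dots> \<le> 224 * real (Psi x y) * ?S * exp (B * \<bar>?V\<bar>)"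
          by (rule mult_mono[OF _ le[OF B(2)]]) (use S0 in \<open>auto intro!: mult_right_mono\<close>)
        finally show ?thesis .
      next
        case False
        then have "ln (t powr N) \<le> ln y" using tT by (simp add: ln_powr)
        then have tN: "t powr N \<le> y" using tT y1 by (subst (asm) ln_le_cancel_iff) auto
        have "smooth_growth x y"
        proof
          show "1 \<le> x" using x by simp
          have "60 * 1 \<le> N * ln t" using N lnt by (intro mult_mono) auto
          then have "60 \<le> ln y" using False by simp
          then show "exp 60 \<le> y" using y1 by (simp add: ln_ge_iff)
          have "1 + t \<le> t powr 2"
          proof -
            have "3 * t \<le> t * t" using tT by simp
            then have "1 + t \<le> t\<^sup>2" using tT unfolding power2_eq_square by linarith
            then show ?thesis using tT by (simp add: powr_numeral)
          qed
          then have "(1 + t) powr (3200 * exp 22) \<le> (t powr 2) powr (3200 * exp 22)"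
            using tT by (intro powr_mono2) auto
          also have "\<dots> = t powr N" by (simp add: powr_powr N_def)
          finally show "(1 + ln x) powr (3200 * exp 22) \<le> y" using tN by (simp add: t_def)
        qed
        then have "?E \<le> 224 * real (Psi x y) * ?S * exp (384 * ?V)"
          using k tT unfolding t_def by (intro moment_sparse_range) auto
        also have "\<dots> \<le> 224 * real (Psi x y) * ?S * exp (B * \<bar>?V\<bar>)"
          by (rule mult_left_mono[OF le[OF B(1)]]) (use S0 in auto)
        finally show ?thesis .
      qed
    qed
    moreover have "?S = (real k * ln y * (ln x)\<^sup>2 / y) powr (1 / 2)" using y1 by (simp add: powr_half_sqrt)
    ultimately show "prob_space.expectation M
        (\<lambda>\<omega>. norm ((\<Sum>n\<in>ints_upto x. X n \<omega>) - Psi0 x y (\<lambda>n. X n \<omega>)) ^ (2 * k))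
          powr (1 / (2 * real k))
      \<le> 224 * real (Psi x y) * (real k * ln y * (ln x)\<^sup>2 / y) powr (1 / 2)
          * exp (B * \<bar>real k * (ln x)\<^sup>2 * ln (ln x) / y\<bar>)"
      by (simp only: remainder_moment_def)
  qed simp
qed

end
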